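(* There is an algorithm which, given a cutting of the pizza into $n$ slices (the list of slice sizes), performs a precomputation in time $O(n)$ and then, during the game, decides each of Alice's turns in time $O(1)$, in such a way that Alice makes at most two jumps and her total gain is at least $g(n)|P|$, where $g(n)=1$ if $n=1$, $g(n)=4/9$ if $n\in\{15,17,19,\dots\}$, and $g(n)=1/2$ otherwise.
   Context: The pizza game: a pizza is cut into $n\ge1$ slices forming a circular sequence $P=p_0p_1\dots p_{n-1}$ (indices modulo $n$, $p_i$ adjacent to $p_{i\pm1}$), each slice having a size $|p_i|\ge 0$; $|P|=\sum_i|p_i|$. Alice and Bob alternately take slices, one per turn, Alice first. In the first turn Alice may take any slice; in every later turn the player must take a slice that has a neighbor already taken. For $1<j\le n$, if a player took $p_i$ in turn $j-1$ and the other player takes $p_{i-1}$ or $p_{i+1}$ in turn $j$, turn $j$ is a shift; otherwise it is a jump. Arithmetic operations on slice sizes are assumed to take constant time. *)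

theory Defs
  imports Complex_Main "HOL-Library.Landau_Symbols"
begin

section \<open>The pizza game\<close>

text \<open>A cutting is the list of its slice sizes. A play is the list of the slices in the order
  in which they are taken, so entry \<open>j\<close> is taken in turn \<open>j + 1\<close> and Alice owns the even
  positions.\<close>

definition cutting :: "real list \<Rightarrow> bool" where
  "cutting P \<longleftrightarrow> P \<noteq> [] \<and> (\<forall>x \<in> set P. 0 \<le> x)"

definition neighbor :: "nat \<Rightarrow> nat \<Rightarrow> nat \<Rightarrow> bool" where
  "neighbor n i j \<longleftrightarrow> j = (i + 1) mod n \<or> i = (j + 1) mod n"

definition legal_move :: "nat \<Rightarrow> nat list \<Rightarrow> nat \<Rightarrow> bool" where
  "legal_move n xs i \<longleftrightarrow>
     i < n \<and> i \<notin> set xs \<and> (xs = [] \<or> (\<exists>j \<in> set xs. neighbor n j i))"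

definition alice_gain :: "real list \<Rightarrow> nat list \<Rightarrow> real" where
  "alice_gain P xs = (\<Sum>j | j < length xs \<and> even j. P ! (xs ! j))"

definition jump :: "nat \<Rightarrow> nat list \<Rightarrow> nat \<Rightarrow> bool" where
  "jump n xs j \<longleftrightarrow> 0 < j \<and> j < length xs \<and> \<not> neighbor n (xs ! (j - 1)) (xs ! j)"

definition alice_jumps :: "nat \<Rightarrow> nat list \<Rightarrow> nat" where
  "alice_jumps n xs = card {j. even j \<and> jump n xs j}"

definition gain_bound :: "nat \<Rightarrow> real" where
  "gain_bound n = (if n = 1 then 1 else if odd n \<and> 15 \<le> n then 4 / 9 else 1 / 2)"


section \<open>Programs\<close>

text \<open>The machine is a real RAM. Integers, which serve as indices, and reals are kept in separate
  variables and arrays. Reals support the four arithmetic operations and comparison; they cannot be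
  rounded to integers. Integers support only addition, subtraction and comparison, so that the
  unit-cost assumption gives no bit-parallelism through integer multiplication. Real constants
  are rational, so that a program cannot contain an infinite table encoded as a real number.\<close>

type_synonym vname = string

datatype iexp =
    IConst int
  | IVar vname
  | ILoad vname iexp
  | IAdd iexp iexp
  | ISub iexp iexp

datatype rexp =
    RConst rat
  | RVar vname
  | RLoad vname iexp
  | RAdd rexp rexp
  | RSub rexp rexp
  | RMul rexp rexp
  | RDiv rexp rexp

datatype bexp =
    ILe iexp iexp
  | RLe rexp rexp
  | BNot bexp
  | BAnd bexp bexp

datatype com =
    Skip
  | IAssign vname iexp
  | IStore vname iexp iexp
  | RAssign vname rexp
  | RStore vname iexp rexp
  | Seq com com
  | If bexp com com
  | While bexp com

record mem =
  ivar :: "vname \<Rightarrow> int"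
  iarr :: "vname \<Rightarrow> int \<Rightarrow> int"
  rvar :: "vname \<Rightarrow> real"
  rarr :: "vname \<Rightarrow> int \<Rightarrow> real"

fun ival :: "iexp \<Rightarrow> mem \<Rightarrow> int" where
  "ival (IConst c) s = c"
| "ival (IVar x) s = ivar s x"
| "ival (ILoad a e) s = iarr s a (ival e s)"
| "ival (IAdd e f) s = ival e s + ival f s"
| "ival (ISub e f) s = ival e s - ival f s"

fun rval :: "rexp \<Rightarrow> mem \<Rightarrow> real" where
  "rval (RConst c) s = of_rat c"
| "rval (RVar x) s = rvar s x"
| "rval (RLoad a e) s = rarr s a (ival e s)"
| "rval (RAdd e f) s = rval e s + rval f s"
| "rval (RSub e f) s = rval e s - rval f s"
| "rval (RMul e f) s = rval e s * rval f s"
| "rval (RDiv e f) s = rval e s / rval f s"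

fun bval :: "bexp \<Rightarrow> mem \<Rightarrow> bool" where
  "bval (ILe e f) s \<longleftrightarrow> ival e s \<le> ival f s"
| "bval (RLe e f) s \<longleftrightarrow> rval e s \<le> rval f s"
| "bval (BNot b) s \<longleftrightarrow> \<not> bval b s"
| "bval (BAnd b c) s \<longleftrightarrow> bval b s \<and> bval c s"

text \<open>\<open>exec c s k t\<close>: started in memory \<open>s\<close>, the program \<open>c\<close> terminates in memory \<open>t\<close> after
  \<open>k\<close> steps. Every assignment and every test counts as one step. The expressions
  occurring in a program have bounded size, so counting each single operation instead
  would change \<open>k\<close> only by a constant factor depending on \<open>c\<close> alone.\<close>

inductive exec :: "com \<Rightarrow> mem \<Rightarrow> nat \<Rightarrow> mem \<Rightarrow> bool" where
  Skip: "exec Skip s 1 s"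
| IAssign: "exec (IAssign x e) s 1 (s\<lparr>ivar := (ivar s)(x := ival e s)\<rparr>)"
| IStore: "exec (IStore a i e) s 1
     (s\<lparr>iarr := (iarr s)(a := (iarr s a)(ival i s := ival e s))\<rparr>)"
| RAssign: "exec (RAssign x e) s 1 (s\<lparr>rvar := (rvar s)(x := rval e s)\<rparr>)"
| RStore: "exec (RStore a i e) s 1
     (s\<lparr>rarr := (rarr s)(a := (rarr s a)(ival i s := rval e s))\<rparr>)"
| Seq: "\<lbrakk>exec c s k t; exec d t l u\<rbrakk> \<Longrightarrow> exec (Seq c d) s (k + l) u"
| IfTrue: "\<lbrakk>bval b s; exec c s k t\<rbrakk> \<Longrightarrow> exec (If b c d) s (k + 1) t"
| IfFalse: "\<lbrakk>\<not> bval b s; exec d s k t\<rbrakk> \<Longrightarrow> exec (If b c d) s (k + 1) t"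
| WhileFalse: "\<not> bval b s \<Longrightarrow> exec (While b c) s 1 s"
| WhileTrue: "\<lbrakk>bval b s; exec c s k t; exec (While b c) t l u\<rbrakk> \<Longrightarrow>
     exec (While b c) s (k + l + 1) u"

inductive_cases exec_SkipE: "exec Skip s k t"
inductive_cases exec_IAssignE: "exec (IAssign x e) s k t"
inductive_cases exec_IStoreE: "exec (IStore a i e) s k t"
inductive_cases exec_RAssignE: "exec (RAssign x e) s k t"
inductive_cases exec_RStoreE: "exec (RStore a i e) s k t"
inductive_cases exec_SeqE: "exec (Seq c d) s k t"
inductive_cases exec_IfE: "exec (If b c d) s k t"
inductive_cases exec_WhileE: "exec (While b c) s k t"

lemma exec_deterministic:
  assumes "exec c s k t" and "exec c s l u"
  shows "l = k \<and> u = t"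
  using assms
proof (induction arbitrary: l u rule: exec.induct)
  case Skip
  then show ?case by (elim exec_SkipE) simp
next
  case IAssign
  then show ?case by (elim exec_IAssignE) simp
next
  case IStore
  then show ?case by (elim exec_IStoreE) simp
next
  case RAssign
  then show ?case by (elim exec_RAssignE) simp
next
  case RStore
  then show ?case by (elim exec_RStoreE) simp
next
  case (Seq c s k t d l' t')
  from Seq.prems obtain k1 k2 m where "exec c s k1 m" "exec d m k2 u" "l = k1 + k2"
    by (elim exec_SeqE) blast
  then show ?case using Seq.IH(1)[of k1 m] Seq.IH(2)[of k2 u] by simp
next
  case (IfTrue b s c k t d)
  from IfTrue.prems IfTrue.hyps(1) obtain k1 where "exec c s k1 u" "l = k1 + 1"
    by (elim exec_IfE) auto
  then show ?case using IfTrue.IH[of k1 u] by simp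
next
  case (IfFalse b s d k t c)
  from IfFalse.prems IfFalse.hyps(1) obtain k1 where "exec d s k1 u" "l = k1 + 1"
    by (elim exec_IfE) auto
  then show ?case using IfFalse.IH[of k1 u] by simp
next
  case (WhileFalse b s c)
  show ?case
    by (rule exec_WhileE[OF WhileFalse.prems]) (use WhileFalse.hyps in auto)
next
  case (WhileTrue b s c k t l' t')
  obtain k1 k2 m where "exec c s k1 m" "exec (While b c) m k2 u" "l = k1 + k2 + 1"
    by (rule exec_WhileE[OF WhileTrue.prems]) (use WhileTrue.hyps(1) in auto)
  then show ?case using WhileTrue.IH(1)[of k1 m] WhileTrue.IH(2)[of k2 u] by simp
qed


section \<open>Playing the game by a program\<close>

text \<open>All memory cells not holding the input are zero.\<close>

definition input :: "real list \<Rightarrow> mem" where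
  "input P =
     \<lparr>ivar = (\<lambda>_. 0)(''n'' := int (length P)),
      iarr = (\<lambda>_ _. 0),
      rvar = (\<lambda>_. 0),
      rarr = (\<lambda>_ _. 0)(''p'' := (\<lambda>i. if 0 \<le> i \<and> i < int (length P) then P ! nat i else 0))\<rparr>"

text \<open>Before each of her turns Alice's program is told the slice just taken by Bob; in the
  first turn there is none, which is signalled by \<open>- 1\<close>.\<close>

definition observe :: "nat list \<Rightarrow> mem \<Rightarrow> mem" where
  "observe xs s =
     s\<lparr>ivar := (ivar s)(''bob'' := (if xs = [] then - 1 else int (last xs)))\<rparr>"

definition answer :: "mem \<Rightarrow> int" where
  "answer s = ivar s ''alice''"

text \<open>\<open>reachable pre turn P xs s\<close>: on the cutting \<open>P\<close>, Alice precomputing with \<open>pre\<close> and then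
  deciding every turn with \<open>turn\<close>, the moves \<open>xs\<close> may have been made, Bob's ones being arbitrary
  legal moves, and Alice's memory is then \<open>s\<close>. It persists between her turns.\<close>

inductive reachable :: "com \<Rightarrow> com \<Rightarrow> real list \<Rightarrow> nat list \<Rightarrow> mem \<Rightarrow> bool"
  for pre turn :: com and P :: "real list" where
  precomputed: "exec pre (input P) k s \<Longrightarrow> reachable pre turn P [] s"
| alice: "\<lbrakk>reachable pre turn P xs s; even (length xs); length xs < length P;
     exec turn (observe xs s) k t; answer t = int i\<rbrakk> \<Longrightarrow> reachable pre turn P (xs @ [i]) t"
| bob: "\<lbrakk>reachable pre turn P xs s; odd (length xs); legal_move (length P) xs i\<rbrakk> \<Longrightarrow>
     reachable pre turn P (xs @ [i]) s"

end

theory Submission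
  imports Defs
begin

text \<open>For even \<open>n\<close> Alice always follows Bob and obtains all slices of the heavier parity. For odd
  \<open>n = 2 * h - 1\<close>, order the slices cyclically by steps of two. As long as Alice follows Bob she
  owns an arc of this order, in the end a half-circle (\<open>h\<close> consecutive slices), so she can
  guarantee the smallest half-circle through her first slice. If this is less than half of the pizza
  for every start, three half-circles \<open>a b c\<close>, \<open>c d e\<close>, \<open>e f a\<close>, none larger than that guarantee,
  cover the order. The pizza then splits into three intervals in which the slices of \<open>b\<close> and \<open>e\<close>,
  of \<open>d\<close> and \<open>a\<close>, of \<open>f\<close> and \<open>c\<close> alternate. Inside an interval a jump exchanges the roles of
  the two kinds of slices. Starting at a slice of the inner kind \<open>b\<close> and jumping when Bob takes an end
  of the interval, or starting at the outer kind \<open>e\<close> and jumping once more in the interior, Alice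
  secures \<open>min b (b / 2 + e / 4)\<close>, or \<open>b\<close> if it is a single slice, besides what a half-circle
  outside yields. The best of these bounds is at least 4/9 of the pizza by linear programming
  duality, and at least 1/2 if some interval has a single inner slice, as is the case for
  \<open>n < 15\<close>.\<close>

section \<open>Plans\<close>

text \<open>Up to an offset fixed by the switch, Alice's share of a segment depends only on where
  she leaves it: \<open>R i\<close> on the right, \<open>L j\<close> on the left. Both
  \<open>L j\<close> and \<open>R j\<close> contain the \<open>j\<close>-th inner slice, so together
  they are at least the whole segment, and a low left share forces a high right one. If the inner
  start is unsafe, there are a low right share \<open>R M\<close> and, further right, a low left
  share \<open>L N\<close>. These indices become the switch slices of the outer start, because a
  switch there raises all later shares by the difference from the low one. The constant
  \<open>b / 2 + e / 4\<close> comes from asking when the outer start fails as well: then four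
  shares total less than \<open>4 * t\<close>, their complements can differ only by outer slices
  from two disjoint ranges, and so \<open>2 * (b + e) - 4 * t < e\<close>. The first half-circle is
  a smallest one of all, so it bounds the play outside two of the segments; for the remaining
  segment the other two half-circles must be chosen well. 4/9 is the exact optimum of the linear
  program: arcs \<open>a\<close> to \<open>f\<close> of sizes 0, 3, 0, 2, 2, 2 make the bound
  without jumps and all three segment bounds equal to 4 out of 9.\<close>

text \<open>Alice answers next to Bob except when he takes a switch slice in phase 0 or an end slice in
  phase 1: then she jumps and the phase increases. Phase 2 is free of jumps.\<close>

record plan =
  first_slice :: int
  first_phase :: int
  switch1 :: int
  switch2 :: int
  end1 :: int
  end2 :: int

definition trigger :: "plan \<Rightarrow> int \<Rightarrow> int \<Rightarrow> bool" where
  "trigger q ph x \<longleftrightarrow>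
     ph = 0 \<and> (x = switch1 q \<or> x = switch2 q) \<or> ph = 1 \<and> (x = end1 q \<or> x = end2 q)"

locale pizza =
  fixes P :: "real list"
  assumes cutting: "cutting P"
begin

definition n :: int where "n = int (length P)"

definition slice :: "int \<Rightarrow> real" where "slice x = P ! nat (x mod n)"

text \<open>\<open>Good ph l r G\<close> is an invariant of Bob's turns: in phase \<open>ph\<close> the slices \<open>l\<close> to \<open>r\<close> (modulo \<open>n\<close>)
  are taken and Alice has gained \<open>G\<close>.\<close>

definition wins :: "plan \<Rightarrow> real \<Rightarrow> bool" where
  "wins q \<tau> \<longleftrightarrow> first_phase q \<in> {0..2} \<and>
     (\<exists>Good. Good (first_phase q) (first_slice q) (first_slice q) (slice (first_slice q)) \<and>
       (\<forall>ph l r G. Good ph l r G \<longrightarrow>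
         (n - 2 \<le> r - l \<longrightarrow> \<tau> \<le> G) \<and>
         (r - l < n - 2 \<longrightarrow>
           (if trigger q ph ((r + 1) mod n) then Good (ph + 1) (l - 1) (r + 1) (G + slice (l - 1))
            else Good ph l (r + 2) (G + slice (r + 2))) \<and>
           (if trigger q ph ((l - 1) mod n) then Good (ph + 1) (l - 1) (r + 1) (G + slice (r + 1))
            else Good ph (l - 2) r (G + slice (l - 2))))))"

lemma n_pos: "0 < n"
  using cutting by (simp add: n_def cutting_def)

lemma slice_nonneg: "0 \<le> slice x"
  using cutting n_pos by (auto simp: slice_def cutting_def n_def nat_less_iff)

lemma slice_shift [simp]: "slice (x + n * i) = slice x"
  by (simp add: slice_def)

lemma slice_mod [simp]: "slice (x mod n) = slice x"
  by (simp add: slice_def)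

lemma sum_slice: "(\<Sum>x\<in>{0..<n}. slice x) = sum_list P"
proof -
  have "(\<Sum>x\<in>{0..<n}. slice x) = (\<Sum>i\<in>{0..<length P}. slice (int i))"
    by (rule sum.reindex_bij_witness[of _ int nat]) (auto simp: n_def)
  also have "\<dots> = (\<Sum>i\<in>{0..<length P}. P ! i)"
    by (rule sum.cong) (auto simp: slice_def n_def nat_mod_distrib)
  finally show ?thesis by (simp add: sum_list_sum_nth)
qed

text \<open>The extension to negative arguments makes \<open>W j - W i\<close> the size of an arc for all \<open>i \<le> j\<close>.\<close>

definition W :: "int \<Rightarrow> real" where
  "W j = (if 0 \<le> j then \<Sum>i\<in>{0..<j}. slice (2 * i) else - (\<Sum>i\<in>{j..<0}. slice (2 * i)))"

lemma W_0 [simp]: "W 0 = 0"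
  by (simp add: W_def)

lemma W_add1: "W (j + 1) = W j + slice (2 * j)"
proof (cases "0 \<le> j")
  case True
  then have "{0..<j + 1} = insert j {0..<j}" by auto
  then show ?thesis using True by (simp add: W_def)
next
  case False
  then have "{j..<0} = insert j {j + 1..<0}" by auto
  then show ?thesis using False by (auto simp: W_def)
qed

lemma W_mono:
  assumes "a \<le> b"
  shows "W a \<le> W b"
  using assms
proof (induction b rule: int_ge_induct)
  case (step i)
  then show ?case using slice_nonneg[of "2 * i"] by (simp add: W_add1)
qed simp

end

section \<open>Odd number of slices: the cyclic order by steps of two and its half-circles\<close>

locale odd_pizza = pizza +
  fixes h :: int
  assumes n_h: "n = 2 * h - 1"
begin

lemma h_pos: "1 \<le> h"
  using n_h n_pos by simp

text \<open>Since \<open>2 * h = n + 1\<close>, multiplication by \<open>h\<close> inverts doubling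
  modulo \<open>n\<close>, so steps of two visit every slice exactly once.\<close>

lemma W_n: "W n = sum_list P"
proof -
  have inj: "inj_on (\<lambda>i. (2 * i) mod n) {0..<n}"
  proof (rule inj_onI)
    fix x y assume xy: "x \<in> {0..<n}" "y \<in> {0..<n}" "(2 * x) mod n = (2 * y) mod n"
    have "h * (2 * x) mod n = h * (2 * y) mod n" by (rule mod_mult_cong) (use xy in auto)
    moreover have "h * (2 * z) = z + n * z" for z by (simp add: n_h algebra_simps)
    ultimately show "x = y" using xy by simp
  qed
  have "(\<lambda>i. (2 * i) mod n) ` {0..<n} = {0..<n}"
    by (rule endo_inj_surj[OF _ _ inj]) (use n_pos in auto)
  then have "(\<Sum>x\<in>{0..<n}. slice x) = (\<Sum>i\<in>{0..<n}. slice ((2 * i) mod n))"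
    using sum.reindex[OF inj, of slice] by (simp add: o_def)
  then show ?thesis using sum_slice n_pos by (simp add: W_def)
qed

lemma W_shift: "W (j + n) = W j + sum_list P"
proof -
  have step: "W (j + 1 + n) - W (j + 1) = W (j + n) - W j" for j
    using W_add1[of "j + n"] W_add1[of j] slice_shift[of "2 * j" 2] by (simp add: algebra_simps)
  have "W (j + n) - W j = W (0 + n) - W 0"
  proof (induction j rule: int_induct[of _ 0])
    case (step1 i) then show ?case using step[of i] by simp
  next
    case (step2 i) then show ?case using step[of "i - 1"] by simp
  qed simp
  then show ?thesis using W_n by simp
qed

definition S :: "int \<Rightarrow> real" where "S j = W (j + h) - W j"

lemma S_shift: "S (j + n) = S j"
  using W_shift[of j] W_shift[of "j + h"] by (simp add: S_def algebra_simps)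

text \<open>From here on \<open>j\<close> stands for slice \<open>2 * j\<close>. With this numbering Alice's slices form the arc
  from \<open>l\<close> to \<open>r\<close> as long as she does not jump, and Bob can take \<open>r + h\<close> or \<open>l + h - 1\<close>.\<close>

lemma wins_oddI:
  assumes ph: "first_phase q \<in> {0..2}"
    and start: "first_slice q = (2 * \<sigma>) mod n"
    and init: "Good (first_phase q) \<sigma> \<sigma> (slice (2 * \<sigma>))"
    and arc: "\<And>ph l r G. Good ph l r G \<Longrightarrow> r - l < h"
    and fin: "\<And>ph l r G. Good ph l r G \<Longrightarrow> r - l = h - 1 \<Longrightarrow> \<tau> \<le> G"
    and right_jump: "\<And>ph l r G. Good ph l r G \<Longrightarrow> r - l < h - 1 \<Longrightarrow> trigger q ph ((2 * (r + h)) mod n) \<Longrightarrow>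
      Good (ph + 1) (l + h - 1) (r + h) (G + slice (2 * (l + h - 1)))"
    and right: "\<And>ph l r G. Good ph l r G \<Longrightarrow> r - l < h - 1 \<Longrightarrow> \<not> trigger q ph ((2 * (r + h)) mod n) \<Longrightarrow>
      Good ph l (r + 1) (G + slice (2 * (r + 1)))"
    and left_jump: "\<And>ph l r G. Good ph l r G \<Longrightarrow> r - l < h - 1 \<Longrightarrow> trigger q ph ((2 * (l + h - 1)) mod n) \<Longrightarrow>
      Good (ph + 1) (l + h - 1) (r + h) (G + slice (2 * (r + h)))"
    and left: "\<And>ph l r G. Good ph l r G \<Longrightarrow> r - l < h - 1 \<Longrightarrow> \<not> trigger q ph ((2 * (l + h - 1)) mod n) \<Longrightarrow>
      Good ph (l - 1) r (G + slice (2 * (l - 1)))"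
  shows "wins q \<tau>"
proof -
  \<comment> \<open>The doubled indices of the new ends after a jump are
    \<open>2 * (a + h - 1)\<close> and \<open>2 * (b + h)\<close>, which exceed
    \<open>2 * a - 1\<close> and \<open>2 * b + 1\<close> by \<open>n\<close>. Pizza positions,
    which are not reduced, therefore agree with doubled indices only up to a common multiple of
    \<open>n\<close>.\<close>
  define Good' where "Good' ph l r G \<longleftrightarrow>
    (\<exists>a b i. l = 2 * a + n * i \<and> r = 2 * b + n * i \<and> Good ph a b G)" for ph l r G
  have GoodI: "Good' ph l r G" if "l = 2 * a + n * i" "r = 2 * b + n * i" "Good ph a b G" for ph l r G a b i
    using that unfolding Good'_def by blast
  have "Good' (first_phase q) (first_slice q) (first_slice q) (slice (first_slice q))"
  proof -
    have "first_slice q = 2 * \<sigma> + n * (- (2 * \<sigma> div n))"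
      using start by (simp add: minus_div_mult_eq_mod[symmetric] algebra_simps)
    moreover have "slice (first_slice q) = slice (2 * \<sigma>)" by (simp add: start)
    ultimately show ?thesis using init unfolding Good'_def by metis
  qed
  moreover have "(n - 2 \<le> r - l \<longrightarrow> \<tau> \<le> G) \<and>
      (r - l < n - 2 \<longrightarrow>
        (if trigger q ph ((r + 1) mod n) then Good' (ph + 1) (l - 1) (r + 1) (G + slice (l - 1))
         else Good' ph l (r + 2) (G + slice (r + 2))) \<and>
        (if trigger q ph ((l - 1) mod n) then Good' (ph + 1) (l - 1) (r + 1) (G + slice (r + 1))
         else Good' ph (l - 2) r (G + slice (l - 2))))"
    if good: "Good' ph l r G" for ph l r G
  proof -
    obtain a b i where *: "l = 2 * a + n * i" "r = 2 * b + n * i" "Good ph a b G"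
      using good unfolding Good'_def by blast
    have m1: "(2 * (b + h)) mod n = (r + 1) mod n"
    proof -
      have "2 * (b + h) = r + 1 + n * (1 - i)" by (simp add: * n_h algebra_simps)
      then show ?thesis by (simp only: mod_mult_self2)
    qed
    have m2: "(2 * (a + h - 1)) mod n = (l - 1) mod n"
    proof -
      have "2 * (a + h - 1) = l - 1 + n * (1 - i)" by (simp add: * n_h algebra_simps)
      then show ?thesis by (simp only: mod_mult_self2)
    qed
    have rep: "l - 1 = 2 * (a + h - 1) + n * (i - 1)" "r + 1 = 2 * (b + h) + n * (i - 1)"
      "r + 2 = 2 * (b + 1) + n * i" "l - 2 = 2 * (a - 1) + n * i"
      by (simp_all add: * n_h algebra_simps)
    have s1: "slice (l - 1) = slice (2 * (a + h - 1))" by (simp only: rep slice_shift)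
    have s2: "slice (r + 1) = slice (2 * (b + h))" by (simp only: rep slice_shift)
    have s3: "slice (r + 2) = slice (2 * (b + 1))" by (simp only: rep slice_shift)
    have s4: "slice (l - 2) = slice (2 * (a - 1))" by (simp only: rep slice_shift)
    have "\<tau> \<le> G" if "n - 2 \<le> r - l"
      using that arc[OF *(3)] fin[OF *(3)] by (simp add: * n_h)
    moreover have "(if trigger q ph ((r + 1) mod n) then Good' (ph + 1) (l - 1) (r + 1) (G + slice (l - 1))
         else Good' ph l (r + 2) (G + slice (r + 2)))" if "r - l < n - 2"
    proof -
      have lt: "b - a < h - 1" using that by (simp add: * n_h)
      show ?thesis
      proof (cases "trigger q ph ((r + 1) mod n)")
        case True
        then have "Good (ph + 1) (a + h - 1) (b + h) (G + slice (l - 1))"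
          using right_jump[OF *(3) lt] m1 s1 by simp
        from GoodI[OF rep(1,2) this] show ?thesis by (simp only: True if_True)
      next
        case False
        then have "Good ph a (b + 1) (G + slice (r + 2))"
          using right[OF *(3) lt] m1 s3 by simp
        from GoodI[OF *(1) rep(3) this] show ?thesis by (simp only: False if_False)
      qed
    qed
    moreover have "(if trigger q ph ((l - 1) mod n) then Good' (ph + 1) (l - 1) (r + 1) (G + slice (r + 1))
         else Good' ph (l - 2) r (G + slice (l - 2)))" if "r - l < n - 2"
    proof -
      have lt: "b - a < h - 1" using that by (simp add: * n_h)
      show ?thesis
      proof (cases "trigger q ph ((l - 1) mod n)")
        case True
        then have "Good (ph + 1) (a + h - 1) (b + h) (G + slice (r + 1))"
          using left_jump[OF *(3) lt] m2 s2 by simp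
        from GoodI[OF rep(1,2) this] show ?thesis by (simp only: True if_True)
      next
        case False
        then have "Good ph (a - 1) b (G + slice (l - 2))"
          using left[OF *(3) lt] m2 s4 by simp
        from GoodI[OF rep(4) *(2) this] show ?thesis by (simp only: False if_False)
      qed
    qed
    ultimately show ?thesis by blast
  qed
  ultimately show ?thesis using ph unfolding wins_def by blast
qed

end

section \<open>Following Bob without jumps\<close>

context odd_pizza
begin

text \<open>Again \<open>h\<close> is the inverse of 2 modulo \<open>n\<close>, so indices in a
  window shorter than \<open>n\<close> name different slices. The summand \<open>n * i\<close>
  admits an index that is some full turns ahead.\<close>

lemma mod_eq_iff_V:
  assumes "\<bar>a - b\<bar> < n"
  shows "(2 * (a + n * i)) mod n = (2 * b) mod n \<longleftrightarrow> a = b"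
proof
  assume eq: "(2 * (a + n * i)) mod n = (2 * b) mod n"
  have "h * (2 * (a + n * i)) mod n = h * (2 * b) mod n" by (rule mod_mult_cong) (use eq in auto)
  moreover have "h * (2 * (a + n * i)) = a + n * (a + 2 * h * i)"  "h * (2 * b) = b + n * b"
    by (simp_all add: n_h algebra_simps)
  ultimately have "a mod n = b mod n" by (metis mod_mult_self2)
  then have "n dvd a - b" by (simp add: mod_eq_dvd_iff)
  then show "a = b" using assms by (meson dvd_imp_le_int eq_iff_diff_eq_0 not_less abs_ge_zero dvd_abs_iff
      abs_eq_0 order_le_less zdvd_not_zless zero_less_abs_iff)
next
  assume "a = b"
  moreover have "2 * (b + n * i) = 2 * b + n * (2 * i)" by (simp add: algebra_simps)
  ultimately show "(2 * (a + n * i)) mod n = (2 * b) mod n" by (simp only: mod_mult_self2)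
qed

text \<open>\<open>S j\<close> ranges over the half-circles through the current arc, among which Bob chooses.\<close>

definition follows :: "real \<Rightarrow> int \<Rightarrow> int \<Rightarrow> real \<Rightarrow> bool" where
  "follows \<tau> l r G \<longleftrightarrow> l \<le> r \<and> r - l < h \<and> (\<forall>j\<in>{r + 1 - h..l}. \<tau> \<le> G - (W (r + 1) - W l) + S j)"

text \<open>The difference between the gain and the size of the current arc is constant while Alice
  answers next to Bob; only jumps change it. In \<open>follows\<close> it is the correction to be
  added to the final half-circle.\<close>

lemma gain_right: "G + slice (2 * (r + 1)) - (W (r + 1 + 1) - W l) = G - (W (r + 1) - W l)"
  using W_add1[of "r + 1"] by simp

lemma gain_left: "G + slice (2 * (l - 1)) - (W (r + 1) - W (l - 1)) = G - (W (r + 1) - W l)"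
  using W_add1[of "l - 1"] by simp

lemma follows_right: "follows \<tau> l r G \<Longrightarrow> r - l < h - 1 \<Longrightarrow> follows \<tau> l (r + 1) (G + slice (2 * (r + 1)))"
  unfolding follows_def gain_right by auto

lemma follows_left: "follows \<tau> l r G \<Longrightarrow> r - l < h - 1 \<Longrightarrow> follows \<tau> (l - 1) r (G + slice (2 * (l - 1)))"
  unfolding follows_def gain_left by auto

lemma follows_final:
  assumes "follows \<tau> l r G" "r - l = h - 1"
  shows "\<tau> \<le> G"
proof -
  have "r + 1 = l + h" using assms(2) by simp
  moreover have "\<tau> \<le> G - (W (r + 1) - W l) + S l" using assms unfolding follows_def by simp
  ultimately show ?thesis by (simp add: S_def)
qed

lemma follows_less: "follows \<tau> l r G \<Longrightarrow> r - l < h"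
  by (simp add: follows_def)

lemma wins_no_jump:
  assumes "first_phase q = 2" "first_slice q = (2 * \<sigma>) mod n"
    and "\<And>j. j \<in> {\<sigma> + 1 - h..\<sigma>} \<Longrightarrow> \<tau> \<le> S j"
  shows "wins q \<tau>"
proof (rule wins_oddI[where \<sigma> = \<sigma> and Good = "\<lambda>ph l r G. ph = 2 \<and> follows \<tau> l r G"])
  show "first_phase q = 2 \<and> follows \<tau> \<sigma> \<sigma> (slice (2 * \<sigma>))"
    using assms h_pos W_add1[of \<sigma>] by (auto simp: follows_def)
  show "first_phase q \<in> {0..2}" "first_slice q = (2 * \<sigma>) mod n" using assms by simp_all
qed (auto simp only: trigger_def intro: follows_right follows_left follows_final dest: follows_less)

end

section \<open>Segments\<close>

text \<open>On the pizza, the outer slices \<open>J, \<dots>, J + k\<close> alternate with the inner slices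
  \<open>J + h, \<dots>, J + h + k - 1\<close>, the \<open>i\<close>-th inner one lying between the outer ones \<open>J + i - 1\<close> and \<open>J + i\<close>.\<close>

locale segment = odd_pizza +
  fixes J k :: int and x t :: real
  assumes k: "1 \<le> k" "k < h"
    and x: "\<And>j. j \<in> {J + 1 - h..J + k} \<Longrightarrow> x \<le> S j"
begin

text \<open>\<open>R i\<close> is Alice's share of the segment if she has taken the inner slices from the \<open>i\<close>-th to the
  last one when Bob reaches the right end, and leaves him all inner slices before them; \<open>L j\<close> is the
  mirror image.\<close>

definition R :: "int \<Rightarrow> real" where
  "R i = (W (J + h + k) - W (J + h + i - 1)) + (W (J + i) - W J)"

definition L :: "int \<Rightarrow> real" where
  "L j = (W (J + h + j) - W (J + h)) + (W (J + k + 1) - W (J + j))"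

abbreviation inner :: real where "inner \<equiv> W (J + h + k) - W (J + h)"
abbreviation outer :: real where "outer \<equiv> W (J + k + 1) - W J"

text \<open>After leaving the segment Alice plays for a half-circle, of size at least
  \<open>x\<close>, in which outer slices are counted again although the share \<open>t\<close>
  already settles the whole segment. Hence the subtraction of \<open>outer\<close>.\<close>

definition target :: real where "target = t + x - outer"

text \<open>The current arc consists of the inner slices \<open>i\<close> to \<open>j\<close>. When
  it is left it has grown to \<open>i'..k\<close> if Bob reaches the right end first, and to
  \<open>1..j'\<close> if he reaches the left end first; the two families of bounds cover all these
  outcomes.\<close>

definition straddles :: "int \<Rightarrow> int \<Rightarrow> real \<Rightarrow> bool" where
  "straddles l r G \<longleftrightarrow> (\<exists>i j. l = J + h - 1 + i \<and> r = J + h - 1 + j \<and> 1 \<le> i \<and> i \<le> j \<and> j \<le> k \<and>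
     (\<forall>i'\<in>{1..i}. t \<le> G - (W (r + 1) - W l) + R i') \<and>
     (\<forall>j'\<in>{j..k}. t \<le> G - (W (r + 1) - W l) + L j'))"

definition phases :: "int \<Rightarrow> int \<Rightarrow> int \<Rightarrow> int \<Rightarrow> int \<Rightarrow> int \<Rightarrow> real \<Rightarrow> bool" where
  "phases M w N ph l r G \<longleftrightarrow>
     ph = 0 \<and> G = W (r + 1) - W l \<and> J + M \<le> l \<and> l \<le> J + w \<and> J + w \<le> r \<and> r < J + N \<or>
     ph = 1 \<and> straddles l r G \<or> ph = 2 \<and> follows target l r G"

lemma S_bound:
  assumes "j \<in> {J + n + 1 - h..J + n + k}"
  shows "x \<le> S j"
  using x[of "j - n"] S_shift[of "j - n"] assms by auto

lemma straddles_right: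
  assumes "straddles l r G" "r < J + h - 1 + k"
  shows "straddles l (r + 1) (G + slice (2 * (r + 1)))"
proof -
  obtain i j where *: "l = J + h - 1 + i" "r = J + h - 1 + j" "1 \<le> i" "i \<le> j" "j \<le> k"
    "\<forall>i'\<in>{1..i}. t \<le> G - (W (r + 1) - W l) + R i'" "\<forall>j'\<in>{j..k}. t \<le> G - (W (r + 1) - W l) + L j'"
    using assms(1) unfolding straddles_def by blast
  then show ?thesis unfolding straddles_def gain_right using assms(2)
    by - (rule exI[of _ i], rule exI[of _ "j + 1"], simp)
qed

lemma straddles_left:
  assumes "straddles l r G" "J + h < l"
  shows "straddles (l - 1) r (G + slice (2 * (l - 1)))"
proof -
  obtain i j where *: "l = J + h - 1 + i" "r = J + h - 1 + j" "1 \<le> i" "i \<le> j" "j \<le> k"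
    "\<forall>i'\<in>{1..i}. t \<le> G - (W (r + 1) - W l) + R i'" "\<forall>j'\<in>{j..k}. t \<le> G - (W (r + 1) - W l) + L j'"
    using assms(1) unfolding straddles_def by blast
  then show ?thesis unfolding straddles_def gain_left using assms(2)
    by - (rule exI[of _ "i - 1"], rule exI[of _ j], simp)
qed

text \<open>At the right end the arc size cancels against the inner part of \<open>R i\<close>,
  leaving \<open>t <= G + (W (J + i) - W J)\<close>. The jump makes the outer slices
  \<open>J + i - 1\<close> to \<open>J + k\<close> the current arc. A final half-circle
  \<open>S j\<close> then yields \<open>G + W (J + i) - W (J + k + 1) + S j\<close>, which is at
  least \<open>t - outer + x\<close>.\<close>

lemma straddles_right_end:
  assumes "straddles l r G" "r = J + h - 1 + k"
  shows "follows target (l + h - 1) (r + h) (G + slice (2 * (l + h - 1)))"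
proof -
  obtain i where *: "l = J + h - 1 + i" "1 \<le> i" "i \<le> k" "t \<le> G - (W (r + 1) - W l) + R i"
    using assms unfolding straddles_def by auto
  have l': "l + h - 1 = J + n + i - 1" and r': "r + h = J + n + k" using * assms(2) by (simp_all add: n_h)
  have all: "target \<le> G + slice (2 * (l + h - 1)) - (W (r + h + 1) - W (l + h - 1)) + S j"
    if j: "j \<in> {J + n + k + 1 - h..J + n + i - 1}" for j
  proof -
    have "x \<le> S j" using j k * by (intro S_bound) auto
    moreover have "W (J + n + i) = W (J + n + i - 1) + slice (2 * (J + n + i - 1))"
      using W_add1[of "J + n + i - 1"] by simp
    moreover have "W (J + n + i) = W (J + i) + sum_list P" "W (J + n + k + 1) = W (J + k + 1) + sum_list P"
      using W_shift[of "J + i"] W_shift[of "J + k + 1"] by (simp_all add: algebra_simps)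
    moreover have "t \<le> G + (W (J + i) - W J)"
    proof -
      have "l = J + h + i - 1" "r + 1 = J + h + k" using * assms(2) by auto
      then show ?thesis using *(4) by (simp add: R_def)
    qed
    ultimately show ?thesis unfolding target_def l' r' by linarith
  qed
  show ?thesis unfolding follows_def l' r' using all[unfolded l' r'] *(2,3) k by auto
qed

lemma straddles_left_end:
  assumes "straddles l r G" "l = J + h"
  shows "follows target (l + h - 1) (r + h) (G + slice (2 * (r + h)))"
proof -
  obtain j where *: "r = J + h - 1 + j" "1 \<le> j" "j \<le> k" "t \<le> G - (W (r + 1) - W l) + L j"
    using assms unfolding straddles_def by auto
  have l': "l + h - 1 = J + n" and r': "r + h = J + n + j" using * assms(2) by (simp_all add: n_h)
  have all: "target \<le> G + slice (2 * (r + h)) - (W (r + h + 1) - W (l + h - 1)) + S i"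
    if i: "i \<in> {J + n + j + 1 - h..J + n}" for i
  proof -
    have "x \<le> S i" using i k * by (intro S_bound) auto
    moreover have "W (J + n + j + 1) = W (J + n + j) + slice (2 * (J + n + j))"
      by (rule W_add1)
    moreover have "W (J + n + j) = W (J + j) + sum_list P" "W (J + n) = W J + sum_list P"
      using W_shift[of "J + j"] W_shift[of "J"] by (simp_all add: algebra_simps)
    moreover have "t \<le> G + (W (J + k + 1) - W (J + j))"
    proof -
      have "r + 1 = J + h + j" using * by simp
      then show ?thesis using *(4) assms(2) by (simp add: L_def)
    qed
    ultimately show ?thesis unfolding target_def l' r' by linarith
  qed
  show ?thesis unfolding follows_def l' r' using all[unfolded l' r'] *(2,3) k by auto
qed

text \<open>Phase 0 takes outer slices, phase 1 inner ones. A switch when Bob takes the \<open>M\<close>-th inner slice,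
  with the outer slices up to \<open>J + j\<close> taken, shifts all later shares by \<open>R (j + 1) - R M\<close>; a switch at
  the \<open>N\<close>-th one by \<open>L i - L N\<close>.\<close>

lemma wins_phases:
  assumes ph: "first_phase q \<in> {0, 1}"
    and start: "first_slice q = (2 * \<sigma>) mod n"
    and init: "phases M w N (first_phase q) \<sigma> \<sigma> (slice (2 * \<sigma>))"
    and ends: "end1 q = (2 * J) mod n" "end2 q = (2 * (J + k)) mod n"
    and switches: "first_phase q = 0 \<Longrightarrow> switch1 q = (2 * (J + h - 1 + M)) mod n"
      "first_phase q = 0 \<Longrightarrow> switch2 q = (2 * (J + h - 1 + N)) mod n"
    and bounds: "first_phase q = 0 \<Longrightarrow> 1 \<le> M" "first_phase q = 0 \<Longrightarrow> N \<le> k"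
    and sw_left: "\<And>i j. first_phase q = 0 \<Longrightarrow> i \<in> {1..M} \<Longrightarrow> j \<in> {w + 1..N} \<Longrightarrow> t + R M \<le> R j + R i"
      "\<And>i j. first_phase q = 0 \<Longrightarrow> j \<in> {w + 1..N} \<Longrightarrow> i \<in> {j..k} \<Longrightarrow> t + R M \<le> R j + L i"
    and sw_right: "\<And>i j. first_phase q = 0 \<Longrightarrow> i \<in> {M..w} \<Longrightarrow> j \<in> {N..k} \<Longrightarrow> t + L N \<le> L i + L j"
      "\<And>i j. first_phase q = 0 \<Longrightarrow> i \<in> {M..w} \<Longrightarrow> j \<in> {1..i} \<Longrightarrow> t + L N \<le> L i + R j"
  shows "wins q target"
proof (rule wins_oddI[where \<sigma> = \<sigma> and Good = "\<lambda>ph l r G. first_phase q \<le> ph \<and> phases M w N ph l r G"])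
  note simps = phases_def trigger_def
  have in_n: "k < n" using k h_pos by (simp add: n_h)
  \<comment> \<open>Next to an inner arc Bob takes outer slices, whose indices come out one full
    turn higher: \<open>r + h = (r - h + 1) + n\<close> and
    \<open>l + h - 1 = (l - h) + n\<close>.\<close>
  have end_right: "(2 * (r + h)) mod n = end1 q \<or> (2 * (r + h)) mod n = end2 q \<longleftrightarrow> r = J + h - 1 + k"
    if "J + h \<le> r" "r \<le> J + h - 1 + k" for r
    using mod_eq_iff_V[of "r - h + 1" J 1] mod_eq_iff_V[of "r - h + 1" "J + k" 1] that ends in_n
    by (auto simp: n_h algebra_simps)
  have end_left: "(2 * (l + h - 1)) mod n = end1 q \<or> (2 * (l + h - 1)) mod n = end2 q \<longleftrightarrow> l = J + h"
    if "J + h \<le> l" "l \<le> J + h - 1 + k" for l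
    using mod_eq_iff_V[of "l - h" J 1] mod_eq_iff_V[of "l - h" "J + k" 1] that ends in_n
    by (auto simp: n_h algebra_simps)
  have switch_right: "(2 * (r + h)) mod n = switch1 q \<or> (2 * (r + h)) mod n = switch2 q \<longleftrightarrow> r = J + N - 1"
    if "J + M \<le> r" "r < J + N" "first_phase q = 0" for r
    using mod_eq_iff_V[of "r + h" "J + h - 1 + M" 0] mod_eq_iff_V[of "r + h" "J + h - 1 + N" 0] that
      switches bounds in_n by (auto simp: algebra_simps)
  have switch_left: "(2 * (l + h - 1)) mod n = switch1 q \<or> (2 * (l + h - 1)) mod n = switch2 q \<longleftrightarrow> l = J + M"
    if "J + M \<le> l" "l < J + N" "first_phase q = 0" for l
    using mod_eq_iff_V[of "l + h - 1" "J + h - 1 + M" 0] mod_eq_iff_V[of "l + h - 1" "J + h - 1 + N" 0] that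
      switches bounds in_n by (auto simp: algebra_simps)
  show "first_phase q \<in> {0..2}" using ph by auto
  show "first_slice q = (2 * \<sigma>) mod n" by fact
  show "first_phase q \<le> first_phase q \<and> phases M w N (first_phase q) \<sigma> \<sigma> (slice (2 * \<sigma>))"
    using init by simp
  fix ph l r G
  assume good: "first_phase q \<le> ph \<and> phases M w N ph l r G"
  have cases: "(ph = 0 \<Longrightarrow> first_phase q = 0 \<Longrightarrow> G = W (r + 1) - W l \<Longrightarrow> J + M \<le> l \<Longrightarrow> l \<le> J + w \<Longrightarrow>
      J + w \<le> r \<Longrightarrow> r < J + N \<Longrightarrow> X) \<Longrightarrow> (ph = 1 \<Longrightarrow> straddles l r G \<Longrightarrow> J + h \<le> l \<Longrightarrow> l \<le> r \<Longrightarrow> r \<le> J + h - 1 + k \<Longrightarrow> X) \<Longrightarrow>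
      (ph = 2 \<Longrightarrow> follows target l r G \<Longrightarrow> X) \<Longrightarrow> X" for X
    using good ph unfolding phases_def straddles_def by auto
  show "r - l < h"
    by (rule cases) (use k bounds in \<open>auto simp: follows_def\<close>)
  show "target \<le> G" if "r - l = h - 1"
    by (rule cases) (use k bounds that in \<open>auto intro: follows_final\<close>)
  show "first_phase q \<le> ph + 1 \<and> phases M w N (ph + 1) (l + h - 1) (r + h) (G + slice (2 * (l + h - 1)))"
    if lt: "r - l < h - 1" and tr: "trigger q ph ((2 * (r + h)) mod n)"
  proof (rule cases)
    assume a: "ph = 0" "first_phase q = 0" "G = W (r + 1) - W l" "J + M \<le> l" "l \<le> J + w" "J + w \<le> r" "r < J + N"
    have r: "r = J + N - 1" using tr a switch_right[of r] by (auto simp: trigger_def)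
    have "straddles (l + h - 1) (r + h) (G + slice (2 * (l + h - 1)))"
      unfolding straddles_def
    proof (rule exI[of _ "l - J"], rule exI[of _ N], intro conjI ballI)
      have c: "G + slice (2 * (l + h - 1)) - (W (r + h + 1) - W (l + h - 1)) = L (l - J) - L N"
      proof -
        have "W (r + h + 1) = W (J + h + N)" "W (r + 1) = W (J + N)"
          "W (l + h - 1 + 1) = W (J + h + (l - J))" "W (J + (l - J)) = W l"
          by (rule arg_cong[where f = W], use r in simp)+
        then show ?thesis using W_add1[of "l + h - 1"] a(3) unfolding L_def by linarith
      qed
      show "t \<le> G + slice (2 * (l + h - 1)) - (W (r + h + 1) - W (l + h - 1)) + R i'" if "i' \<in> {1..l - J}" for i'
        unfolding c using sw_right(2)[of "l - J" i'] a that by auto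
      show "t \<le> G + slice (2 * (l + h - 1)) - (W (r + h + 1) - W (l + h - 1)) + L j'" if "j' \<in> {N..k}" for j'
        unfolding c using sw_right(1)[of "l - J" j'] a that by auto
    qed (use a r bounds in auto)
    then show ?thesis using a by (simp add: phases_def)
  next
    assume a: "ph = 1" "straddles l r G" "J + h \<le> l" "l \<le> r" "r \<le> J + h - 1 + k"
    then show ?thesis using straddles_right_end[of l r G] tr end_right[of r] good
      by (auto simp: phases_def trigger_def)
  qed (use tr in \<open>auto simp: trigger_def\<close>)
  show "first_phase q \<le> ph + 1 \<and> phases M w N (ph + 1) (l + h - 1) (r + h) (G + slice (2 * (r + h)))"
    if lt: "r - l < h - 1" and tr: "trigger q ph ((2 * (l + h - 1)) mod n)"
  proof (rule cases)
    assume a: "ph = 0" "first_phase q = 0" "G = W (r + 1) - W l" "J + M \<le> l" "l \<le> J + w" "J + w \<le> r" "r < J + N"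
    have l: "l = J + M" using tr a switch_left[of l] by (auto simp: trigger_def)
    have "straddles (l + h - 1) (r + h) (G + slice (2 * (r + h)))"
      unfolding straddles_def
    proof (rule exI[of _ M], rule exI[of _ "r - J + 1"], intro conjI ballI)
      have c: "G + slice (2 * (r + h)) - (W (r + h + 1) - W (l + h - 1)) = R (r - J + 1) - R M"
      proof -
        have "W (J + h + (r - J + 1) - 1) = W (r + h)" "W (J + (r - J + 1)) = W (r + 1)"
          "W (l + h - 1) = W (J + h + M - 1)" "W l = W (J + M)"
          by (rule arg_cong[where f = W], use l in simp)+
        then show ?thesis using W_add1[of "r + h"] a(3) unfolding R_def by linarith
      qed
      show "t \<le> G + slice (2 * (r + h)) - (W (r + h + 1) - W (l + h - 1)) + R i'" if "i' \<in> {1..M}" for i'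
        unfolding c using sw_left(1)[of i' "r - J + 1"] a that by auto
      show "t \<le> G + slice (2 * (r + h)) - (W (r + h + 1) - W (l + h - 1)) + L j'" if "j' \<in> {r - J + 1..k}" for j'
        unfolding c using sw_left(2)[of "r - J + 1" j'] a that by auto
    qed (use a l bounds in auto)
    then show ?thesis using a by (simp add: phases_def)
  next
    assume a: "ph = 1" "straddles l r G" "J + h \<le> l" "l \<le> r" "r \<le> J + h - 1 + k"
    then show ?thesis using straddles_left_end[of l r G] tr end_left[of l] good
      by (auto simp: phases_def trigger_def)
  qed (use tr in \<open>auto simp: trigger_def\<close>)
  show "first_phase q \<le> ph \<and> phases M w N ph l (r + 1) (G + slice (2 * (r + 1)))"
    if lt: "r - l < h - 1" and tr: "\<not> trigger q ph ((2 * (r + h)) mod n)"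
  proof (rule cases)
    assume a: "ph = 0" "first_phase q = 0" "G = W (r + 1) - W l" "J + M \<le> l" "l \<le> J + w" "J + w \<le> r" "r < J + N"
    have "r \<noteq> J + N - 1" using tr a switch_right[of r] by (auto simp: trigger_def)
    then show ?thesis using a W_add1[of "r + 1"] by (simp add: phases_def)
  next
    assume a: "ph = 1" "straddles l r G" "J + h \<le> l" "l \<le> r" "r \<le> J + h - 1 + k"
    have "r \<noteq> J + h - 1 + k" using tr a end_right[of r] by (auto simp: trigger_def)
    then show ?thesis using a straddles_right[of l r G] good by (simp add: phases_def)
  next
    assume "ph = 2" "follows target l r G"
    then show ?thesis using lt follows_right good by (simp add: phases_def)
  qed
  show "first_phase q \<le> ph \<and> phases M w N ph (l - 1) r (G + slice (2 * (l - 1)))"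
    if lt: "r - l < h - 1" and tr: "\<not> trigger q ph ((2 * (l + h - 1)) mod n)"
  proof (rule cases)
    assume a: "ph = 0" "first_phase q = 0" "G = W (r + 1) - W l" "J + M \<le> l" "l \<le> J + w" "J + w \<le> r" "r < J + N"
    have "l \<noteq> J + M" using tr a switch_left[of l] by (auto simp: trigger_def)
    then show ?thesis using a W_add1[of "l - 1"] by (simp add: phases_def)
  next
    assume a: "ph = 1" "straddles l r G" "J + h \<le> l" "l \<le> r" "r \<le> J + h - 1 + k"
    have "l \<noteq> J + h" using tr a end_left[of l] by (auto simp: trigger_def)
    then show ?thesis using a straddles_left[of l r G] good by (simp add: phases_def)
  next
    assume "ph = 2" "follows target l r G"
    then show ?thesis using lt follows_left good by (simp add: phases_def)
  qed
qed

end

section \<open>Start and switch slices inside a segment\<close>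

context segment
begin

text \<open>The \<open>j\<close>-th inner slice belongs to both shares, every other slice of the
  segment to exactly one of them.\<close>

lemma L_plus_R: "L j + R j = inner + outer + (W (J + h + j) - W (J + h + j - 1))"
  by (simp add: L_def R_def)

lemma L_plus_R_ge: "inner + outer \<le> L j + R j"
  using L_plus_R[of j] W_mono[of "J + h + j - 1" "J + h + j"] by simp

lemma inner_le_R1: "inner \<le> R 1"
  using W_mono[of J "J + 1"] by (simp add: R_def)

lemma L_drop: "i \<le> j \<Longrightarrow> L i - L j \<le> W (J + j) - W (J + i)"
  using W_mono[of "J + h + i" "J + h + j"] by (simp add: L_def)

context
  fixes v M :: int
  assumes t: "t \<le> inner" "k = 1 \<or> 4 * t \<le> 2 * inner + outer"
    and v: "v \<in> {1..k}" "\<And>j. j \<in> {v..k} \<Longrightarrow> t \<le> L j" "v = 1 \<or> L (v - 1) < t"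
    and M: "M \<in> {1..v}" "\<And>i. i \<in> {1..v} \<Longrightarrow> R M \<le> R i"
begin

text \<open>From \<open>v\<close> on every left share suffices. A start at the \<open>v\<close>-th
  inner slice can thus fail only through a right share up to \<open>v\<close>, and \<open>M\<close>
  gives the worst of these.\<close>

lemma wins_inner_start:
  assumes "t \<le> R M"
    and q: "first_phase q = 1" "first_slice q = (2 * (J + h - 1 + v)) mod n"
      "end1 q = (2 * J) mod n" "end2 q = (2 * (J + k)) mod n"
  shows "wins q target"
proof (rule wins_phases[where \<sigma> = "J + h - 1 + v" and M = 1 and N = 1 and w = 1])
  let ?s = "J + h - 1 + v"
  have "slice (2 * ?s) - (W (?s + 1) - W ?s) = 0" using W_add1[of ?s] by simp
  moreover have "t \<le> R i" if "i \<in> {1..v}" for i using M(2)[OF that] assms(1) by simp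
  ultimately have "straddles ?s ?s (slice (2 * ?s))" unfolding straddles_def
    using v(1,2) by (intro exI[of _ v]) simp
  then show "phases 1 1 1 (first_phase q) ?s ?s (slice (2 * ?s))" using q by (simp add: phases_def)
qed (use q in auto)

text \<open>A switch at \<open>M\<close> with the outer slices up to \<open>J + j - 1\<close> taken
  needs \<open>t + R M <= R j + R i\<close> for \<open>i <= M\<close> and
  \<open>t + R M <= R j + L i\<close> for \<open>i >= j\<close>. As \<open>R M\<close> and
  \<open>L N\<close> are minima, \<open>R j >= \<theta>\<close> suffices for both. Symmetrically, a
  switch at \<open>N\<close> needs \<open>L y >= max t (t + L N - R M)\<close>. Taking for
  \<open>w\<close> the last index violating the first threshold makes every \<open>j > w\<close>
  safe, and \<open>key\<close> shows that every \<open>y <= w\<close> meets the second one.\<close>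

lemma wins_outer_start:
  fixes N w :: int
  defines "\<theta> \<equiv> max t (t + R M - L N)"
  assumes RM: "R M < t"
    and N: "N \<in> {M..k}" "\<And>j. j \<in> {M..k} \<Longrightarrow> L N \<le> L j"
    and w: "w \<in> {M..N}" "R w < \<theta>" "\<And>j. j \<in> {w + 1..N} \<Longrightarrow> \<theta> \<le> R j"
    and q: "first_phase q = 0" "first_slice q = (2 * (J + w)) mod n"
      "end1 q = (2 * J) mod n" "end2 q = (2 * (J + k)) mod n"
      "switch1 q = (2 * (J + h - 1 + M)) mod n" "switch2 q = (2 * (J + h - 1 + N)) mod n"
  shows "wins q target"
proof -
  have "v \<noteq> 1"
  proof
    assume "v = 1"
    then have "M = 1" using M(1) by simp
    then show False using RM inner_le_R1 t(1) by simp
  qed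
  then have v1: "L (v - 1) < t" and t4: "4 * t \<le> 2 * inner + outer" using v(1,3) t(2) by auto
  have pos: "0 \<le> inner" "0 \<le> outer" using W_mono[of "J + h" "J + h + k"] W_mono[of J "J + k + 1"] k by auto
  have tt: "2 * t \<le> inner + outer" using t4 pos by argo
  have "t \<le> R (v - 1)" using L_plus_R_ge[of "v - 1"] v1 tt by linarith
  then have M1: "M \<noteq> v - 1" using RM by auto
  have "t \<le> R v"
  proof -
    \<comment> \<open>Moving from \<open>v - 1\<close> to \<open>v\<close> costs at most the inner
      slice \<open>v - 1\<close>, and that slice is the surplus in
      \<open>L (v - 1) + R (v - 1)\<close>, so the loss is paid for.\<close>
    have "R v \<ge> R (v - 1) - (W (J + h + (v - 1)) - W (J + h + (v - 1) - 1))"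
      using W_mono[of "J + (v - 1)" "J + v"] by (simp add: R_def algebra_simps)
    then show ?thesis using L_plus_R[of "v - 1"] v1 tt pos t4 by argo
  qed
  then have Mv: "M < v - 1" using RM M1 M(1) by (cases "M = v") auto
  have LN: "L N < t" using N(2)[of "v - 1"] Mv v(1) v1 by auto
  have Nv: "N < v" using LN v(2)[of N] N(1) by force
  have "t < L M" using L_plus_R_ge[of M] RM tt by argo
  then have MN: "M < N" using LN N(1) by (cases "M = N") auto
  have "t \<le> R N" "t + R M - L N \<le> R N" using L_plus_R_ge[of N] LN RM tt by argo+
  then have "\<theta> \<le> R N" unfolding \<theta>_def by simp
  then have wN: "w < N" using w(1,2) by (cases "w = N") auto
  \<comment> \<open>\<open>L\<close> decreases only by outer slices, and those between \<open>M\<close> and \<open>y\<close> and between \<open>w\<close> and \<open>N\<close> are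
    disjoint, so the two drops together cannot exceed \<open>outer\<close>.\<close>
  have key: "max t (t + L N - R M) \<le> L y" if y: "y \<in> {M..w}" for y
  proof (rule ccontr)
    assume "\<not> ?thesis"
    moreover have "L M - L y \<le> W (J + y) - W (J + M)" "L w - L N \<le> W (J + N) - W (J + w)"
      using L_drop[of M y] L_drop[of w N] y wN by auto
    moreover have "W (J + y) \<le> W (J + w)" "W (J + N) \<le> W (J + k + 1)" "W J \<le> W (J + M)"
      using W_mono y N(1) M(1) by auto
    moreover obtain b e where be: "b = inner" "e = outer" "e = W (J + k + 1) - W J" by simp
    \<comment> \<open>The maxima bounding \<open>R w\<close> and \<open>L y\<close> add up to
      \<open>2 * t\<close> plus the distance between \<open>R M\<close> and \<open>L N\<close>. So
      \<open>R M\<close>, \<open>R w\<close>, \<open>L y\<close> and \<open>L N\<close> total less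
      than \<open>2 * t\<close> plus twice the larger of \<open>R M\<close> and \<open>L N\<close>,
      hence less than \<open>4 * t\<close>. The two drops would then exceed
      \<open>2 * (b + e) - 4 * t >= e\<close>.\<close>
    moreover have "4 * t \<le> 2 * b + e" "b + e - R M \<le> L M" "b + e - R w \<le> L w"
      using t4 L_plus_R_ge[of M] L_plus_R_ge[of w] unfolding be(1,2) by auto
    ultimately show False using w(2) RM LN unfolding \<theta>_def by (cases "R M \<le> L N") (simp_all add: max_def split: if_splits)
  qed
  show ?thesis
  proof (rule wins_phases[where \<sigma> = "J + w" and M = M and N = N and w = w])
    show "phases M w N (first_phase q) (J + w) (J + w) (slice (2 * (J + w)))"
      using W_add1[of "J + w"] w(1) wN q(1) by (simp add: phases_def)
    show "t + R M \<le> R j + R i" if "i \<in> {1..M}" "j \<in> {w + 1..N}" for i j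
      using M(2)[of i] w(3)[of j] that M(1) unfolding \<theta>_def by simp
    show "t + R M \<le> R j + L i" if "j \<in> {w + 1..N}" "i \<in> {j..k}" for i j
      using N(2)[of i] w(3)[of j] that w(1) unfolding \<theta>_def by simp
    show "t + L N \<le> L i + L j" if "i \<in> {M..w}" "j \<in> {N..k}" for i j
      using key[of i] N(2)[of j] that N(1) by simp
    show "t + L N \<le> L i + R j" if "i \<in> {M..w}" "j \<in> {1..i}" for i j
      using key[of i] M(2)[of j] that wN Nv by simp
  qed (use q M(1) N(1) in auto)
qed

end

end

section \<open>Covering triples and the values of their segments\<close>

context odd_pizza
begin

definition inner_sum :: "int \<Rightarrow> int \<Rightarrow> real" where "inner_sum J k = W (J + h + k) - W (J + h)"
definition outer_sum :: "int \<Rightarrow> int \<Rightarrow> real" where "outer_sum J k = W (J + k + 1) - W J"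

text \<open>For \<open>1 <= k\<close> this is the largest \<open>t\<close> that the two start lemmas
  of a segment admit.\<close>

definition level :: "int \<Rightarrow> int \<Rightarrow> real" where
  "level J k = (if k \<le> 1 then inner_sum J k else min (inner_sum J k) (inner_sum J k / 2 + outer_sum J k / 4))"

definition seg_value :: "int \<Rightarrow> int \<Rightarrow> real \<Rightarrow> real" where
  "seg_value J k x = level J k + x - outer_sum J k"

text \<open>Half-circles starting \<open>h\<close> or \<open>h - 1\<close> apart cover the circle,
  because \<open>2 * h = n + 1\<close>; at most one slice is counted twice.\<close>

lemma S_overlap: "sum_list P \<le> S j + S (j + h)" "sum_list P \<le> S j + S (j + h - 1)"
proof -
  have "S j + S (j + h) = W (j + 1 + n) - W j" "S j + S (j + h - 1) = W (j + n) - W j + (W (j + h) - W (j + h - 1))"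
    by (simp_all add: S_def n_h algebra_simps)
  then show "sum_list P \<le> S j + S (j + h)" "sum_list P \<le> S j + S (j + h - 1)"
    using W_shift[of j] W_shift[of "j + 1"] W_mono[of j "j + 1"] W_mono[of "j + h - 1" "j + h"] by auto
qed

text \<open>The strict bounds make neighbouring half-circles overlap in at least one slice, so the
  outer arcs are nonempty, while the inner arcs may still be empty.\<close>

definition covers :: "int \<Rightarrow> int \<Rightarrow> int \<Rightarrow> bool" where
  "covers j1 j2 j3 \<longleftrightarrow> j1 < j2 \<and> j2 < j1 + h \<and> j1 + h \<le> j3 \<and> j3 < j2 + h"

text \<open>A half-circle below \<open>g\<close> beyond the last small one would either complete a covering triple or
  cover the whole pizza together with it.\<close>

lemma wins_no_jump_from_last_small:
  assumes j1: "\<And>j. S j1 \<le> S j"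
    and g: "\<And>j2 j3. covers j1 j2 j3 \<Longrightarrow> g \<le> max (S j2) (S j3)" "2 * g \<le> sum_list P"
    and u: "0 \<le> u" "u < h" "u = 0 \<or> S (j1 + u) < g" "\<And>j. j \<in> {u + 1..<h} \<Longrightarrow> g \<le> S (j1 + j)"
    and q: "first_phase q = 2" "first_slice q = (2 * (j1 + u + h)) mod n"
  shows "wins q g"
proof (rule wins_no_jump[OF q])
  fix j assume "j \<in> {j1 + u + h + 1 - h..j1 + u + h}"
  then consider "j \<in> {j1 + u + 1..<j1 + h}" | "u = 0" "j = j1 + h" | "u \<ge> 1" "j = j1 + u + h"
    | "u \<ge> 1" "j \<in> {j1 + h..<j1 + u + h}" using u(1) by force
  then show "g \<le> S j"
  proof cases
    case 1
    then show ?thesis using u(4)[of "j - j1"] by auto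
  next
    case 2
    then show ?thesis using S_overlap(1)[of j1] j1[of "j1 + h"] g(2) by simp
  next
    case 3
    then show ?thesis using S_overlap(1)[of "j1 + u"] u(3) g(2) by simp
  next
    case 4
    then have "covers j1 (j1 + u) j" using u by (auto simp: covers_def)
    then show ?thesis using g(1) 4 u(3) by fastforce
  qed
qed

text \<open>The three half-circles \<open>a b c\<close>, \<open>c d e\<close>, \<open>e f a\<close> cut the circle into six arcs, and \<open>b e\<close>, \<open>d a\<close>,
  \<open>f c\<close> are the inner and outer parts of three segments that make up the pizza.\<close>

lemma covering_triple_value:
  assumes cov: "covers j1 j2 j3"
    and S1: "S j1 \<le> S j2" "S j1 \<le> S j3"
    and g: "g = max (S j2) (S j3)" "2 * g < sum_list P"
  shows "1 \<le> j2 + h - 1 - j3" "1 \<le> j3 - h - j1" "1 \<le> j1 + h - 1 - j2"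
    and "gain_bound (length P) * sum_list P \<le> max g (max (seg_value j3 (j2 + h - 1 - j3) (min (S j2) (S j3)))
      (max (seg_value j1 (j3 - h - j1) (S j1)) (seg_value j2 (j1 + h - 1 - j2) (S j1))))"
proof -
  define a where "a = W (j3 + h) - W (j1 + n)"
  define b where "b = W (j2 + n) - W (j3 + h)"
  define c where "c = W (j1 + h) - W j2"
  define d where "d = W j3 - W (j1 + h)"
  define e where "e = W (j2 + h) - W j3"
  define f where "f = W (j1 + n) - W (j2 + h)"
  note arcs = a_def b_def c_def d_def e_def f_def
  let ?k1 = "j2 + h - 1 - j3" and ?k2 = "j3 - h - j1" and ?k3 = "j1 + h - 1 - j2"
  have nonneg: "0 \<le> a" "0 \<le> b" "0 \<le> c" "0 \<le> d" "0 \<le> e" "0 \<le> f"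
    using cov unfolding arcs covers_def by (auto intro!: W_mono simp: n_h)
  have total: "sum_list P = a + b + c + d + e + f"
    using W_shift[of j2] by (simp add: arcs)
  have H: "S j1 = a + b + c" "S j2 = c + d + e" "S j3 = e + f + a"
    using W_shift[of j1] W_shift[of j2] by (simp_all add: S_def arcs)
  have B: "inner_sum j3 ?k1 = b" "outer_sum j3 ?k1 = e"
    by (simp_all add: inner_sum_def outer_sum_def arcs n_h algebra_simps)
  have D: "inner_sum j1 ?k2 = d" "outer_sum j1 ?k2 = a"
  proof -
    have "W (j3 + h) = W (j3 - h + 1 + n)" by (rule arg_cong[where f = W]) (simp add: n_h)
    then have "W (j3 + h) = W (j3 - h + 1) + sum_list P" using W_shift[of "j3 - h + 1"] by simp
    then show "inner_sum j1 ?k2 = d" "outer_sum j1 ?k2 = a"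
      using W_shift[of j1] by (simp_all add: inner_sum_def outer_sum_def arcs)
  qed
  have F: "inner_sum j2 ?k3 = f" "outer_sum j2 ?k3 = c"
    by (simp_all add: inner_sum_def outer_sum_def arcs n_h algebra_simps)
  \<comment> \<open>Each inequality is the sum of two statements that a half-circle is smaller than
    its complement: for instance \<open>c + d + e < f + a + b\<close> and
    \<open>e + f + a < b + c + d\<close> give \<open>e < b\<close>. In particular no inner arc is
    empty.\<close>
  have heavy: "e < b" "a < d" "c < f" using g H total S1 by linarith+
  show k: "1 \<le> ?k1" "1 \<le> ?k2" "1 \<le> ?k3"
  proof -
    have "?k1 \<noteq> 0" "?k2 \<noteq> 0" "?k3 \<noteq> 0"
      using heavy nonneg B D F by (auto simp: inner_sum_def)
    then show "1 \<le> ?k1" "1 \<le> ?k2" "1 \<le> ?k3" using cov by (auto simp: covers_def)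
  qed
  show "gain_bound (length P) * sum_list P \<le> max g (max (seg_value j3 ?k1 (min (S j2) (S j3)))
      (max (seg_value j1 ?k2 (S j1)) (seg_value j2 ?k3 (S j1))))"
  proof (cases "?k1 = 1 \<or> ?k2 = 1 \<or> ?k3 = 1")
    case True
    have "n \<noteq> 1" using cov n_h by (auto simp: covers_def)
    then have "length P \<noteq> 1" by (simp add: n_def)
    then have "gain_bound (length P) \<le> 1 / 2" by (simp add: gain_bound_def)
    then have "gain_bound (length P) * sum_list P \<le> 1 / 2 * sum_list P"
      by (rule mult_right_mono) (use nonneg total in simp)
    \<comment> \<open>With a single inner slice the segment value is exactly the complement of
      \<open>S j2\<close> or of \<open>S j3\<close>, both of which are below half of the
      pizza.\<close>
    moreover from True have "1 / 2 * sum_list P \<le> max (seg_value j3 ?k1 (min (S j2) (S j3)))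
      (max (seg_value j1 ?k2 (S j1)) (seg_value j2 ?k3 (S j1)))"
    proof (elim disjE)
      assume "?k1 = 1"
      then have "seg_value j3 ?k1 (min (S j2) (S j3)) = b + min (S j2) (S j3) - e"
        unfolding seg_value_def level_def B by simp
      then show ?thesis using g total H S1 by linarith
    next
      assume "?k2 = 1"
      then have "seg_value j1 ?k2 (S j1) = d + S j1 - a"
        unfolding seg_value_def level_def D by simp
      then show ?thesis using g total H S1 by linarith
    next
      assume "?k3 = 1"
      then have "seg_value j2 ?k3 (S j1) = f + S j1 - c"
        unfolding seg_value_def level_def F by simp
      then show ?thesis using g total H S1 by linarith
    qed
    ultimately show ?thesis by linarith
  next
    case False
    \<comment> \<open>A segment has \<open>k\<close> inner and \<open>k + 1\<close> outer slices, so
      three segments with \<open>k >= 2\<close> need at least 15 slices.\<close>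
    have "n = 2 * (?k1 + ?k2 + ?k3) + 3" by (simp add: n_h)
    then have "15 \<le> n" "odd n" using False k by auto
    then have "15 \<le> length P" "odd (length P)" by (simp_all add: n_def)
    then have gb: "gain_bound (length P) = 4 / 9" by (auto simp: gain_bound_def)
    have v1: "b / 2 + e / 4 + min (S j2) (S j3) - e = seg_value j3 ?k1 (min (S j2) (S j3))"
      using False heavy nonneg k unfolding seg_value_def level_def B by (auto simp: min_def)
    have v2: "d / 2 + S j1 - a \<le> seg_value j1 ?k2 (S j1)"
      using False heavy nonneg k unfolding seg_value_def level_def D by (auto simp: min_def)
    have v3: "f / 2 + S j1 - c \<le> seg_value j2 ?k3 (S j1)"
      using False heavy nonneg k unfolding seg_value_def level_def F by (auto simp: min_def)
    show ?thesis
    proof (rule ccontr)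
      assume "\<not> ?thesis"
      then have lt: "g < 4 / 9 * sum_list P" "b / 2 + e / 4 + min (S j2) (S j3) - e < 4 / 9 * sum_list P"
        "d / 2 + S j1 - a < 4 / 9 * sum_list P" "f / 2 + S j1 - c < 4 / 9 * sum_list P"
        using v1 v2 v3 unfolding gb by linarith+
      show False
      \<comment> \<open>The dual certificate: if \<open>S j2\<close> is the smaller one, 4 times the
        first segment bound, 2 times the third and 3 times \<open>S j3\<close> count every arc at
        least 4 times, and 4 + 2 + 3 = 9. In the other case the second segment and
        \<open>S j2\<close> take the places of the third and \<open>S j3\<close>.\<close>
      proof (cases "S j2 \<le> S j3")
        case True
        then show False using lt g(1) S1 nonneg unfolding H total by (simp add: min_def max_def)
      next
        case False
        then show False using lt g(1) S1 nonneg unfolding H total by (simp add: min_def max_def)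
      qed
    qed
  qed
qed

end

text \<open>At Bob's turns the gap consists of an odd number \<open>2 * c + 1\<close> of slices.
  Those of Alice's parity in it are \<open>r + 2, ..., r + 2 * c\<close>, the last of which is
  \<open>l - 2\<close> modulo \<open>n\<close>; either answer takes one of them, and none ever
  becomes available to Bob.\<close>

lemma (in pizza) wins_even:
  assumes m: "n = 2 * m" and q: "first_phase q = 2"
  shows "wins q (\<Sum>i\<in>{0..<m}. slice (first_slice q + 2 * i))"
proof -
  define \<tau> where "\<tau> = (\<Sum>i\<in>{0..<m}. slice (first_slice q + 2 * i))"
  define Good where "Good ph l r G \<longleftrightarrow> ph = 2 \<and>
    (\<exists>c\<ge>0. r - l = n - 2 - 2 * c \<and> G + (\<Sum>i\<in>{1..c}. slice (r + 2 * i)) = \<tau>)" for ph :: int and l r G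
  have "Good (first_phase q) (first_slice q) (first_slice q) (slice (first_slice q))"
  proof -
    have "{0..<m} = insert 0 {1..m - 1}" using n_pos m by auto
    then have "slice (first_slice q) + (\<Sum>i\<in>{1..m - 1}. slice (first_slice q + 2 * i)) = \<tau>"
      by (simp add: \<tau>_def)
    then show ?thesis using q n_pos m unfolding Good_def by (intro conjI exI[of _ "m - 1"]) auto
  qed
  moreover have "(n - 2 \<le> r - l \<longrightarrow> \<tau> \<le> G) \<and> (r - l < n - 2 \<longrightarrow>
      Good ph l (r + 2) (G + slice (r + 2)) \<and> Good ph (l - 2) r (G + slice (l - 2)))" if good: "Good ph l r G" for ph l r G
  proof -
    obtain c where c: "0 \<le> c" "r - l = n - 2 - 2 * c" "G + (\<Sum>i\<in>{1..c}. slice (r + 2 * i)) = \<tau>" "ph = 2"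
      using good unfolding Good_def by blast
    have "\<tau> \<le> G" if "n - 2 \<le> r - l"
      using that c by simp
    moreover have "Good ph l (r + 2) (G + slice (r + 2)) \<and> Good ph (l - 2) r (G + slice (l - 2))" if "r - l < n - 2"
    proof
      have c1: "1 \<le> c" using that c by simp
      have "(\<Sum>i\<in>{1..c - 1}. slice (r + 2 + 2 * i)) = (\<Sum>i\<in>{2..c}. slice (r + 2 * i))"
        by (rule sum.reindex_bij_witness[of _ "\<lambda>i. i - 1" "\<lambda>i. i + 1"]) (auto simp: algebra_simps)
      moreover have "{1..c} = insert 1 {2..c}" using c1 by auto
      ultimately have "G + slice (r + 2) + (\<Sum>i\<in>{1..c - 1}. slice (r + 2 + 2 * i)) = \<tau>"
        using c(3) by simp
      then show "Good ph l (r + 2) (G + slice (r + 2))" unfolding Good_def using c c1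
        by (intro conjI exI[of _ "c - 1"]) auto
      have "l - 2 = r + 2 * c + n * (- 1)" using c by simp
      then have "slice (l - 2) = slice (r + 2 * c)" by (simp only: slice_shift)
      moreover have "{1..c} = insert c {1..c - 1}" using c1 by auto
      ultimately have "G + slice (l - 2) + (\<Sum>i\<in>{1..c - 1}. slice (r + 2 * i)) = \<tau>"
        using c(3) by simp
      then show "Good ph (l - 2) r (G + slice (l - 2))" unfolding Good_def using c c1
        by (intro conjI exI[of _ "c - 1"]) auto
    qed
    ultimately show ?thesis by blast
  qed
  moreover have "\<not> trigger q ph x" if "Good ph l r G" for ph x l r G
    using that by (simp add: Good_def trigger_def)
  ultimately show ?thesis using q unfolding wins_def \<tau>_def[symmetric]
    by (intro conjI exI[of _ Good]) auto
qed

section \<open>Running programs\<close>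

text \<open>A total-correctness triple with a time bound. As \<open>exec\<close> is deterministic,
  the existence of one execution settles all of them.\<close>

definition run :: "com \<Rightarrow> mem \<Rightarrow> nat \<Rightarrow> (mem \<Rightarrow> bool) \<Rightarrow> bool" where
  "run c s K Q \<longleftrightarrow> (\<exists>k t. exec c s k t \<and> k \<le> K \<and> Q t)"

lemma run_mono: "run c s K Q \<Longrightarrow> K \<le> K' \<Longrightarrow> (\<And>t. Q t \<Longrightarrow> Q' t) \<Longrightarrow> run c s K' Q'"
  unfolding run_def by (meson le_trans)

lemma run_exec: "run c s K Q \<Longrightarrow> exec c s k t \<Longrightarrow> Q t"
  unfolding run_def using exec_deterministic by blast

lemma run_Seq: "run c s K (\<lambda>t. run d t K' Q) \<Longrightarrow> run (Seq c d) s (K + K') Q"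
  unfolding run_def by (blast intro: exec.Seq add_mono)

fun straight :: "com \<Rightarrow> bool" where
  "straight (Seq c d) \<longleftrightarrow> straight c \<and> straight d"
| "straight (If b c d) \<longleftrightarrow> straight c \<and> straight d"
| "straight (While b c) \<longleftrightarrow> False"
| "straight _ \<longleftrightarrow> True"

fun cost :: "com \<Rightarrow> nat" where
  "cost (Seq c d) = cost c + cost d"
| "cost (If b c d) = max (cost c) (cost d) + 1"
| "cost _ = 1"

text \<open>Symbolic execution of loop-free programs by simplification. Loops get a dummy result,
  which \<open>straight\<close> keeps out of \<open>run_straight\<close>.\<close>

fun result :: "com \<Rightarrow> mem \<Rightarrow> mem" where
  "result (IAssign x e) s = s\<lparr>ivar := (ivar s)(x := ival e s)\<rparr>"
| "result (IStore a i e) s = s\<lparr>iarr := (iarr s)(a := (iarr s a)(ival i s := ival e s))\<rparr>"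
| "result (RAssign x e) s = s\<lparr>rvar := (rvar s)(x := rval e s)\<rparr>"
| "result (RStore a i e) s = s\<lparr>rarr := (rarr s)(a := (rarr s a)(ival i s := rval e s))\<rparr>"
| "result (Seq c d) s = result d (result c s)"
| "result (If b c d) s = (if bval b s then result c s else result d s)"
| "result _ s = s"

lemma run_straight: "straight c \<Longrightarrow> run c s (cost c) (\<lambda>t. t = result c s)"
proof (induction c arbitrary: s)
  case (Seq c d)
  then show ?case by (auto intro!: run_Seq intro: run_mono)
next
  case (If b c d)
  then show ?case unfolding run_def
    by (cases "bval b s") (fastforce intro: exec.IfTrue exec.IfFalse)+
qed (auto simp: run_def intro: exec.intros)

lemma run_straightI: "straight c \<Longrightarrow> cost c \<le> K \<Longrightarrow> Q (result c s) \<Longrightarrow> run c s K Q"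
  by (rule run_mono[OF run_straight]) auto

abbreviation IEq :: "iexp \<Rightarrow> iexp \<Rightarrow> bexp" where "IEq e f \<equiv> BAnd (ILe e f) (ILe f e)"
abbreviation BOr :: "bexp \<Rightarrow> bexp \<Rightarrow> bexp" where "BOr b c \<equiv> BNot (BAnd (BNot b) (BNot c))"

section \<open>Alice's turns\<close>

definition step_right :: com where
  "step_right = Seq (IAssign ''r'' (IAdd (IVar ''r'') (IConst 1)))
     (Seq (If (ILe (IVar ''n'') (IVar ''r'')) (IAssign ''r'' (IConst 0)) Skip)
     (IAssign ''alice'' (IVar ''r'')))"

definition step_left :: com where
  "step_left = Seq (IAssign ''l'' (ISub (IVar ''l'') (IConst 1)))
     (Seq (If (ILe (IConst 0) (IVar ''l'')) Skip (IAssign ''l'' (ISub (IVar ''n'') (IConst 1))))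
     (IAssign ''alice'' (IVar ''l'')))"

definition triggered :: bexp where
  "triggered = BOr
     (BAnd (IEq (IVar ''phase'') (IConst 0)) (BOr (IEq (IVar ''bob'') (IVar ''switch1'')) (IEq (IVar ''bob'') (IVar ''switch2''))))
     (BAnd (IEq (IVar ''phase'') (IConst 1)) (BOr (IEq (IVar ''bob'') (IVar ''end1'')) (IEq (IVar ''bob'') (IVar ''end2''))))"

text \<open>The memory holds the ends of the taken arc reduced modulo \<open>n\<close>. Bob's slice
  is compared with the right neighbour only; any other legal slice must be the left
  neighbour.\<close>

definition turn :: com where
  "turn = If (IEq (IVar ''bob'') (IConst (- 1)))
     (Seq (IAssign ''l'' (IVar ''start'')) (Seq (IAssign ''r'' (IVar ''start'')) (IAssign ''alice'' (IVar ''start''))))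
     (Seq (IAssign ''next'' (IAdd (IVar ''r'') (IConst 1)))
     (Seq (If (ILe (IVar ''n'') (IVar ''next'')) (IAssign ''next'' (IConst 0)) Skip)
     (If (IEq (IVar ''bob'') (IVar ''next''))
       (Seq (IAssign ''r'' (IVar ''bob''))
         (If triggered (Seq (IAssign ''phase'' (IAdd (IVar ''phase'') (IConst 1))) step_left) step_right))
       (Seq (IAssign ''l'' (IVar ''bob''))
         (If triggered (Seq (IAssign ''phase'' (IAdd (IVar ''phase'') (IConst 1))) step_right) step_left)))))"

definition knows :: "int \<Rightarrow> plan \<Rightarrow> mem \<Rightarrow> bool" where
  "knows m q s \<longleftrightarrow> ivar s ''n'' = m \<and> ivar s ''start'' = first_slice q \<and>
     ivar s ''switch1'' = switch1 q \<and> ivar s ''switch2'' = switch2 q \<and>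
     ivar s ''end1'' = end1 q \<and> ivar s ''end2'' = end2 q"

lemma mod_add1:
  assumes "(0::int) < m"
  shows "(if m \<le> x mod m + 1 then 0 else x mod m + 1) = (x + 1) mod m"
proof (cases "x mod m + 1 = m")
  case True
  then have "(x + 1) mod m = 0" by (metis mod_add_left_eq mod_self)
  then show ?thesis using True by simp
next
  case False
  then have "x mod m + 1 < m" using pos_mod_bound[OF assms, of x] by linarith
  then have "(x mod m + 1) mod m = x mod m + 1" using assms by simp
  then show ?thesis using \<open>x mod m + 1 < m\<close> by (simp add: mod_add_left_eq)
qed

lemma mod_sub1:
  assumes "(0::int) < m"
  shows "(if 0 \<le> x mod m - 1 then x mod m - 1 else m - 1) = (x - 1) mod m"
proof (cases "x mod m = 0")
  case True
  then have "(x - 1) mod m = (- 1) mod m" by (metis mod_diff_left_eq diff_0)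
  also have "(- 1) mod m = m - 1" using assms by (simp add: zmod_minus1)
  finally show ?thesis using True by simp
next
  case False
  then have "0 \<le> x mod m - 1" using pos_mod_sign[OF assms, of x] by linarith
  moreover from this have "(x mod m - 1) mod m = x mod m - 1"
    using pos_mod_bound[OF assms, of x] by (intro mod_pos_pos_trivial) linarith+
  ultimately show ?thesis by (simp add: mod_diff_left_eq)
qed

lemma result_step_right:
  assumes "ivar s ''n'' = m" "0 < m" "ivar s ''r'' = x mod m"
  shows "result step_right s = s\<lparr>ivar := (ivar s)(''r'' := (x + 1) mod m, ''alice'' := (x + 1) mod m)\<rparr>"
  unfolding step_right_def using assms mod_add1[OF assms(2), of x] by (auto split: if_splits)

lemma result_step_left:
  assumes "ivar s ''n'' = m" "0 < m" "ivar s ''l'' = x mod m"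
  shows "result step_left s = s\<lparr>ivar := (ivar s)(''l'' := (x - 1) mod m, ''alice'' := (x - 1) mod m)\<rparr>"
  unfolding step_left_def using assms mod_sub1[OF assms(2), of x] by (auto split: if_splits)

lemma bval_triggered:
  "knows m q s \<Longrightarrow> bval triggered s \<longleftrightarrow> trigger q (ivar s ''phase'') (ivar s ''bob'')"
  by (auto simp: triggered_def trigger_def knows_def)

lemma run_first_turn:
  assumes "knows m q s"
  shows "run turn (observe [] s) 20 (\<lambda>t. knows m q t \<and> ivar t ''phase'' = ivar s ''phase'' \<and>
    ivar t ''l'' = first_slice q \<and> ivar t ''r'' = first_slice q \<and> answer t = first_slice q)"
  by (rule run_straightI) (use assms in \<open>auto simp: turn_def step_left_def step_right_def observe_def knows_def answer_def\<close>)

lemma run_turn: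
  assumes q: "knows m q s" and m: "0 < m" and lr: "ivar s ''l'' = l mod m" "ivar s ''r'' = r mod m"
    and xs: "xs \<noteq> []"
  shows "int (last xs) = (r + 1) mod m \<Longrightarrow> run turn (observe xs s) 20 (\<lambda>t. knows m q t \<and>
      (if trigger q (ivar s ''phase'') ((r + 1) mod m)
       then ivar t ''phase'' = ivar s ''phase'' + 1 \<and> ivar t ''l'' = (l - 1) mod m \<and> ivar t ''r'' = (r + 1) mod m \<and> answer t = (l - 1) mod m
       else ivar t ''phase'' = ivar s ''phase'' \<and> ivar t ''l'' = l mod m \<and> ivar t ''r'' = (r + 2) mod m \<and> answer t = (r + 2) mod m))" (is "_ \<Longrightarrow> ?right")
    and "int (last xs) = (l - 1) mod m \<Longrightarrow> (l - 1) mod m \<noteq> (r + 1) mod m \<Longrightarrow> run turn (observe xs s) 20 (\<lambda>t. knows m q t \<and>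
      (if trigger q (ivar s ''phase'') ((l - 1) mod m)
       then ivar t ''phase'' = ivar s ''phase'' + 1 \<and> ivar t ''l'' = (l - 1) mod m \<and> ivar t ''r'' = (r + 1) mod m \<and> answer t = (r + 1) mod m
       else ivar t ''phase'' = ivar s ''phase'' \<and> ivar t ''l'' = (l - 2) mod m \<and> ivar t ''r'' = r mod m \<and> answer t = (l - 2) mod m))" (is "_ \<Longrightarrow> _ \<Longrightarrow> ?left")
proof -
  define next_bob where "next_bob = Seq (IAssign ''next'' (IAdd (IVar ''r'') (IConst 1)))
     (If (ILe (IVar ''n'') (IVar ''next'')) (IAssign ''next'' (IConst 0)) Skip)"
  have nb: "result next_bob t = t\<lparr>ivar := (ivar t)(''next'' := (r + 1) mod m)\<rparr>"
    if "ivar t ''n'' = m" "ivar t ''r'' = r mod m" for t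
    using that mod_add1[OF m, of r] unfolding next_bob_def by (auto split: if_splits)
  let ?s = "s\<lparr>ivar := (ivar s)(''bob'' := int (last xs), ''next'' := (r + 1) mod m)\<rparr>"
  have res: "result turn (observe xs s) = (if int (last xs) = (r + 1) mod m
      then let t = ?s\<lparr>ivar := (ivar ?s)(''r'' := int (last xs))\<rparr> in
        if trigger q (ivar s ''phase'') (int (last xs)) then result step_left (t\<lparr>ivar := (ivar t)(''phase'' := ivar s ''phase'' + 1)\<rparr>) else result step_right t
      else let t = ?s\<lparr>ivar := (ivar ?s)(''l'' := int (last xs))\<rparr> in
        if trigger q (ivar s ''phase'') (int (last xs)) then result step_right (t\<lparr>ivar := (ivar t)(''phase'' := ivar s ''phase'' + 1)\<rparr>) else result step_left t)"
  proof -
    have "result turn (observe xs s) = result (If (IEq (IVar ''bob'') (IVar ''next''))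
       (Seq (IAssign ''r'' (IVar ''bob''))
         (If triggered (Seq (IAssign ''phase'' (IAdd (IVar ''phase'') (IConst 1))) step_left) step_right))
       (Seq (IAssign ''l'' (IVar ''bob''))
         (If triggered (Seq (IAssign ''phase'' (IAdd (IVar ''phase'') (IConst 1))) step_right) step_left)))
       (result next_bob (observe xs s))"
      using xs by (simp add: turn_def next_bob_def observe_def)
    also have "result next_bob (observe xs s) = ?s"
      using nb[of "observe xs s"] q lr xs by (simp add: knows_def observe_def)
    finally show ?thesis
      using bval_triggered[of m q "?s\<lparr>ivar := (ivar ?s)(''r'' := int (last xs))\<rparr>"]
        bval_triggered[of m q "?s\<lparr>ivar := (ivar ?s)(''l'' := int (last xs))\<rparr>"] q
      by (auto simp: knows_def Let_def)
  qed
  have st: "straight turn" "cost turn \<le> 20"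
    by (simp_all add: turn_def step_left_def step_right_def)
  show ?right if "int (last xs) = (r + 1) mod m"
    by (rule run_straightI[OF st], unfold res)
      (use that q lr m result_step_left[where m = m and x = l] result_step_right[where m = m and x = "r + 1"] in
        \<open>auto simp: knows_def answer_def Let_def algebra_simps\<close>)
  show ?left if "int (last xs) = (l - 1) mod m" "(l - 1) mod m \<noteq> (r + 1) mod m"
    by (rule run_straightI[OF st], unfold res)
      (use that q lr m result_step_left[where m = m and x = "l - 1"] result_step_right[where m = m and x = r] in
        \<open>auto simp: knows_def answer_def Let_def algebra_simps\<close>)
qed

section \<open>Plays as growing arcs: gain, jumps and legal moves\<close>

lemma alice_gain_snoc:
  "alice_gain P (xs @ [i]) = alice_gain P xs + (if even (length xs) then P ! i else 0)"
proof -
  have "{j. j < length (xs @ [i]) \<and> even j} = {j. j < length xs \<and> even j} \<union> (if even (length xs) then {length xs} else {})"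
    by (auto simp: less_Suc_eq)
  then have "alice_gain P (xs @ [i]) = (\<Sum>j | j < length xs \<and> even j. P ! ((xs @ [i]) ! j))
      + (if even (length xs) then P ! i else 0)"
    unfolding alice_gain_def by (auto simp: sum.union_disjoint)
  also have "(\<Sum>j | j < length xs \<and> even j. P ! ((xs @ [i]) ! j)) = alice_gain P xs"
    unfolding alice_gain_def by (rule sum.cong) (auto simp: nth_append)
  finally show ?thesis .
qed

lemma alice_jumps_snoc:
  "alice_jumps m (xs @ [i]) =
     alice_jumps m xs + (if even (length xs) \<and> xs \<noteq> [] \<and> \<not> neighbor m (last xs) i then 1 else 0)"
proof -
  let ?A = "\<lambda>xs. {j. even j \<and> jump m xs j}"
  have "?A (xs @ [i]) = ?A xs \<union>
      (if even (length xs) \<and> xs \<noteq> [] \<and> \<not> neighbor m (last xs) i then {length xs} else {})"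
    by (cases "xs = []") (auto simp: jump_def nth_append less_Suc_eq last_conv_nth)
  moreover have "finite (?A xs)" "length xs \<notin> ?A xs"
    by (auto simp: jump_def intro: finite_subset[of _ "{..<length xs}"])
  ultimately show ?thesis by (simp add: alice_jumps_def)
qed

context pizza
begin

definition arc :: "int \<Rightarrow> int \<Rightarrow> int set" where "arc l r = (\<lambda>x. x mod n) ` {l..r}"

lemma arc_right: "l \<le> r + 1 \<Longrightarrow> arc l (r + 1) = insert ((r + 1) mod n) (arc l r)"
proof -
  assume "l \<le> r + 1"
  then have "{l..r + 1} = insert (r + 1) {l..r}" by auto
  then show ?thesis by (simp add: arc_def)
qed

lemma arc_left: "l - 1 \<le> r \<Longrightarrow> arc (l - 1) r = insert ((l - 1) mod n) (arc l r)"
proof -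
  assume "l - 1 \<le> r"
  then have "{l - 1..r} = insert (l - 1) {l..r}" by auto
  then show ?thesis by (simp add: arc_def)
qed

lemma mod_neq: "x < y \<Longrightarrow> y - x < n \<Longrightarrow> x mod n \<noteq> y mod n"
  using zdvd_not_zless[of "y - x" n] by (auto simp: mod_eq_dvd_iff dvd_diff_commute)

lemma legal_right:
  assumes "int ` set xs = arc l r" "l \<le> r" "r - l + 1 < n" "int i = (r + 1) mod n"
  shows "legal_move (length P) xs i"
proof -
  have "i < length P" using assms(4) pos_mod_bound[OF n_pos, of "r + 1"] unfolding n_def by linarith
  moreover have "int i \<notin> arc l r"
  proof
    assume "int i \<in> arc l r"
    then obtain x where "int i = x mod n" "l \<le> x" "x \<le> r" by (auto simp: arc_def)
    then show False using mod_neq[of x "r + 1"] assms(3,4) by simp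
  qed
  moreover have "r mod n \<in> arc l r" using assms(2) by (auto simp: arc_def)
  then obtain j where j: "j \<in> set xs" "int j = r mod n" using assms(1) by (metis imageE)
  have "int i = int ((j + 1) mod length P)"
    using assms(4) j(2) by (simp add: n_def zmod_int mod_simps add.commute)
  then have "neighbor (length P) j i" unfolding neighbor_def by (simp only: of_nat_eq_iff simp_thms)
  ultimately show ?thesis using j assms(1) unfolding legal_move_def by blast
qed

lemma legal_left:
  assumes "int ` set xs = arc l r" "l \<le> r" "r - l + 1 < n" "int i = (l - 1) mod n"
  shows "legal_move (length P) xs i"
proof -
  have "i < length P" using assms(4) pos_mod_bound[OF n_pos, of "l - 1"] unfolding n_def by linarith
  moreover have "int i \<notin> arc l r"
  proof
    assume "int i \<in> arc l r"
    then obtain x where "int i = x mod n" "l \<le> x" "x \<le> r" by (auto simp: arc_def)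
    then show False using mod_neq[of "l - 1" x] assms(3,4) by simp
  qed
  moreover have "l mod n \<in> arc l r" using assms(2) by (auto simp: arc_def)
  then obtain j where j: "j \<in> set xs" "int j = l mod n" using assms(1) by (metis imageE)
  have "int j = int ((i + 1) mod length P)"
    using assms(4) j(2) by (simp add: n_def zmod_int mod_simps add.commute)
  then have "neighbor (length P) j i" unfolding neighbor_def by (simp only: of_nat_eq_iff simp_thms)
  ultimately show ?thesis using j assms(1) unfolding legal_move_def by blast
qed

lemma legal_cases:
  assumes "int ` set xs = arc l r" "legal_move (length P) xs i" "xs \<noteq> []"
  shows "int i = (r + 1) mod n \<or> int i = (l - 1) mod n"
proof -
  obtain j where j: "j \<in> set xs" "neighbor (length P) j i" and i: "i < length P" "i \<notin> set xs"
    using assms(2,3) unfolding legal_move_def by blast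
  have "int i \<notin> int ` set xs" using i by auto
  then have i': "int i \<notin> arc l r" "int i = int i mod n" using assms(1) i by (auto simp: n_def)
  obtain x where x: "int j = x mod n" "l \<le> x" "x \<le> r" using j(1) assms(1) unfolding arc_def by force
  show ?thesis using j(2) unfolding neighbor_def
  proof
    assume "i = (j + 1) mod length P"
    then have x1: "int i = (x + 1) mod n" using x(1) by (simp add: n_def zmod_int mod_simps add.commute)
    have "\<not> x + 1 \<le> r"
    proof
      assume "x + 1 \<le> r"
      then have "(x + 1) mod n \<in> arc l r" using x(2) unfolding arc_def by (intro imageI) simp
      then show False using i'(1) x1 by simp
    qed
    then have "x = r" using x(3) by simp
    then show ?thesis using x1 by simp
  next
    assume "j = (i + 1) mod length P"
    then have "x mod n = (int i + 1) mod n" using x(1) by (simp add: n_def zmod_int add.commute)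
    then have "(x - 1) mod n = (int i + 1 - 1) mod n" by (rule mod_diff_cong) simp
    then have x1: "int i = (x - 1) mod n" using i'(2) by simp
    have "\<not> l \<le> x - 1"
    proof
      assume "l \<le> x - 1"
      then have "(x - 1) mod n \<in> arc l r" using x(3) unfolding arc_def by (intro imageI) simp
      then show False using i'(1) x1 by simp
    qed
    then have "x = l" using x(2) by simp
    then show ?thesis using x1 by simp
  qed
qed

lemma neighbor_mod:
  assumes "int i = x mod n" "int j = (x + 1) mod n"
  shows "neighbor (length P) i j" "neighbor (length P) j i"
proof -
  have "int j = int ((i + 1) mod length P)" using assms by (simp add: n_def zmod_int mod_simps add.commute)
  then have "j = (i + 1) mod length P" by (simp only: of_nat_eq_iff)
  then show "neighbor (length P) i j" "neighbor (length P) j i" unfolding neighbor_def by simp_all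
qed

lemma slice_int: "int i = x mod n \<Longrightarrow> P ! i = slice x"
proof -
  assume "int i = x mod n"
  then have "i = nat (x mod n)" by simp
  then show ?thesis by (simp add: slice_def)
qed

text \<open>The bound of two jumps is contained in the last line: every jump raises the phase,
  triggers exist only in phases 0 and 1, and so the phase never exceeds 2.\<close>

definition alice_to_wait :: "plan \<Rightarrow> (int \<Rightarrow> int \<Rightarrow> int \<Rightarrow> real \<Rightarrow> bool) \<Rightarrow> nat list \<Rightarrow> mem \<Rightarrow> bool" where
  "alice_to_wait q Good xs s \<longleftrightarrow> knows n q s \<and> (\<exists>l r.
     ivar s ''l'' = l mod n \<and> ivar s ''r'' = r mod n \<and> l \<le> r \<and>
     int ` set xs = arc l r \<and> int (length xs) = r - l + 1 \<and> odd (length xs) \<and>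
     Good (ivar s ''phase'') l r (alice_gain P xs) \<and>
     int (alice_jumps (length P) xs) \<le> ivar s ''phase'' \<and> ivar s ''phase'' \<in> {0..2})"

lemma first_turn:
  assumes q: "knows n q s" "ivar s ''phase'' = first_phase q" "first_slice q \<in> {0..<n}" "first_phase q \<in> {0..2}"
    and good: "Good (first_phase q) (first_slice q) (first_slice q) (slice (first_slice q))"
  shows "run turn (observe [] s) 20 (\<lambda>t. \<exists>i. answer t = int i \<and> legal_move (length P) [] i \<and>
    alice_to_wait q Good [i] t)"
proof (rule run_mono[OF run_first_turn[OF q(1)]])
  fix t assume t: "knows n q t \<and> ivar t ''phase'' = ivar s ''phase'' \<and>
    ivar t ''l'' = first_slice q \<and> ivar t ''r'' = first_slice q \<and> answer t = first_slice q"
  let ?i = "nat (first_slice q)"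
  have "P ! ?i = slice (first_slice q)" using q(3) by (intro slice_int) simp
  then have "alice_gain P [?i] = slice (first_slice q)"
    using alice_gain_snoc[of P "[]" ?i] by (simp add: alice_gain_def)
  moreover have "alice_jumps (length P) [?i] = 0"
    using alice_jumps_snoc[of "length P" "[]" ?i] by (simp add: alice_jumps_def jump_def)
  moreover have "int ` set [?i] = arc (first_slice q) (first_slice q)" using q(3) by (simp add: arc_def)
  ultimately have "alice_to_wait q Good [?i] t"
    unfolding alice_to_wait_def using t q good
    by (intro conjI exI[of _ "first_slice q"]) auto
  moreover have "answer t = int ?i" "legal_move (length P) [] ?i"
    using t q(3) by (auto simp: legal_move_def n_def)
  ultimately show "\<exists>i. answer t = int i \<and> legal_move (length P) [] i \<and> alice_to_wait q Good [i] t" by blast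
qed simp

definition good_step :: "plan \<Rightarrow> (int \<Rightarrow> int \<Rightarrow> int \<Rightarrow> real \<Rightarrow> bool) \<Rightarrow> bool" where
  "good_step q Good \<longleftrightarrow> (\<forall>ph l r G. Good ph l r G \<longrightarrow> r - l < n - 2 \<longrightarrow>
     (if trigger q ph ((r + 1) mod n) then Good (ph + 1) (l - 1) (r + 1) (G + slice (l - 1))
      else Good ph l (r + 2) (G + slice (r + 2))) \<and>
     (if trigger q ph ((l - 1) mod n) then Good (ph + 1) (l - 1) (r + 1) (G + slice (r + 1))
      else Good ph (l - 2) r (G + slice (l - 2))))"

lemma trigger_phase: "trigger q ph x \<Longrightarrow> ph \<in> {0, 1}"
  by (auto simp: trigger_def)

lemma later_turn:
  assumes wait: "alice_to_wait q Good xs s" and bob: "legal_move (length P) xs b" and len: "length xs + 1 < length P"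
    and step: "good_step q Good"
  shows "run turn (observe (xs @ [b]) s) 20 (\<lambda>t. \<exists>i. answer t = int i \<and> legal_move (length P) (xs @ [b]) i \<and>
    alice_to_wait q Good (xs @ [b, i]) t)"
proof -
  define ph G where "ph = ivar s ''phase''" and "G = alice_gain P xs"
  obtain l r where lr: "ivar s ''l'' = l mod n" "ivar s ''r'' = r mod n" "l \<le> r" "int ` set xs = arc l r"
    "int (length xs) = r - l + 1" "odd (length xs)" "Good ph l r G"
    "int (alice_jumps (length P) xs) \<le> ph" "ph \<in> {0..2}" and k: "knows n q s"
    using wait unfolding alice_to_wait_def ph_def G_def by blast
  \<comment> \<open>At least two slices are free: the two neighbours of the arc differ, and one
    slice remains for Alice after Bob's move.\<close>
  have space: "r - l < n - 2" using len lr(5) by (simp add: n_def)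
  have ne: "xs \<noteq> []" using lr(6) by auto
  have gain: "alice_gain P (xs @ [b, i]) = G + P ! i" for i
    using alice_gain_snoc[of P "xs @ [b]" i] alice_gain_snoc[of P xs b] lr(6) by (simp add: G_def)
  have jumps: "alice_jumps (length P) (xs @ [b, i]) =
      alice_jumps (length P) xs + (if neighbor (length P) b i then 0 else 1)" for i
    using alice_jumps_snoc[of "length P" "xs @ [b]" i] alice_jumps_snoc[of "length P" xs b] lr(6) by simp
  note step' = step[unfolded good_step_def, rule_format, OF lr(7) space]
  have wait': "alice_to_wait q Good (xs @ [b, i]) t"
    if "knows n q t" "ivar t ''l'' = l' mod n" "ivar t ''r'' = r' mod n" "l' \<le> r'"
      "int ` set (xs @ [b, i]) = arc l' r'" "r' - l' = r - l + 2"
      "Good (ivar t ''phase'') l' r' (G + P ! i)"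
      "ivar t ''phase'' = ph \<and> neighbor (length P) b i \<or> ivar t ''phase'' = ph + 1 \<and> ph \<in> {0, 1}"
    for i t l' r'
    unfolding alice_to_wait_def gain jumps using that lr
    by (intro conjI exI[of _ l'] exI[of _ r']) auto
  consider (right) "int b = (r + 1) mod n" | (left) "int b = (l - 1) mod n"
    using legal_cases[OF lr(4) bob ne] by blast
  then show ?thesis
  proof cases
    case right
    have arc1: "int ` set (xs @ [b]) = arc l (r + 1)" using arc_right[of l r] right lr by simp
    have arc2: "arc (l - 1) (r + 1) = insert ((l - 1) mod n) (arc l (r + 1))"
      "arc l (r + 2) = insert ((r + 2) mod n) (arc l (r + 1))"
      using arc_left[of l "r + 1"] arc_right[of l "r + 1"] lr(3) by (simp_all add: algebra_simps)
    show ?thesis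
    proof (rule run_mono[OF run_turn(1)[OF k n_pos lr(1,2), of "xs @ [b]"]])
      fix t assume t: "knows n q t \<and> (if trigger q (ivar s ''phase'') ((r + 1) mod n)
         then ivar t ''phase'' = ivar s ''phase'' + 1 \<and> ivar t ''l'' = (l - 1) mod n \<and>
           ivar t ''r'' = (r + 1) mod n \<and> answer t = (l - 1) mod n
         else ivar t ''phase'' = ivar s ''phase'' \<and> ivar t ''l'' = l mod n \<and>
           ivar t ''r'' = (r + 2) mod n \<and> answer t = (r + 2) mod n)"
      define i where "i = nat (answer t)"
      have i: "int i = answer t" using t pos_mod_sign[OF n_pos] by (auto simp: i_def split: if_splits)
      show "\<exists>i. answer t = int i \<and> legal_move (length P) (xs @ [b]) i \<and> alice_to_wait q Good (xs @ [b, i]) t"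
      proof (cases "trigger q ph ((r + 1) mod n)")
        case True
        have a: "int i = (l - 1) mod n" using t True i by (simp add: ph_def)
        have "legal_move (length P) (xs @ [b]) i" using legal_left[OF arc1 _ _ a] lr space by simp
        moreover have "alice_to_wait q Good (xs @ [b, i]) t"
          by (rule wait'[where l' = "l - 1" and r' = "r + 1"])
            (use t True lr arc1 arc2 a step' slice_int[OF a] trigger_phase[OF True] in \<open>auto simp: ph_def\<close>)
        ultimately show ?thesis by (intro exI[of _ i]) (simp add: i)
      next
        case False
        have a2: "int i = (r + 2) mod n" using t False i by (simp add: ph_def)
        then have a: "int i = (r + 1 + 1) mod n" by (simp add: add.commute)
        have "legal_move (length P) (xs @ [b]) i" using legal_right[OF arc1 _ _ a] lr space by simp
        moreover have "alice_to_wait q Good (xs @ [b, i]) t"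
          by (rule wait'[where l' = l and r' = "r + 2"])
            (use t False lr arc1 arc2 a2 step' slice_int[OF a2] neighbor_mod(1)[OF right a] in \<open>auto simp: ph_def\<close>)
        ultimately show ?thesis by (intro exI[of _ i]) (simp add: i)
      qed
    qed (use right in auto)
  next
    case left
    have arc1: "int ` set (xs @ [b]) = arc (l - 1) r" using arc_left[of l r] left lr by simp
    have arc2: "arc (l - 1) (r + 1) = insert ((r + 1) mod n) (arc (l - 1) r)"
      "arc (l - 2) r = insert ((l - 2) mod n) (arc (l - 1) r)"
      using arc_right[of "l - 1" r] arc_left[of "l - 1" r] lr(3) by (simp_all add: algebra_simps)
    show ?thesis
    proof (rule run_mono[OF run_turn(2)[OF k n_pos lr(1,2), of "xs @ [b]"]])
      show "(l - 1) mod n \<noteq> (r + 1) mod n" using mod_neq[of "l - 1" "r + 1"] lr(3) space by simp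
      fix t assume t: "knows n q t \<and> (if trigger q (ivar s ''phase'') ((l - 1) mod n)
         then ivar t ''phase'' = ivar s ''phase'' + 1 \<and> ivar t ''l'' = (l - 1) mod n \<and>
           ivar t ''r'' = (r + 1) mod n \<and> answer t = (r + 1) mod n
         else ivar t ''phase'' = ivar s ''phase'' \<and> ivar t ''l'' = (l - 2) mod n \<and>
           ivar t ''r'' = r mod n \<and> answer t = (l - 2) mod n)"
      define i where "i = nat (answer t)"
      have i: "int i = answer t" using t pos_mod_sign[OF n_pos] by (auto simp: i_def split: if_splits)
      show "\<exists>i. answer t = int i \<and> legal_move (length P) (xs @ [b]) i \<and> alice_to_wait q Good (xs @ [b, i]) t"
      proof (cases "trigger q ph ((l - 1) mod n)")
        case True
        have a: "int i = (r + 1) mod n" using t True i by (simp add: ph_def)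
        have "legal_move (length P) (xs @ [b]) i" using legal_right[OF arc1 _ _ a] lr space by simp
        moreover have "alice_to_wait q Good (xs @ [b, i]) t"
          by (rule wait'[where l' = "l - 1" and r' = "r + 1"])
            (use t True lr arc1 arc2 a step' slice_int[OF a] trigger_phase[OF True] in \<open>auto simp: ph_def\<close>)
        ultimately show ?thesis by (intro exI[of _ i]) (simp add: i)
      next
        case False
        have a2: "int i = (l - 2) mod n" using t False i by (simp add: ph_def)
        then have a: "int i = (l - 1 - 1) mod n" by simp
        have b: "int b = (l - 1 - 1 + 1) mod n" using left by simp
        have "legal_move (length P) (xs @ [b]) i" using legal_left[OF arc1 _ _ a] lr space by simp
        moreover have "alice_to_wait q Good (xs @ [b, i]) t"
          by (rule wait'[where l' = "l - 2" and r' = r])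
            (use t False lr arc1 arc2 a2 step' slice_int[OF a2] neighbor_mod(2)[OF a b] in \<open>auto simp: ph_def\<close>)
        ultimately show ?thesis by (intro exI[of _ i]) (simp add: i)
      qed
    qed (use left in auto)
  qed
qed

end

section \<open>From a winning plan to all plays against arbitrary moves of Bob\<close>

context pizza
begin

theorem play_by_plan:
  assumes pre: "run pre (input P) K (\<lambda>s. \<exists>q. knows n q s \<and> ivar s ''phase'' = first_phase q \<and>
      first_slice q \<in> {0..<n} \<and> wins q \<tau>)"
  shows "\<exists>k s. exec pre (input P) k s \<and> k \<le> K"
    and "reachable pre turn P xs s \<Longrightarrow> even (length xs) \<Longrightarrow> length xs < length P \<Longrightarrow>
      \<exists>k t i. exec turn (observe xs s) k t \<and> k \<le> 20 \<and> answer t = int i \<and> legal_move (length P) xs i"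
    and "reachable pre turn P xs s \<Longrightarrow> length xs = length P \<Longrightarrow>
      alice_jumps (length P) xs \<le> 2 \<and> \<tau> \<le> alice_gain P xs"
proof -
  obtain k0 s0 q where s0: "exec pre (input P) k0 s0" "k0 \<le> K" and q: "knows n q s0"
    "ivar s0 ''phase'' = first_phase q" "first_slice q \<in> {0..<n}" "wins q \<tau>"
    using pre unfolding run_def by blast
  then show "\<exists>k s. exec pre (input P) k s \<and> k \<le> K" by blast
  from q(4) obtain Good where good: "first_phase q \<in> {0..2}"
    "Good (first_phase q) (first_slice q) (first_slice q) (slice (first_slice q))"
    and all: "\<forall>ph l r G. Good ph l r G \<longrightarrow>
         (n - 2 \<le> r - l \<longrightarrow> \<tau> \<le> G) \<and>
         (r - l < n - 2 \<longrightarrow>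
           (if trigger q ph ((r + 1) mod n) then Good (ph + 1) (l - 1) (r + 1) (G + slice (l - 1))
            else Good ph l (r + 2) (G + slice (r + 2))) \<and>
           (if trigger q ph ((l - 1) mod n) then Good (ph + 1) (l - 1) (r + 1) (G + slice (r + 1))
            else Good ph (l - 2) r (G + slice (l - 2))))"
    unfolding wins_def by (elim conjE exE) (rule that)
  have final: "\<tau> \<le> G" if "Good ph l r G" "n - 2 \<le> r - l" for ph l r G
    using all[rule_format, OF that(1)] that(2) by simp
  have step: "good_step q Good"
    unfolding good_step_def using all by simp
  have turn: "run turn (observe xs s) 20 (\<lambda>t. \<exists>i. answer t = int i \<and> legal_move (length P) xs i \<and>
      alice_to_wait q Good (xs @ [i]) t)"
    if "xs = [] \<and> s = s0 \<or> (\<exists>ys b. xs = ys @ [b] \<and> alice_to_wait q Good ys s \<and> legal_move (length P) ys b)"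
      "length xs < length P" for xs s
    using that(1)
  proof (elim disjE exE conjE)
    assume "xs = []" "s = s0"
    then show ?thesis using first_turn[where Good = Good, OF q(1-3) good(1,2)] by simp
  next
    fix ys b assume ys: "xs = ys @ [b]" "alice_to_wait q Good ys s" "legal_move (length P) ys b"
    then show ?thesis using later_turn[OF ys(2,3) _ step] that(2) by simp
  qed
  \<comment> \<open>At Alice's turns the invariant describes the play without Bob's last move, since
    her memory stays unchanged until she observes that move.\<close>
  have inv: "if odd (length xs) then alice_to_wait q Good xs s
      else xs = [] \<and> s = s0 \<or> (\<exists>ys b. xs = ys @ [b] \<and> alice_to_wait q Good ys s \<and> legal_move (length P) ys b)"
    if "reachable pre turn P xs s" for xs s
    using that
  proof induction
    case (precomputed k s)
    then show ?case using exec_deterministic[OF s0(1)] by simp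
  next
    case (alice xs s k t i)
    then have "run turn (observe xs s) 20 (\<lambda>t. \<exists>i. answer t = int i \<and> legal_move (length P) xs i \<and>
      alice_to_wait q Good (xs @ [i]) t)" by (intro turn) simp_all
    from run_exec[OF this alice.hyps(4)] alice.hyps(2,5) show ?case by auto
  next
    case (bob xs s i)
    then show ?case by auto
  qed
  show "\<exists>k t i. exec turn (observe xs s) k t \<and> k \<le> 20 \<and> answer t = int i \<and> legal_move (length P) xs i"
    if "reachable pre turn P xs s" "even (length xs)" "length xs < length P"
  proof -
    have "run turn (observe xs s) 20 (\<lambda>t. \<exists>i. answer t = int i \<and> legal_move (length P) xs i \<and>
      alice_to_wait q Good (xs @ [i]) t)" using inv[OF that(1)] that(2,3) by (intro turn) simp_all
    then show ?thesis unfolding run_def by blast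
  qed
  show "alice_jumps (length P) xs \<le> 2 \<and> \<tau> \<le> alice_gain P xs"
    if reach: "reachable pre turn P xs s" "length xs = length P"
  proof (cases "odd (length xs)")
    case True
    then obtain l r where "Good (ivar s ''phase'') l r (alice_gain P xs)" "int (length xs) = r - l + 1"
      "int (alice_jumps (length P) xs) \<le> 2"
      using inv[OF reach(1)] unfolding alice_to_wait_def by auto
    then show ?thesis using final reach(2) by (auto simp: n_def)
  next
    \<comment> \<open>For even \<open>n\<close> Bob takes the last slice, so gain and jumps are
      those of the play before it.\<close>
    case False
    have "xs \<noteq> []" using reach(2) cutting by (auto simp: cutting_def)
    then obtain ys b where xs: "xs = ys @ [b]" "alice_to_wait q Good ys s"
      using inv[OF reach(1)] False by auto
    then obtain l r where "Good (ivar s ''phase'') l r (alice_gain P ys)" "int (length ys) = r - l + 1"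
      "int (alice_jumps (length P) ys) \<le> 2" "odd (length ys)"
      unfolding alice_to_wait_def by auto
    then show ?thesis using final reach(2) xs(1) alice_gain_snoc[of P ys b] alice_jumps_snoc[of "length P" ys b]
      by (auto simp: n_def)
  qed
qed

end

section \<open>Counting loops, minimum search and threshold search\<close>

definition For :: "vname \<Rightarrow> iexp \<Rightarrow> iexp \<Rightarrow> com \<Rightarrow> com" where
  "For i a b c = Seq (IAssign i a) (While (ILe (IVar i) b) (Seq c (IAssign i (IAdd (IVar i) (IConst 1)))))"

lemma run_While:
  assumes "I lo s" "lo \<le> hi + 1"
    and cond: "\<And>j t. I j t \<Longrightarrow> bval b t \<longleftrightarrow> j \<le> hi"
    and body: "\<And>j t. I j t \<Longrightarrow> lo \<le> j \<Longrightarrow> j \<le> hi \<Longrightarrow> run c t K (I (j + 1))"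
  shows "run (While b c) s (nat (hi + 1 - lo) * (K + 1) + 1) (I (hi + 1))"
  using assms(1,2) body
proof (induction "nat (hi + 1 - lo)" arbitrary: lo s)
  case 0
  then have "lo = hi + 1" by simp
  then have "exec (While b c) s 1 s" using cond[OF 0(2)] by (intro exec.WhileFalse) simp
  then show ?case using 0 \<open>lo = hi + 1\<close> unfolding run_def by auto
next
  case (Suc m)
  have lo: "lo \<le> hi" using Suc(2) by simp
  obtain k t where t: "exec c s k t" "k \<le> K" "I (lo + 1) t"
    using Suc(5)[OF Suc(3) order_refl lo] unfolding run_def by blast
  have "run (While b c) t (nat (hi + 1 - (lo + 1)) * (K + 1) + 1) (I (hi + 1))"
    by (rule Suc(1)) (use Suc(2,5) t lo in auto)
  then obtain l u where u: "exec (While b c) t l u" "l \<le> nat (hi + 1 - (lo + 1)) * (K + 1) + 1" "I (hi + 1) u"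
    unfolding run_def by blast
  have "exec (While b c) s (k + l + 1) u" using t u cond[OF Suc(3)] lo by (intro exec.WhileTrue) auto
  moreover have "nat (hi + 1 - lo) = Suc (nat (hi + 1 - (lo + 1)))" using lo by simp
  ultimately show ?case using t(2) u unfolding run_def by (intro exI[of _ "k + l + 1"] exI[of _ u]) simp
qed

lemma run_For:
  assumes "I (ival a s) (s\<lparr>ivar := (ivar s)(i := ival a s)\<rparr>)" "ival a s \<le> hi + 1"
    and var: "\<And>j t. I j t \<Longrightarrow> ivar t i = j \<and> ival b t = hi"
    and body: "straight c" "\<And>j t. I j t \<Longrightarrow> ival a s \<le> j \<Longrightarrow> j \<le> hi \<Longrightarrow>
      I (j + 1) (result (Seq c (IAssign i (IAdd (IVar i) (IConst 1)))) t)"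
  shows "run (For i a b c) s (nat (hi + 1 - ival a s) * (cost c + 2) + 2) (I (hi + 1))"
proof -
  have "run (While (ILe (IVar i) b) (Seq c (IAssign i (IAdd (IVar i) (IConst 1)))))
      (s\<lparr>ivar := (ivar s)(i := ival a s)\<rparr>) (nat (hi + 1 - ival a s) * (cost c + 1 + 1) + 1) (I (hi + 1))"
  proof (rule run_While[where I = I])
    show "I (ival a s) (s\<lparr>ivar := (ivar s)(i := ival a s)\<rparr>)" "ival a s \<le> hi + 1" by fact+
    show "bval (ILe (IVar i) b) t \<longleftrightarrow> j \<le> hi" if "I j t" for j t using var[OF that] by simp
    show "run (Seq c (IAssign i (IAdd (IVar i) (IConst 1)))) t (cost c + 1) (I (j + 1))"
      if "I j t" "ival a s \<le> j" "j \<le> hi" for j t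
      using that body by (intro run_straightI) auto
  qed
  then have "run (For i a b c) s (1 + (nat (hi + 1 - ival a s) * (cost c + 1 + 1) + 1)) (I (hi + 1))"
    unfolding For_def by - (rule run_Seq, rule run_straightI, simp_all)
  then show ?thesis by (rule run_mono) auto
qed

definition argmin :: "vname \<Rightarrow> iexp \<Rightarrow> iexp \<Rightarrow> (iexp \<Rightarrow> rexp) \<Rightarrow> com" where
  "argmin x a b f = Seq (IAssign x a)
     (For ''i'' a b (If (RLe (f (IVar x)) (f (IVar ''i''))) Skip (IAssign x (IVar ''i''))))"

text \<open>The template \<open>f\<close> is evaluated both at the incumbent \<open>x\<close> and at
  the counter. The loop overwrites these two variables, so the bounds must be insensitive to them
  and \<open>f\<close> must be correct for all their values.\<close>

lemma run_argmin:
  assumes x: "x \<noteq> ''i''" and le: "ival a s \<le> ival b s"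
    and ab: "\<And>y z. ival a (s\<lparr>ivar := (ivar s)(x := y, ''i'' := z)\<rparr>) = ival a s"
      "\<And>y z. ival b (s\<lparr>ivar := (ivar s)(x := y, ''i'' := z)\<rparr>) = ival b s"
    and f: "\<And>y z v. y \<in> {ival a s..ival b s} \<Longrightarrow> z \<in> {ival a s..ival b s} \<Longrightarrow> v \<in> {x, ''i''} \<Longrightarrow>
      rval (f (IVar v)) (s\<lparr>ivar := (ivar s)(x := y, ''i'' := z)\<rparr>) = F (if v = x then y else z)"
  shows "run (argmin x a b f) s (nat (ival b s + 1 - ival a s) * 4 + 3) (\<lambda>t. \<exists>m z. m \<in> {ival a s..ival b s} \<and>
    (\<forall>j\<in>{ival a s..ival b s}. F m \<le> F j) \<and> t = s\<lparr>ivar := (ivar s)(x := m, ''i'' := z)\<rparr>)"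
proof -
  define lo hi where "lo = ival a s" and "hi = ival b s"
  define I where "I j t \<longleftrightarrow> (\<exists>m. m \<in> {lo..hi} \<and> (\<forall>i\<in>{lo..<j}. F m \<le> F i) \<and>
    t = s\<lparr>ivar := (ivar s)(x := m, ''i'' := j)\<rparr>)" for j t
  let ?s = "s\<lparr>ivar := (ivar s)(x := lo)\<rparr>"
  let ?c = "If (RLe (f (IVar x)) (f (IVar ''i''))) Skip (IAssign x (IVar ''i''))"
  have s': "ival a ?s = lo"
  proof -
    have "(ivar s)(x := lo, ''i'' := ivar s ''i'') = (ivar s)(x := lo)" using x by (intro ext) simp
    then show ?thesis using ab(1)[of lo "ivar s ''i''"] by (simp add: lo_def)
  qed
  have "run (For ''i'' a b ?c) ?s (nat (hi + 1 - ival a ?s) * (cost ?c + 2) + 2) (I (hi + 1))"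
  proof (rule run_For)
    show "I (ival a ?s) (?s\<lparr>ivar := (ivar ?s)(''i'' := ival a ?s)\<rparr>)"
      unfolding s' I_def using le by (intro exI[of _ lo]) (auto simp: lo_def hi_def)
    show "ival a ?s \<le> hi + 1" using le s' by (simp add: lo_def hi_def)
    show "ivar t ''i'' = j \<and> ival b t = hi" if "I j t" for j t
      using that ab(2) by (auto simp: I_def hi_def)
    show "I (j + 1) (result (Seq ?c (IAssign ''i'' (IAdd (IVar ''i'') (IConst 1)))) t)"
      if t: "I j t" "ival a ?s \<le> j" "j \<le> hi" for j t
    proof -
      obtain m where m: "m \<in> {lo..hi}" "\<forall>i\<in>{lo..<j}. F m \<le> F i" "t = s\<lparr>ivar := (ivar s)(x := m, ''i'' := j)\<rparr>"
        using t(1) unfolding I_def by blast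
      have j: "j \<in> {lo..hi}" "{lo..<j + 1} = insert j {lo..<j}" using t(2,3) s' by auto
      have "rval (f (IVar x)) t = F m" "rval (f (IVar ''i'')) t = F j"
        using f[of m j x] f[of m j "''i''"] m(1) j x unfolding m(3) lo_def hi_def by auto
      note v = this
      show ?thesis
      proof (cases "F m \<le> F j")
        case True
        then show ?thesis unfolding I_def using m j x v by (intro exI[of _ m]) auto
      next
        case False
        then show ?thesis unfolding I_def using m j x v by (intro exI[of _ j]) (auto simp: fun_upd_twist[of x] intro: order_trans)
      qed
    qed
  qed simp
  then have "run (For ''i'' a b ?c) ?s (nat (hi + 1 - lo) * 4 + 2) (I (hi + 1))"
    unfolding s' by (rule run_mono) auto
  then have "run (argmin x a b f) s (1 + (nat (hi + 1 - lo) * 4 + 2)) (I (hi + 1))"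
    unfolding argmin_def by - (rule run_Seq, rule run_straightI, simp_all add: lo_def)
  then show ?thesis by (rule run_mono) (auto simp: I_def lo_def hi_def)
qed

text \<open>If no index falls below the threshold, \<open>x\<close> keeps its initial value; each
  caller stores the appropriate default beforehand.\<close>

definition last_below :: "vname \<Rightarrow> iexp \<Rightarrow> iexp \<Rightarrow> (iexp \<Rightarrow> rexp) \<Rightarrow> rexp \<Rightarrow> com" where
  "last_below x a b f c = For ''i'' a b (If (RLe c (f (IVar ''i''))) Skip (IAssign x (IVar ''i'')))"

lemma run_last_below:
  assumes x: "x \<noteq> ''i''" and le: "ival a s \<le> ival b s + 1"
    and ab: "\<And>y z. ival b (s\<lparr>ivar := (ivar s)(x := y, ''i'' := z)\<rparr>) = ival b s"
    and f: "\<And>y z. z \<in> {ival a s..ival b s} \<Longrightarrow>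
      rval (f (IVar ''i'')) (s\<lparr>ivar := (ivar s)(x := y, ''i'' := z)\<rparr>) = F z"
      "\<And>y z. rval c (s\<lparr>ivar := (ivar s)(x := y, ''i'' := z)\<rparr>) = \<theta>"
  shows "run (last_below x a b f c) s (nat (ival b s + 1 - ival a s) * 4 + 2) (\<lambda>t. \<exists>m z.
    (m = ivar s x \<or> m \<in> {ival a s..ival b s} \<and> F m < \<theta>) \<and>
    (\<forall>j\<in>{ival a s..ival b s}. m < j \<longrightarrow> \<theta> \<le> F j) \<and> t = s\<lparr>ivar := (ivar s)(x := m, ''i'' := z)\<rparr>)"
proof -
  define lo hi where "lo = ival a s" and "hi = ival b s"
  define I where "I j t \<longleftrightarrow> (\<exists>m. (m = ivar s x \<or> m \<in> {lo..<j} \<and> F m < \<theta>) \<and> (\<forall>i\<in>{lo..<j}. m < i \<longrightarrow> \<theta> \<le> F i) \<and>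
    t = s\<lparr>ivar := (ivar s)(x := m, ''i'' := j)\<rparr>)" for j t
  let ?c = "If (RLe c (f (IVar ''i''))) Skip (IAssign x (IVar ''i''))"
  have "run (For ''i'' a b ?c) s (nat (hi + 1 - ival a s) * (cost ?c + 2) + 2) (I (hi + 1))"
  proof (rule run_For)
    have "(ivar s)(x := ivar s x) = ivar s" by simp
    then show "I (ival a s) (s\<lparr>ivar := (ivar s)(''i'' := ival a s)\<rparr>)"
      unfolding I_def lo_def by (intro exI[of _ "ivar s x"]) simp
    show "ival a s \<le> hi + 1" using le by (simp add: hi_def)
    show "ivar t ''i'' = j \<and> ival b t = hi" if "I j t" for j t
      using that ab by (auto simp: I_def hi_def)
    show "I (j + 1) (result (Seq ?c (IAssign ''i'' (IAdd (IVar ''i'') (IConst 1)))) t)"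
      if t: "I j t" "ival a s \<le> j" "j \<le> hi" for j t
    proof -
      obtain m where m: "m = ivar s x \<or> m \<in> {lo..<j} \<and> F m < \<theta>" "\<forall>i\<in>{lo..<j}. m < i \<longrightarrow> \<theta> \<le> F i"
          "t = s\<lparr>ivar := (ivar s)(x := m, ''i'' := j)\<rparr>"
        using t(1) unfolding I_def by blast
      have j: "j \<in> {lo..hi}" "{lo..<j + 1} = insert j {lo..<j}" using t(2,3) by (auto simp: lo_def)
      have v: "rval (f (IVar ''i'')) t = F j" "rval c t = \<theta>"
        using f(1)[of j m] f(2)[of m j] j unfolding m(3) lo_def hi_def by auto
      show ?thesis
      proof (cases "\<theta> \<le> F j")
        case True
        then show ?thesis unfolding I_def using m j x v by (intro exI[of _ m]) auto
      next
        case False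
        then show ?thesis unfolding I_def using m j x v by (intro exI[of _ j]) (auto simp: fun_upd_twist[of x])
      qed
    qed
  qed simp
  then show ?thesis unfolding last_below_def
    by (rule run_mono) (auto simp: I_def lo_def hi_def)
qed

section \<open>The precomputation\<close>

definition plan_of :: "mem \<Rightarrow> plan" where
  "plan_of s = \<lparr>first_slice = ivar s ''start'', first_phase = ivar s ''phase'',
     switch1 = ivar s ''switch1'', switch2 = ivar s ''switch2'',
     end1 = ivar s ''end1'', end2 = ivar s ''end2''\<rparr>"

lemma knows_plan_of: "ivar s ''n'' = m \<Longrightarrow> knows m (plan_of s) s"
  by (simp add: knows_def plan_of_def)

text \<open>The machine cannot divide integers, so half of \<open>n\<close>, rounded up, is found by
  counting until its double reaches \<open>n\<close>. Parity is then decided by comparing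
  \<open>2 * h\<close> with \<open>n\<close>.\<close>

definition halve :: com where
  "halve = For ''i'' (IConst 1) (IVar ''n'')
     (If (ILe (IVar ''n'') (IAdd (IVar ''h'') (IVar ''h''))) Skip (IAssign ''h'' (IAdd (IVar ''h'') (IConst 1))))"

lemma run_halve:
  assumes m: "ivar s ''n'' = m" "0 < m" and h0: "ivar s ''h'' = 0"
  shows "run halve s (nat m * 4 + 2) (\<lambda>t. \<exists>z. t = s\<lparr>ivar := (ivar s)(''h'' := (m + 1) div 2, ''i'' := z)\<rparr>)"
proof -
  let ?c = "If (ILe (IVar ''n'') (IAdd (IVar ''h'') (IVar ''h''))) Skip (IAssign ''h'' (IAdd (IVar ''h'') (IConst 1)))"
  define I where "I j t \<longleftrightarrow> t = s\<lparr>ivar := (ivar s)(''h'' := min (j - 1) ((m + 1) div 2), ''i'' := j)\<rparr>" for j t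
  have "run halve s (nat (m + 1 - ival (IConst 1) s) * (cost ?c + 2) + 2) (I (m + 1))"
    unfolding halve_def
  proof (rule run_For)
    have "(ivar s)(''h'' := 0) = ivar s" using h0 by (metis fun_upd_triv)
    then show "I (ival (IConst 1) s) (s\<lparr>ivar := (ivar s)(''i'' := ival (IConst 1) s)\<rparr>)"
      using m(2) by (simp add: I_def)
    show "ivar t ''i'' = j \<and> ival (IVar ''n'') t = m" if "I j t" for j t
      using that m by (simp add: I_def)
    show "I (j + 1) (result (Seq ?c (IAssign ''i'' (IAdd (IVar ''i'') (IConst 1)))) t)"
      if "I j t" "ival (IConst 1) s \<le> j" "j \<le> m" for j t
    proof (cases "m \<le> 2 * min (j - 1) ((m + 1) div 2)")
      case True
      then have "min (j - 1) ((m + 1) div 2) = min j ((m + 1) div 2)" by (auto simp: min_def)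
      then show ?thesis using that m True by (simp add: I_def fun_upd_twist)
    next
      case False
      moreover have "m \<le> 2 * ((m + 1) div 2)" by presburger
      ultimately have "j - 1 < (m + 1) div 2" by (cases "j - 1 \<le> (m + 1) div 2") (auto simp: min_def)
      then have "min (j - 1) ((m + 1) div 2) + 1 = min j ((m + 1) div 2)" by (auto simp: min_def)
      then show ?thesis using that m False by (simp add: I_def fun_upd_twist)
    qed
  qed (use m in auto)
  moreover have "min m ((m + 1) div 2) = (m + 1) div 2" using m(2) by (auto simp: min_def)
  ultimately show ?thesis by (elim run_mono) (auto simp: I_def)
qed

context pizza
begin

lemma wins_mono:
  assumes "wins q \<tau>" "\<tau>' \<le> \<tau>"
  shows "wins q \<tau>'"
proof -
  have *: "(n - 2 \<le> d \<longrightarrow> \<tau> \<le> G) \<longrightarrow> (n - 2 \<le> d \<longrightarrow> \<tau>' \<le> G)" for d G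
    using assms(2) by auto
  show ?thesis
    using assms(1) unfolding wins_def by (elim conjE exE, intro conjI exI) (assumption | blast intro: *[rule_format])+
qed

definition loaded :: "mem \<Rightarrow> bool" where
  "loaded s \<longleftrightarrow> ivar s ''n'' = n \<and> (\<forall>i\<in>{0..<n}. rarr s ''p'' i = slice i)"

lemma slice_sum_even_odd:
  "0 \<le> m \<Longrightarrow> (\<Sum>x\<in>{0..<2 * m}. slice x) = (\<Sum>i\<in>{0..<m}. slice (2 * i)) + (\<Sum>i\<in>{0..<m}. slice (2 * i + 1))"
proof (induction m rule: int_ge_induct)
  case (step m)
  have "{0..<2 * (m + 1)} = insert (2 * m) (insert (2 * m + 1) {0..<2 * m})"
    and "{0..<m + 1} = insert m {0..<m}" using step(1) by auto
  then show ?case using step by simp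
qed simp

end

section \<open>Precomputation for an even number of slices\<close>

definition even_plan :: com where
  "even_plan = Seq (RAssign ''even'' (RConst 0)) (Seq (RAssign ''odd'' (RConst 0))
     (Seq (For ''i'' (IConst 0) (ISub (IVar ''h'') (IConst 1))
        (Seq (RAssign ''even'' (RAdd (RVar ''even'') (RLoad ''p'' (IAdd (IVar ''i'') (IVar ''i'')))))
          (RAssign ''odd'' (RAdd (RVar ''odd'') (RLoad ''p'' (IAdd (IAdd (IVar ''i'') (IVar ''i'')) (IConst 1)))))))
     (Seq (IAssign ''phase'' (IConst 2))
        (If (RLe (RVar ''odd'') (RVar ''even'')) (IAssign ''start'' (IConst 0)) (IAssign ''start'' (IConst 1))))))"

lemma (in pizza) run_even_plan:
  assumes s: "loaded s" and m: "n = 2 * m" "ivar s ''h'' = m"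
  shows "run even_plan s (nat m * 4 + 7) (\<lambda>t. ivar t ''n'' = n \<and> ivar t ''start'' \<in> {0..<n} \<and>
    wins (plan_of t) (1 / 2 * sum_list P))"
proof -
  define I where "I j t \<longleftrightarrow> ivar t ''n'' = n \<and> ivar t ''i'' = j \<and> ivar t ''h'' = m \<and> rarr t = rarr s \<and>
    rvar t ''even'' = (\<Sum>i\<in>{0..<j}. slice (2 * i)) \<and> rvar t ''odd'' = (\<Sum>i\<in>{0..<j}. slice (2 * i + 1))" for j and t :: mem
  let ?c = "Seq (RAssign ''even'' (RAdd (RVar ''even'') (RLoad ''p'' (IAdd (IVar ''i'') (IVar ''i'')))))
          (RAssign ''odd'' (RAdd (RVar ''odd'') (RLoad ''p'' (IAdd (IAdd (IVar ''i'') (IVar ''i'')) (IConst 1)))))"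
  let ?s = "s\<lparr>rvar := (rvar s)(''even'' := 0, ''odd'' := 0)\<rparr>"
  have "run (For ''i'' (IConst 0) (ISub (IVar ''h'') (IConst 1)) ?c) ?s
      (nat (m - 1 + 1 - ival (IConst 0) ?s) * (cost ?c + 2) + 2) (I (m - 1 + 1))"
  proof (rule run_For)
    show "I (ival (IConst 0) ?s) (?s\<lparr>ivar := (ivar ?s)(''i'' := ival (IConst 0) ?s)\<rparr>)"
      using s m by (simp add: I_def loaded_def)
    show "ivar t ''i'' = j \<and> ival (ISub (IVar ''h'') (IConst 1)) t = m - 1" if "I j t" for j t
      using that by (simp add: I_def)
    show "I (j + 1) (result (Seq ?c (IAssign ''i'' (IAdd (IVar ''i'') (IConst 1)))) t)"
      if t: "I j t" "ival (IConst 0) ?s \<le> j" "j \<le> m - 1" for j t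
    proof -
      have "rarr t ''p'' (j + j) = slice (2 * j)" "rarr t ''p'' (j + j + 1) = slice (2 * j + 1)"
        using s t m by (auto simp: I_def loaded_def)
      moreover have "{0..<j + 1} = insert j {0..<j}" using t by auto
      ultimately show ?thesis using t by (simp add: I_def)
    qed
  qed (use m n_pos in auto)
  then have loop: "run (For ''i'' (IConst 0) (ISub (IVar ''h'') (IConst 1)) ?c) ?s (nat m * 4 + 2) (I m)"
    by (rule run_mono) auto
  have last: "run (Seq (IAssign ''phase'' (IConst 2))
        (If (RLe (RVar ''odd'') (RVar ''even'')) (IAssign ''start'' (IConst 0)) (IAssign ''start'' (IConst 1)))) t 3
      (\<lambda>t. ivar t ''n'' = n \<and> ivar t ''start'' \<in> {0..<n} \<and> wins (plan_of t) (1 / 2 * sum_list P))"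
    if t: "I m t" for t
  proof -
    have total: "sum_list P = (\<Sum>i\<in>{0..<m}. slice (2 * i)) + (\<Sum>i\<in>{0..<m}. slice (2 * i + 1))"
      using slice_sum_even_odd[of m] n_pos m by (simp add: sum_slice[symmetric])
    have q: "wins q (\<Sum>i\<in>{0..<m}. slice (first_slice q + 2 * i))" if "first_phase q = 2" for q
      by (rule wins_even[OF m(1) that])
    show ?thesis
    proof (cases "rvar t ''odd'' \<le> rvar t ''even''")
      case True
      then show ?thesis using t total n_pos
        by (intro run_straightI) (auto simp: I_def plan_of_def intro!: wins_mono[OF q])
    next
      case False
      then show ?thesis using t total n_pos m(1)
        by (intro run_straightI) (auto simp: I_def plan_of_def add.commute intro!: wins_mono[OF q])
    qed
  qed
  have "run (Seq (For ''i'' (IConst 0) (ISub (IVar ''h'') (IConst 1)) ?c) (Seq (IAssign ''phase'' (IConst 2))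
        (If (RLe (RVar ''odd'') (RVar ''even'')) (IAssign ''start'' (IConst 0)) (IAssign ''start'' (IConst 1)))))
      ?s (nat m * 4 + 2 + 3)
      (\<lambda>t. ivar t ''n'' = n \<and> ivar t ''start'' \<in> {0..<n} \<and> wins (plan_of t) (1 / 2 * sum_list P))"
    by (rule run_Seq, rule run_mono[OF loop order_refl]) (rule last)
  then have "run even_plan s (1 + (1 + (nat m * 4 + 2 + 3)))
      (\<lambda>t. ivar t ''n'' = n \<and> ivar t ''start'' \<in> {0..<n} \<and> wins (plan_of t) (1 / 2 * sum_list P))"
    unfolding even_plan_def by - (rule run_Seq, rule run_straightI, simp, simp, rule run_Seq, rule run_straightI, simp_all)
  then show ?thesis by (rule run_mono) auto
qed

section \<open>Tables of arc sizes and slice positions\<close>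

definition table :: com where
  "table = Seq (RStore ''W'' (IConst 0) (RConst 0)) (Seq (IAssign ''q'' (IConst 0))
     (For ''i'' (IConst 0) (IAdd (IAdd (IVar ''n'') (IVar ''n'')) (IVar ''n''))
       (Seq (RStore ''W'' (IAdd (IVar ''i'') (IConst 1)) (RAdd (RLoad ''W'' (IVar ''i'')) (RLoad ''p'' (IVar ''q''))))
       (Seq (IStore ''pos'' (IVar ''i'') (IVar ''q''))
       (Seq (IAssign ''q'' (IAdd (IVar ''q'') (IConst 2)))
       (Seq (If (ILe (IVar ''n'') (IVar ''q'')) (IAssign ''q'' (ISub (IVar ''q'') (IVar ''n''))) Skip)
         (If (ILe (IVar ''n'') (IVar ''q'')) (IAssign ''q'' (ISub (IVar ''q'') (IVar ''n''))) Skip)))))))"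

context odd_pizza
begin

text \<open>Three full turns are tabulated so that arcs starting in the first turn can be looked up
  without wrapping around. The table \<open>pos\<close> replaces the reduction modulo
  \<open>n\<close>, for which the machine has no operation.\<close>

definition ctx :: "mem \<Rightarrow> bool" where
  "ctx s \<longleftrightarrow> ivar s ''n'' = n \<and> ivar s ''h'' = h \<and> (\<forall>j\<in>{0..3 * n}. rarr s ''W'' j = W j) \<and>
     (\<forall>j\<in>{0..3 * n}. iarr s ''pos'' j = (2 * j) mod n)"

text \<open>For \<open>n = 1\<close> adding two passes \<open>n\<close> twice; this is the case for
  which the program subtracts \<open>n\<close> a second time.\<close>

lemma mod_add2:
  assumes q: "q = x mod n"
  shows "(let r = (if n \<le> q + 2 then q + 2 - n else q + 2) in if n \<le> r then r - n else r) = (x + 2) mod n"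
proof -
  have q': "0 \<le> q" "q < n" using q n_pos by auto
  have x: "(x + 2) mod n = (q + 2) mod n" by (simp add: q mod_add_left_eq)
  consider "q + 2 < n" | "n \<le> q + 2" "q + 2 < 2 * n" | "n = 1" "q = 0"
    using q' n_h h_pos by linarith
  then show ?thesis
  proof cases
    case 1
    then show ?thesis unfolding x using q' by simp
  next
    case 2
    have "(q + 2) mod n = (q + 2 - n) mod n" by (rule minus_mod_self2[symmetric])
    also have "\<dots> = q + 2 - n" by (rule mod_pos_pos_trivial) (use 2 in auto)
    finally show ?thesis unfolding x using 2 by simp
  next
    case 3
    then show ?thesis unfolding x by simp
  qed
qed

lemma run_table:
  assumes s: "loaded s" and h: "ivar s ''h'' = h"
  shows "run table s (nat n * 27 + 13) ctx"
proof -
  define I where "I j t \<longleftrightarrow> loaded t \<and> ivar t ''i'' = j \<and> ivar t ''h'' = h \<and> ivar t ''q'' = (2 * j) mod n \<and>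
    (\<forall>i\<in>{0..j}. rarr t ''W'' i = W i) \<and> (\<forall>i\<in>{0..<j}. iarr t ''pos'' i = (2 * i) mod n)" for j and t :: mem
  let ?c = "Seq (RStore ''W'' (IAdd (IVar ''i'') (IConst 1)) (RAdd (RLoad ''W'' (IVar ''i'')) (RLoad ''p'' (IVar ''q''))))
       (Seq (IStore ''pos'' (IVar ''i'') (IVar ''q''))
       (Seq (IAssign ''q'' (IAdd (IVar ''q'') (IConst 2)))
       (Seq (If (ILe (IVar ''n'') (IVar ''q'')) (IAssign ''q'' (ISub (IVar ''q'') (IVar ''n''))) Skip)
         (If (ILe (IVar ''n'') (IVar ''q'')) (IAssign ''q'' (ISub (IVar ''q'') (IVar ''n''))) Skip))))"
  let ?b = "IAdd (IAdd (IVar ''n'') (IVar ''n'')) (IVar ''n'')"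
  let ?s = "s\<lparr>rarr := (rarr s)(''W'' := (rarr s ''W'')(0 := 0)), ivar := (ivar s)(''q'' := 0)\<rparr>"
  have "run (For ''i'' (IConst 0) ?b ?c) ?s (nat (3 * n + 1 - ival (IConst 0) ?s) * (cost ?c + 2) + 2) (I (3 * n + 1))"
  proof (rule run_For)
    show "I (ival (IConst 0) ?s) (?s\<lparr>ivar := (ivar ?s)(''i'' := ival (IConst 0) ?s)\<rparr>)"
      using s h by (simp add: I_def loaded_def)
    show "ivar t ''i'' = j \<and> ival ?b t = 3 * n" if "I j t" for j t
      using that by (simp add: I_def loaded_def)
    show "I (j + 1) (result (Seq ?c (IAssign ''i'' (IAdd (IVar ''i'') (IConst 1)))) t)"
      if t: "I j t" "ival (IConst 0) ?s \<le> j" "j \<le> 3 * n" for j t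
    proof -
      have p: "rarr t ''p'' ((2 * j) mod n) = slice (2 * j)"
        using t(1) n_pos by (simp add: I_def loaded_def)
      have w: "rarr t ''W'' j = W j" using t by (simp add: I_def)
      have iv: "{0..<j + 1} = insert j {0..<j}" "{0..j + 1} = insert (j + 1) {0..j}" using t(2) by auto
      let ?q = "let r = (if n \<le> (2 * j) mod n + 2 then (2 * j) mod n + 2 - n else (2 * j) mod n + 2) in if n \<le> r then r - n else r"
      have "result (Seq ?c (IAssign ''i'' (IAdd (IVar ''i'') (IConst 1)))) t =
        t\<lparr>rarr := (rarr t)(''W'' := (rarr t ''W'')(j + 1 := W j + slice (2 * j))),
          iarr := (iarr t)(''pos'' := (iarr t ''pos'')(j := (2 * j) mod n)),
          ivar := (ivar t)(''q'' := ?q, ''i'' := j + 1)\<rparr>"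
        using t(1) p w by (simp add: I_def loaded_def Let_def)
      also have "?q = (2 * (j + 1)) mod n" using mod_add2[OF refl, of "2 * j"] by (simp add: algebra_simps)
      finally have res: "result (Seq ?c (IAssign ''i'' (IAdd (IVar ''i'') (IConst 1)))) t =
        t\<lparr>rarr := (rarr t)(''W'' := (rarr t ''W'')(j + 1 := W j + slice (2 * j))),
          iarr := (iarr t)(''pos'' := (iarr t ''pos'')(j := (2 * j) mod n)),
          ivar := (ivar t)(''q'' := (2 * (j + 1)) mod n, ''i'' := j + 1)\<rparr>" .
      have "loaded t" "ivar t ''h'' = h" "\<forall>i\<in>{0..j}. rarr t ''W'' i = W i"
        "\<forall>i\<in>{0..<j}. iarr t ''pos'' i = (2 * i) mod n" using t(1) by (auto simp: I_def)
      then show ?thesis unfolding res using W_add1[of j] by (auto simp: I_def loaded_def iv)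
    qed
  qed (use n_pos in auto)
  then have "run (For ''i'' (IConst 0) ?b ?c) ?s (nat n * 27 + 11) ctx"
    by (rule run_mono) (use n_pos in \<open>auto simp: I_def ctx_def loaded_def nat_add_distrib nat_mult_distrib\<close>)
  then have "run table s (1 + (1 + (nat n * 27 + 11))) ctx"
    unfolding table_def by - (rule run_Seq, rule run_straightI, simp, simp, rule run_Seq, rule run_straightI, simp_all)
  then show ?thesis by (rule run_mono) auto
qed

end

section \<open>Search for the best covering triple\<close>

abbreviation "WE e \<equiv> RLoad ''W'' e"
abbreviation "SE e \<equiv> RSub (WE (IAdd e (IVar ''h''))) (WE e)"

definition find_base :: com where
  "find_base = argmin ''base'' (IConst 0) (ISub (IVar ''n'') (IConst 1)) (\<lambda>e. SE e)"

text \<open>The third indices allowed for a second index \<open>i\<close> run from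
  \<open>base + h\<close> to \<open>i + h - 1\<close>. This window has a fixed left end and gains
  one index per round, so a running minimum \<open>m\<close> replaces the quadratic search over
  pairs.\<close>

definition pair_step :: com where
  "pair_step =
     Seq (If (RLe (SE (IVar ''m'')) (SE (IAdd (IVar ''i'') (ISub (IVar ''h'') (IConst 1))))) Skip
       (IAssign ''m'' (IAdd (IVar ''i'') (ISub (IVar ''h'') (IConst 1)))))
     (Seq (RAssign ''max'' (SE (IVar ''i'')))
     (Seq (If (RLe (RVar ''max'') (SE (IVar ''m''))) (RAssign ''max'' (SE (IVar ''m''))) Skip)
     (Seq (RAssign ''sum'' (RAdd (SE (IVar ''i'')) (SE (IVar ''m''))))
       (If (BAnd (RLe (RVar ''gmax'') (RVar ''max''))
              (BNot (BAnd (RLe (RVar ''max'') (RVar ''gmax'')) (BNot (RLe (RVar ''gsum'') (RVar ''sum''))))))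
         Skip
         (Seq (RAssign ''gmax'' (RVar ''max'')) (Seq (RAssign ''gsum'' (RVar ''sum''))
         (Seq (IAssign ''j2'' (IVar ''i'')) (IAssign ''j3'' (IVar ''m'')))))))))"

text \<open>The initial \<open>gmax\<close>, the total plus 1, is a sentinel above every
  half-circle.\<close>

definition find_pair :: com where
  "find_pair = Seq (Seq (RAssign ''total'' (WE (IVar ''n'')))
     (Seq (RAssign ''gmax'' (RAdd (RVar ''total'') (RConst 1)))
     (IAssign ''m'' (IAdd (IVar ''base'') (IVar ''h'')))))
     (For ''i'' (IAdd (IVar ''base'') (IConst 1)) (IAdd (IVar ''base'') (ISub (IVar ''h'') (IConst 1))) pair_step)"

context odd_pizza
begin

lemma S_at:
  assumes "ctx s" "0 \<le> j" "j + h \<le> 3 * n"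
  shows "rarr s ''W'' (j + h) - rarr s ''W'' j = S j"
  using assms h_pos by (simp add: ctx_def S_def)

lemma ctx_ivar [simp]: "x \<noteq> ''n'' \<Longrightarrow> x \<noteq> ''h'' \<Longrightarrow>
    ctx (s\<lparr>ivar := f(x := y)\<rparr>) \<longleftrightarrow> ctx (s\<lparr>ivar := f\<rparr>)"
  by (simp add: ctx_def)

lemma ctx_id [simp]: "ctx (s\<lparr>ivar := ivar s\<rparr>) \<longleftrightarrow> ctx s" "ctx (s\<lparr>rvar := g\<rparr>) \<longleftrightarrow> ctx s"
  "ctx (s\<lparr>ivar := ivar s, rvar := g\<rparr>) \<longleftrightarrow> ctx s" "ctx (s\<lparr>rvar := g, ivar := f\<rparr>) \<longleftrightarrow> ctx (s\<lparr>ivar := f\<rparr>)"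
  by (simp_all add: ctx_def)

lemma ctx_vars: "ctx s \<Longrightarrow> ivar s ''n'' = n" "ctx s \<Longrightarrow> ivar s ''h'' = h"
  by (simp_all add: ctx_def)

lemma S_periodic: "S (j + n * i) = S j"
proof (induction i rule: int_induct[of _ 0])
  case (step1 i) then show ?case using S_shift[of "j + n * i"] by (simp add: algebra_simps)
next
  case (step2 i) then show ?case using S_shift[of "j + n * (i - 1)"] by (simp add: algebra_simps)
qed simp

lemma S_mod: "S (j mod n) = S j"
  using S_periodic[of "j mod n" "j div n"] by simp

lemma run_find_base:
  assumes s: "ctx s"
  shows "run find_base s (nat n * 4 + 3)
    (\<lambda>t. ctx t \<and> ivar t ''base'' \<in> {0..<n} \<and> (\<forall>j. S (ivar t ''base'') \<le> S j))"
proof -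
  have "run find_base s (nat (ival (ISub (IVar ''n'') (IConst 1)) s + 1 - ival (IConst 0) s) * 4 + 3)
    (\<lambda>t. \<exists>m z. m \<in> {ival (IConst 0) s..ival (ISub (IVar ''n'') (IConst 1)) s} \<and>
    (\<forall>j\<in>{ival (IConst 0) s..ival (ISub (IVar ''n'') (IConst 1)) s}. S m \<le> S j) \<and>
      t = s\<lparr>ivar := (ivar s)(''base'' := m, ''i'' := z)\<rparr>)"
    unfolding find_base_def
    by (rule run_argmin) (use s n_pos n_h h_pos in \<open>auto simp: ctx_vars S_at\<close>)
  then show ?thesis
  proof (rule run_mono)
    fix t assume "\<exists>m z. m \<in> {ival (IConst 0) s..ival (ISub (IVar ''n'') (IConst 1)) s} \<and>
      (\<forall>j\<in>{ival (IConst 0) s..ival (ISub (IVar ''n'') (IConst 1)) s}. S m \<le> S j) \<and>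
      t = s\<lparr>ivar := (ivar s)(''base'' := m, ''i'' := z)\<rparr>"
    then obtain m z where m: "m \<in> {0..<n}" "\<forall>j\<in>{0..<n}. S m \<le> S j" "t = s\<lparr>ivar := (ivar s)(''base'' := m, ''i'' := z)\<rparr>"
      using s by (auto simp: ctx_vars)
    have "S m \<le> S j" for j using m(2)[rule_format, of "j mod n"] n_pos by (simp add: S_mod)
    then show "ctx t \<and> ivar t ''base'' \<in> {0..<n} \<and> (\<forall>j. S (ivar t ''base'') \<le> S j)"
      using m s by simp
  qed (use s n_pos in \<open>simp add: ctx_vars\<close>)
qed

text \<open>Ties are broken by the sum, so that no half-circle touching the overlap of the two chosen ones
  is smaller than both of them.\<close>

definition lex_le :: "real \<Rightarrow> real \<Rightarrow> int \<Rightarrow> int \<Rightarrow> bool" where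
  "lex_le g s a b \<longleftrightarrow> g < max (S a) (S b) \<or> g = max (S a) (S b) \<and> s \<le> S a + S b"

text \<open>The alternative \<open>sum_list P < gmax\<close> is the untouched sentinel. It remains
  only for \<open>n = 1\<close>, where no triple covers.\<close>

definition best_pair :: "int \<Rightarrow> mem \<Rightarrow> bool" where
  "best_pair j1 s \<longleftrightarrow> rvar s ''total'' = sum_list P \<and>
     (covers j1 (ivar s ''j2'') (ivar s ''j3'') \<and>
       rvar s ''gmax'' = max (S (ivar s ''j2'')) (S (ivar s ''j3'')) \<and>
       rvar s ''gsum'' = S (ivar s ''j2'') + S (ivar s ''j3'') \<or>
      sum_list P < rvar s ''gmax'') \<and>
     (\<forall>a b. covers j1 a b \<longrightarrow> lex_le (rvar s ''gmax'') (rvar s ''gsum'') a b)"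

lemma result_pair_step:
  assumes t: "ctx t" "ivar t ''i'' = j" "ivar t ''m'' = m" "0 \<le> j" "j + 2 * h \<le> 3 * n" "0 \<le> m" "m + h \<le> 3 * n"
  defines "m' \<equiv> if S m \<le> S (j + (h - 1)) then m else j + (h - 1)"
  defines "upd \<equiv> max (S j) (S m') < rvar t ''gmax'' \<or>
      max (S j) (S m') = rvar t ''gmax'' \<and> S j + S m' < rvar t ''gsum''"
  shows "ivar (result pair_step t) = (if upd then (ivar t)(''m'' := m', ''j2'' := j, ''j3'' := m') else (ivar t)(''m'' := m'))"
    and "rvar (result pair_step t) ''total'' = rvar t ''total''"
    and "rvar (result pair_step t) ''gmax'' = (if upd then max (S j) (S m') else rvar t ''gmax'')"
    and "rvar (result pair_step t) ''gsum'' = (if upd then S j + S m' else rvar t ''gsum'')"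
    and "rarr (result pair_step t) = rarr t" and "iarr (result pair_step t) = iarr t"
proof -
  have e: "rarr t ''W'' (j + h) - rarr t ''W'' j = S j" "rarr t ''W'' (m + h) - rarr t ''W'' m = S m"
    "rarr t ''W'' (j + (h - 1) + h) - rarr t ''W'' (j + (h - 1)) = S (j + (h - 1))"
    by (rule S_at[OF t(1)]; use t h_pos in simp)+
  have "ivar t ''h'' = h" using t(1) by (rule ctx_vars)
  note e = e this
  define t1 where "t1 = t\<lparr>ivar := (ivar t)(''m'' := m')\<rparr>"
  define t2 where "t2 = t1\<lparr>rvar := (rvar t)(''max'' := max (S j) (S m'), ''sum'' := S j + S m')\<rparr>"
  define t3 where "t3 = (if upd then t2\<lparr>ivar := (ivar t2)(''j2'' := j, ''j3'' := m'),
    rvar := (rvar t2)(''gmax'' := max (S j) (S m'), ''gsum'' := S j + S m')\<rparr> else t2)"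
  have "(ivar t)(''m'' := m) = ivar t" using t(3) by auto
  then have r1: "result (If (RLe (SE (IVar ''m'')) (SE (IAdd (IVar ''i'') (ISub (IVar ''h'') (IConst 1))))) Skip
       (IAssign ''m'' (IAdd (IVar ''i'') (ISub (IVar ''h'') (IConst 1))))) t = t1"
    using t(2,3) e by (simp add: t1_def m'_def)
  have em: "rarr t ''W'' (m' + h) - rarr t ''W'' m' = S m'" using e by (simp add: m'_def)
  have r2: "result (Seq (RAssign ''max'' (SE (IVar ''i''))) (Seq (If (RLe (RVar ''max'') (SE (IVar ''m'')))
      (RAssign ''max'' (SE (IVar ''m''))) Skip) (RAssign ''sum'' (RAdd (SE (IVar ''i'')) (SE (IVar ''m'')))))) t1 = t2"
    using t(2,3) e(1,4) em by (cases "S j \<le> S m'") (simp_all add: t1_def t2_def max_def)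
  have r3: "result (If (BAnd (RLe (RVar ''gmax'') (RVar ''max''))
      (BNot (BAnd (RLe (RVar ''max'') (RVar ''gmax'')) (BNot (RLe (RVar ''gsum'') (RVar ''sum''))))))
      Skip (Seq (RAssign ''gmax'' (RVar ''max'')) (Seq (RAssign ''gsum'' (RVar ''sum''))
         (Seq (IAssign ''j2'' (IVar ''i'')) (IAssign ''j3'' (IVar ''m'')))))) t2 = t3"
  proof -
    obtain x y where xy: "x = max (S j) (S m')" "y = S j + S m'" by simp
    have "upd \<longleftrightarrow> x < rvar t ''gmax'' \<or> x = rvar t ''gmax'' \<and> y < rvar t ''gsum''"
      by (simp add: upd_def xy)
    then show ?thesis
      using t(2) unfolding t3_def t2_def t1_def xy[symmetric] by (cases upd) (simp_all, linarith+)
  qed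
  have "result pair_step t = t3"
    unfolding r3[symmetric] r2[symmetric] r1[symmetric] pair_step_def by (simp only: result.simps)
  then show "ivar (result pair_step t) = (if upd then (ivar t)(''m'' := m', ''j2'' := j, ''j3'' := m') else (ivar t)(''m'' := m'))"
    "rvar (result pair_step t) ''total'' = rvar t ''total''"
    "rvar (result pair_step t) ''gmax'' = (if upd then max (S j) (S m') else rvar t ''gmax'')"
    "rvar (result pair_step t) ''gsum'' = (if upd then S j + S m' else rvar t ''gsum'')"
    "rarr (result pair_step t) = rarr t" "iarr (result pair_step t) = iarr t"
    by (simp_all add: t3_def t2_def t1_def)
qed

lemma run_find_pair:
  assumes s: "ctx s" and base: "ivar s ''base'' = j1" "j1 \<in> {0..<n}"
  shows "run find_pair s (nat n * 14 + 5) (\<lambda>t. ctx t \<and> ivar t ''base'' = j1 \<and> best_pair j1 t)"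
proof -
  \<comment> \<open>Before the first round the window is empty, and \<open>m\<close> already holds
    the index which that round adds; hence the separate case \<open>j = j1 + 1\<close>.\<close>
  define I where "I j t \<longleftrightarrow> ctx t \<and> ivar t ''base'' = j1 \<and> ivar t ''i'' = j \<and> rvar t ''total'' = sum_list P \<and>
     (ivar t ''m'' = j1 + h \<and> j = j1 + 1 \<or> ivar t ''m'' \<in> {j1 + h..j + h - 2}) \<and>
     (\<forall>b\<in>{j1 + h..j + h - 2}. S (ivar t ''m'') \<le> S b) \<and>
     (covers j1 (ivar t ''j2'') (ivar t ''j3'') \<and>
       rvar t ''gmax'' = max (S (ivar t ''j2'')) (S (ivar t ''j3'')) \<and>
       rvar t ''gsum'' = S (ivar t ''j2'') + S (ivar t ''j3'') \<or> sum_list P < rvar t ''gmax'') \<and>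
     (\<forall>a b. covers j1 a b \<longrightarrow> a < j \<longrightarrow> lex_le (rvar t ''gmax'') (rvar t ''gsum'') a b)" for j and t :: mem
  let ?a = "IAdd (IVar ''base'') (IConst 1)" and ?b = "IAdd (IVar ''base'') (ISub (IVar ''h'') (IConst 1))"
  let ?s = "s\<lparr>rvar := (rvar s)(''total'' := sum_list P, ''gmax'' := sum_list P + 1), ivar := (ivar s)(''m'' := j1 + h)\<rparr>"
  have small: "j1 + 3 * h \<le> 3 * n" using base n_h h_pos by simp
  have "run (For ''i'' ?a ?b pair_step) ?s (nat (j1 + h - 1 + 1 - ival ?a ?s) * (cost pair_step + 2) + 2) (I (j1 + h - 1 + 1))"
  proof (rule run_For)
    show "I (ival ?a ?s) (?s\<lparr>ivar := (ivar ?s)(''i'' := ival ?a ?s)\<rparr>)"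
      using s base by (simp add: I_def covers_def ctx_vars)
    show "ival ?a ?s \<le> j1 + h - 1 + 1" using base h_pos by simp
    show "ivar t ''i'' = j \<and> ival ?b t = j1 + h - 1" if "I j t" for j t
      using that by (simp add: I_def ctx_vars)
    show "straight pair_step" by (simp add: pair_step_def)
    show "I (j + 1) (result (Seq pair_step (IAssign ''i'' (IAdd (IVar ''i'') (IConst 1)))) t)"
      if t: "I j t" "ival ?a ?s \<le> j" "j \<le> j1 + h - 1" for j t
    proof -
      define m where "m = ivar t ''m''"
      define m' where "m' = (if S m \<le> S (j + (h - 1)) then m else j + (h - 1))"
      define u where "u = result pair_step t"
      have j: "j1 + 1 \<le> j" using t(2) base by simp
      have m: "m = j1 + h \<and> j = j1 + 1 \<or> m \<in> {j1 + h..j + h - 2}" "\<forall>b\<in>{j1 + h..j + h - 2}. S m \<le> S b"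
        using t(1) by (auto simp: I_def m_def)
      have old: "ctx t" "ivar t ''base'' = j1" "ivar t ''i'' = j" "rvar t ''total'' = sum_list P"
        "covers j1 (ivar t ''j2'') (ivar t ''j3'') \<and>
          rvar t ''gmax'' = max (S (ivar t ''j2'')) (S (ivar t ''j3'')) \<and>
          rvar t ''gsum'' = S (ivar t ''j2'') + S (ivar t ''j3'') \<or> sum_list P < rvar t ''gmax''"
        "\<And>a b. covers j1 a b \<Longrightarrow> a < j \<Longrightarrow> lex_le (rvar t ''gmax'') (rvar t ''gsum'') a b"
        using t(1) by (auto simp: I_def)
      have bnd: "0 \<le> j" "j + 2 * h \<le> 3 * n" "0 \<le> m" "m + h \<le> 3 * n"
        using j m(1) t(3) small base(2) h_pos by auto
      note step = result_pair_step[OF old(1,3) m_def[symmetric] bnd, folded m'_def u_def]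
      have m'1: "m' \<in> {j1 + h..j + h - 1}" using m(1) j h_pos by (auto simp: m'_def)
      have m'2: "S m' \<le> S b" if "b \<in> {j1 + h..j + h - 1}" for b
      proof (cases "b = j + (h - 1)")
        case True
        then show ?thesis by (simp add: m'_def)
      next
        case False
        then have "S m \<le> S b" using that m(2) by auto
        then show ?thesis by (simp add: m'_def)
      qed
      have cov: "covers j1 j m'" using m'1 j t(3) by (auto simp: covers_def)
      \<comment> \<open>For a fixed second index both the maximum and the sum are monotone in
        \<open>S b\<close>, so the minimum \<open>m'\<close> of the window stands for all third
        indices.\<close>
      have new: "lex_le (rvar u ''gmax'') (rvar u ''gsum'') a b" if ab: "covers j1 a b" "a < j + 1" for a b
      proof (cases "a = j")
        case True
        then have "S m' \<le> S b" using ab by (intro m'2) (auto simp: covers_def)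
        then show ?thesis unfolding step(3,4) lex_le_def True by (auto simp: max_def split: if_splits)
      next
        case False
        then have "lex_le (rvar t ''gmax'') (rvar t ''gsum'') a b" using ab by (intro old(6)) auto
        then show ?thesis unfolding step(3,4) lex_le_def by (auto split: if_splits)
      qed
      have pair: "covers j1 (ivar u ''j2'') (ivar u ''j3'') \<and>
          rvar u ''gmax'' = max (S (ivar u ''j2'')) (S (ivar u ''j3'')) \<and>
          rvar u ''gsum'' = S (ivar u ''j2'') + S (ivar u ''j3'') \<or> sum_list P < rvar u ''gmax''"
        using old(5) cov unfolding step(1,3,4) by (simp split: if_split)
      have vars: "ctx u" "ivar u ''base'' = j1" "ivar u ''i'' = j" "ivar u ''m'' = m'" "rvar u ''total'' = sum_list P"
        using old(1-4) step(1,2,5,6) by (auto simp: ctx_def)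
      show ?thesis unfolding I_def using vars m'1 m'2 pair new by (simp add: u_def[symmetric] algebra_simps)
    qed
  qed
  then have loop: "run (For ''i'' ?a ?b pair_step) ?s (nat (h - 1) * 13 + 2) (I (j1 + h))"
    by (rule run_mono) (use base in \<open>auto simp: pair_step_def\<close>)
  have "rarr s ''W'' n = sum_list P" using s n_pos W_n by (simp add: ctx_def)
  then have "run find_pair s (3 + (nat (h - 1) * 13 + 2)) (I (j1 + h))"
    unfolding find_pair_def
    by - (rule run_Seq, rule run_straightI, use loop s base in \<open>simp_all add: ctx_vars\<close>)
  then show ?thesis
  proof (rule run_mono)
    show "3 + (nat (h - 1) * 13 + 2) \<le> nat n * 14 + 5" using n_h h_pos by auto
    show "ctx t \<and> ivar t ''base'' = j1 \<and> best_pair j1 t" if "I (j1 + h) t" for t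
      using that by (auto simp: I_def best_pair_def covers_def)
  qed
qed

end

lemma run_If:
  "(bval b s \<Longrightarrow> run c s K Q) \<Longrightarrow> (\<not> bval b s \<Longrightarrow> run d s K Q) \<Longrightarrow> run (If b c d) s (K + 1) Q"
  unfolding run_def by (cases "bval b s") (fastforce intro: exec.IfTrue exec.IfFalse)+

section \<open>The plan without jumps and the choice of a segment\<close>

definition no_jump :: com where
  "no_jump = Seq (Seq (RAssign ''best'' (RVar ''gmax''))
       (Seq (If (RLe (RDiv (RVar ''total'') (RConst 2)) (RVar ''best''))
              (RAssign ''best'' (RDiv (RVar ''total'') (RConst 2))) Skip)
            (IAssign ''u'' (IConst 0))))
     (Seq (last_below ''u'' (IConst 1) (ISub (IVar ''h'') (IConst 1)) (\<lambda>e. SE (IAdd (IVar ''base'') e)) (RVar ''best''))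
     (Seq (IAssign ''start'' (ILoad ''pos'' (IAdd (IAdd (IVar ''base'') (IVar ''u'')) (IVar ''h''))))
     (Seq (IAssign ''phase'' (IConst 2)) (IAssign ''mode'' (IConst 0)))))"

definition evaluate :: com where
  "evaluate = Seq (RAssign ''e'' (RSub (WE (IAdd (IAdd (IVar ''J'') (IVar ''k'')) (IConst 1))) (WE (IVar ''J''))))
     (Seq (RAssign ''b'' (RSub (WE (IAdd (IAdd (IVar ''J'') (IVar ''h'')) (IVar ''k''))) (WE (IAdd (IVar ''J'') (IVar ''h'')))))
     (Seq (RAssign ''t'' (RVar ''b''))
     (Seq (If (BOr (ILe (IVar ''k'') (IConst 1)) (RLe (RVar ''t'') (RAdd (RDiv (RVar ''b'') (RConst 2)) (RDiv (RVar ''e'') (RConst 4)))))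
            Skip (RAssign ''t'' (RAdd (RDiv (RVar ''b'') (RConst 2)) (RDiv (RVar ''e'') (RConst 4)))))
     (Seq (RAssign ''value'' (RSub (RAdd (RVar ''t'') (RVar ''x'')) (RVar ''e'')))
       (If (RLe (RVar ''value'') (RVar ''best'')) Skip
         (Seq (RAssign ''best'' (RVar ''value'')) (Seq (IAssign ''bestJ'' (IVar ''J''))
         (Seq (IAssign ''bestk'' (IVar ''k'')) (Seq (RAssign ''level'' (RVar ''t'')) (IAssign ''mode'' (IConst 1)))))))))))"

definition segment1 :: com where
  "segment1 = Seq (IAssign ''J'' (IVar ''j3''))
     (Seq (IAssign ''k'' (ISub (IAdd (IVar ''j2'') (ISub (IVar ''h'') (IConst 1))) (IVar ''j3'')))
     (Seq (RAssign ''x'' (SE (IVar ''j2'')))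
       (If (RLe (RVar ''x'') (SE (IVar ''j3''))) Skip (RAssign ''x'' (SE (IVar ''j3''))))))"

definition segment2 :: com where
  "segment2 = Seq (IAssign ''J'' (IVar ''base''))
     (Seq (IAssign ''k'' (ISub (ISub (IVar ''j3'') (IVar ''h'')) (IVar ''base'')))
       (RAssign ''x'' (SE (IVar ''base''))))"

definition segment3 :: com where
  "segment3 = Seq (IAssign ''J'' (IVar ''j2''))
     (Seq (IAssign ''k'' (ISub (IAdd (IVar ''base'') (ISub (IVar ''h'') (IConst 1))) (IVar ''j2'')))
       (RAssign ''x'' (SE (IVar ''base''))))"

definition choose_segment :: com where
  "choose_segment = If (RLe (RDiv (RVar ''total'') (RConst 2)) (RVar ''gmax'')) Skip
     (Seq segment1 (Seq evaluate (Seq segment2 (Seq evaluate (Seq segment3 evaluate)))))"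

context odd_pizza
begin

lemma wins_single:
  assumes "n = 1" and q: "first_phase q = 2" "first_slice q = (2 * \<sigma>) mod n"
  shows "wins q (sum_list P)"
proof (rule wins_no_jump[OF q])
  have "j + h = j + n" for j using n_h assms(1) by simp
  then show "sum_list P \<le> S j" for j unfolding S_def by (simp only: W_shift)
qed

definition same_tables :: "mem \<Rightarrow> mem \<Rightarrow> bool" where
  "same_tables s t \<longleftrightarrow> rarr t = rarr s \<and> iarr t = iarr s \<and>
     (\<forall>x\<in>{''n'', ''h'', ''base'', ''j2'', ''j3'', ''start'', ''phase'', ''switch1'', ''switch2'', ''end1'', ''end2''}. ivar t x = ivar s x) \<and>
     (\<forall>x\<in>{''total'', ''gmax''}. rvar t x = rvar s x)"

lemma same_tables_ctx: "same_tables s t \<Longrightarrow> ctx s \<Longrightarrow> ctx t"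
  by (simp add: same_tables_def ctx_def)

lemma same_tables_trans: "same_tables s t \<Longrightarrow> same_tables t u \<Longrightarrow> same_tables s u"
  by (simp add: same_tables_def)

lemma same_tables_plan_of: "same_tables s t \<Longrightarrow> plan_of t = plan_of s"
  by (simp add: same_tables_def plan_of_def)

lemma pos_at: "ctx s \<Longrightarrow> 0 \<le> j \<Longrightarrow> j \<le> 3 * n \<Longrightarrow> iarr s ''pos'' j = (2 * j) mod n"
  by (simp add: ctx_def)

lemma run_no_jump:
  assumes s: "ctx s" and base: "ivar s ''base'' = j1" "j1 \<in> {0..<n}" "\<And>j. S j1 \<le> S j"
    and pair: "best_pair j1 s"
  shows "run no_jump s (nat n * 4 + 9) (\<lambda>t. ctx t \<and> ivar t ''base'' = j1 \<and> best_pair j1 t \<and> ivar t ''mode'' = 0 \<and>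
    ivar t ''start'' \<in> {0..<n} \<and>
    rvar t ''best'' = min (rvar t ''gmax'') (sum_list P / 2) \<and> wins (plan_of t) (rvar t ''best'') \<and>
    (n = 1 \<longrightarrow> wins (plan_of t) (sum_list P)))"
proof -
  define g where "g = min (rvar s ''gmax'') (sum_list P / 2)"
  let ?s = "s\<lparr>rvar := (rvar s)(''best'' := g), ivar := (ivar s)(''u'' := 0)\<rparr>"
  let ?f = "\<lambda>e. SE (IAdd (IVar ''base'') e)"
  have tot: "rvar s ''total'' = sum_list P" using pair by (simp add: best_pair_def)
  have r1: "run (Seq (RAssign ''best'' (RVar ''gmax''))
       (Seq (If (RLe (RDiv (RVar ''total'') (RConst 2)) (RVar ''best''))
              (RAssign ''best'' (RDiv (RVar ''total'') (RConst 2))) Skip)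
            (IAssign ''u'' (IConst 0)))) s 4 (\<lambda>t. t = ?s)"
    by (rule run_straightI) (use tot in \<open>simp_all add: g_def min_def\<close>)
  have loop: "run (last_below ''u'' (IConst 1) (ISub (IVar ''h'') (IConst 1)) ?f (RVar ''best'')) ?s (nat n * 4 + 2)
    (\<lambda>t. \<exists>m z. (m = 0 \<or> m \<in> {1..h - 1} \<and> S (j1 + m) < g) \<and> (\<forall>j\<in>{1..h - 1}. m < j \<longrightarrow> g \<le> S (j1 + j)) \<and>
      t = ?s\<lparr>ivar := (ivar ?s)(''u'' := m, ''i'' := z)\<rparr>)"
  proof (rule run_mono)
    show "run (last_below ''u'' (IConst 1) (ISub (IVar ''h'') (IConst 1)) ?f (RVar ''best'')) ?s
      (nat (ival (ISub (IVar ''h'') (IConst 1)) ?s + 1 - ival (IConst 1) ?s) * 4 + 2) (\<lambda>t. \<exists>m z.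
      (m = ivar ?s ''u'' \<or> m \<in> {ival (IConst 1) ?s..ival (ISub (IVar ''h'') (IConst 1)) ?s} \<and> S (j1 + m) < g) \<and>
      (\<forall>j\<in>{ival (IConst 1) ?s..ival (ISub (IVar ''h'') (IConst 1)) ?s}. m < j \<longrightarrow> g \<le> S (j1 + j)) \<and>
      t = ?s\<lparr>ivar := (ivar ?s)(''u'' := m, ''i'' := z)\<rparr>)"
    proof (rule run_last_below)
      show "rval (?f (IVar ''i'')) (?s\<lparr>ivar := (ivar ?s)(''u'' := y, ''i'' := z)\<rparr>) = S (j1 + z)"
        if "z \<in> {ival (IConst 1) ?s..ival (ISub (IVar ''h'') (IConst 1)) ?s}" for y z
        using S_at[OF s, of "j1 + z"] that s base n_h h_pos by (simp add: ctx_vars)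
    qed (use s h_pos in \<open>simp_all add: ctx_vars\<close>)
  qed (use s h_pos n_h in \<open>auto simp: ctx_vars\<close>)
  have last: "run (Seq (IAssign ''start'' (ILoad ''pos'' (IAdd (IAdd (IVar ''base'') (IVar ''u'')) (IVar ''h''))))
     (Seq (IAssign ''phase'' (IConst 2)) (IAssign ''mode'' (IConst 0)))) t 3
     (\<lambda>t. ctx t \<and> ivar t ''base'' = j1 \<and> best_pair j1 t \<and> ivar t ''mode'' = 0 \<and>
    ivar t ''start'' \<in> {0..<n} \<and>
    rvar t ''best'' = min (rvar t ''gmax'') (sum_list P / 2) \<and> wins (plan_of t) (rvar t ''best'') \<and>
    (n = 1 \<longrightarrow> wins (plan_of t) (sum_list P)))"
    if t: "\<exists>m z. (m = 0 \<or> m \<in> {1..h - 1} \<and> S (j1 + m) < g) \<and> (\<forall>j\<in>{1..h - 1}. m < j \<longrightarrow> g \<le> S (j1 + j)) \<and>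
      t = ?s\<lparr>ivar := (ivar ?s)(''u'' := m, ''i'' := z)\<rparr>" for t
  proof -
    obtain m z where m: "m = 0 \<or> m \<in> {1..h - 1} \<and> S (j1 + m) < g" "\<forall>j\<in>{1..h - 1}. m < j \<longrightarrow> g \<le> S (j1 + j)"
      and t: "t = ?s\<lparr>ivar := (ivar ?s)(''u'' := m, ''i'' := z)\<rparr>" using t by blast
    have start: "iarr s ''pos'' (j1 + m + h) = (2 * (j1 + m + h)) mod n"
      by (rule pos_at[OF s]) (use m(1) base h_pos n_h in auto)
    have w: "wins q g" if "first_phase q = 2" "first_slice q = (2 * (j1 + m + h)) mod n" for q
    proof (rule wins_no_jump_from_last_small[OF base(3) _ _ _ _ _ _ that])
      show "g \<le> max (S j2) (S j3)" if "covers j1 j2 j3" for j2 j3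
      proof -
        have "lex_le (rvar s ''gmax'') (rvar s ''gsum'') j2 j3" using pair that unfolding best_pair_def by blast
        then show ?thesis unfolding g_def lex_le_def by (auto simp: min_le_iff_disj)
      qed
      show "g \<le> S (j1 + j)" if "j \<in> {m + 1..<h}" for j using m that by auto
    qed (use m h_pos in \<open>auto simp: g_def\<close>)
    show ?thesis
      by (rule run_straightI)
        (use s base pair start w wins_single[of _ "j1 + m + h"] n_pos in
          \<open>simp_all add: t ctx_vars plan_of_def best_pair_def g_def\<close>)
  qed
  have "run no_jump s (4 + (nat n * 4 + 2 + 3)) (\<lambda>t. ctx t \<and> ivar t ''base'' = j1 \<and> best_pair j1 t \<and> ivar t ''mode'' = 0 \<and>
    ivar t ''start'' \<in> {0..<n} \<and>
    rvar t ''best'' = min (rvar t ''gmax'') (sum_list P / 2) \<and> wins (plan_of t) (rvar t ''best'') \<and>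
    (n = 1 \<longrightarrow> wins (plan_of t) (sum_list P)))"
    unfolding no_jump_def
  proof (rule run_Seq, rule run_mono[OF r1 order_refl], simp only:, rule run_Seq, rule run_mono[OF loop order_refl])
  qed (rule last)
  then show ?thesis by (rule run_mono) auto
qed

lemma result_evaluate:
  assumes t: "ctx t" "ivar t ''J'' = J" "ivar t ''k'' = k" "0 \<le> J" "0 \<le> k" "k < h" "J + h + k \<le> 3 * n"
  defines "u \<equiv> result evaluate t" and "val \<equiv> seg_value J k (rvar t ''x'')"
  shows "same_tables t u"
    and "rvar u ''best'' = max (rvar t ''best'') val"
    and "rvar t ''best'' < val \<Longrightarrow> ivar u ''bestJ'' = J \<and> ivar u ''bestk'' = k \<and> ivar u ''mode'' = 1 \<and> rvar u ''level'' = level J k"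
    and "\<not> rvar t ''best'' < val \<Longrightarrow> ivar u ''bestJ'' = ivar t ''bestJ'' \<and> ivar u ''bestk'' = ivar t ''bestk'' \<and>
      ivar u ''mode'' = ivar t ''mode'' \<and> rvar u ''level'' = rvar t ''level''"
proof -
  define b e where "b = inner_sum J k" and "e = outer_sum J k"
  have w: "rarr t ''W'' (J + h + k) - rarr t ''W'' (J + h) = b" "rarr t ''W'' (J + k + 1) - rarr t ''W'' J = e"
    "ivar t ''h'' = h"
    using t h_pos by (auto simp: ctx_def b_def e_def inner_sum_def outer_sum_def)
  define t1 where "t1 = t\<lparr>rvar := (rvar t)(''e'' := e, ''b'' := b, ''t'' := level J k, ''value'' := val)\<rparr>"
  have lev: "level J k = (if k \<le> 1 \<or> b \<le> b / 2 + e / 4 then b else b / 2 + e / 4)"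
    by (simp add: level_def b_def e_def min_def)
  have val: "val = level J k + rvar t ''x'' - e" by (simp add: val_def seg_value_def e_def)
  have "u = (if rvar t ''best'' < val then t1\<lparr>ivar := (ivar t)(''bestJ'' := J, ''bestk'' := k, ''mode'' := 1),
      rvar := (rvar t1)(''best'' := val, ''level'' := level J k)\<rparr> else t1)"
  proof (cases "k \<le> 1 \<or> b \<le> b / 2 + e / 4")
    case True
    then show ?thesis using w t(2,3) lev unfolding u_def evaluate_def t1_def val by (auto simp: fun_upd_twist)
  next
    case False
    then show ?thesis using w t(2,3) lev unfolding u_def evaluate_def t1_def val by (auto simp: fun_upd_twist)
  qed
  then show "same_tables t u"
    "rvar u ''best'' = max (rvar t ''best'') val"
    "rvar t ''best'' < val \<Longrightarrow> ivar u ''bestJ'' = J \<and> ivar u ''bestk'' = k \<and> ivar u ''mode'' = 1 \<and> rvar u ''level'' = level J k"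
    "\<not> rvar t ''best'' < val \<Longrightarrow> ivar u ''bestJ'' = ivar t ''bestJ'' \<and> ivar u ''bestk'' = ivar t ''bestk'' \<and>
      ivar u ''mode'' = ivar t ''mode'' \<and> rvar u ''level'' = rvar t ''level''"
    by (auto simp: same_tables_def t1_def)
qed

text \<open>Mode 0 means that the plan without jumps already stored is the best so far. Mode 1
  records only a segment; its plan is computed once, after all three segments have been
  compared.\<close>

definition chosen :: "mem \<Rightarrow> bool" where
  "chosen s \<longleftrightarrow> ivar s ''mode'' = 0 \<and> wins (plan_of s) (rvar s ''best'') \<or>
     ivar s ''mode'' = 1 \<and> (\<exists>J k x. ivar s ''bestJ'' = J \<and> ivar s ''bestk'' = k \<and> segment P h J k x \<and>
       rvar s ''level'' = level J k \<and> rvar s ''best'' = seg_value J k x \<and> 0 \<le> J \<and> J + h + k \<le> 3 * n)"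

lemma chosen_evaluate:
  assumes "chosen t" "ctx t" "ivar t ''J'' = J" "ivar t ''k'' = k" "segment P h J k (rvar t ''x'')" "0 \<le> J" "J + h + k \<le> 3 * n"
  shows "chosen (result evaluate t)"
proof -
  have k: "0 \<le> k" "k < h" using segment.k[OF assms(5)] by auto
  note r = result_evaluate[OF assms(2,3,4,6) k assms(7)]
  show ?thesis
  proof (cases "rvar t ''best'' < seg_value J k (rvar t ''x'')")
    case True
    then show ?thesis using r(2) r(3)[OF True] assms(5-7) unfolding chosen_def by auto
  next
    case False
    then show ?thesis using r(2) r(4)[OF False] same_tables_plan_of[OF r(1)] assms(1) unfolding chosen_def by auto
  qed
qed

end

section \<open>Computing the plan of the chosen segment\<close>

abbreviation "LE e \<equiv> RAdd (RSub (WE (IAdd (IAdd (IVar ''J'') (IVar ''h'')) e)) (WE (IAdd (IVar ''J'') (IVar ''h''))))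
  (RSub (WE (IAdd (IAdd (IVar ''J'') (IVar ''k'')) (IConst 1))) (WE (IAdd (IVar ''J'') e)))"
abbreviation "RE e \<equiv> RAdd (RSub (WE (IAdd (IAdd (IVar ''J'') (IVar ''h'')) (IVar ''k'')))
    (WE (ISub (IAdd (IAdd (IVar ''J'') (IVar ''h'')) e) (IConst 1))))
  (RSub (WE (IAdd (IVar ''J'') e)) (WE (IVar ''J'')))"

definition load_segment :: com where
  "load_segment = Seq (IAssign ''J'' (IVar ''bestJ'')) (Seq (IAssign ''k'' (IVar ''bestk''))
     (Seq (IAssign ''end1'' (ILoad ''pos'' (IVar ''J'')))
     (Seq (IAssign ''end2'' (ILoad ''pos'' (IAdd (IVar ''J'') (IVar ''k'')))) (IAssign ''v'' (IConst 0)))))"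

definition outer_start :: com where
  "outer_start = Seq (argmin ''N'' (IVar ''M'') (IVar ''k'') (\<lambda>e. LE e))
     (Seq (Seq (RAssign ''theta'' (RVar ''level''))
       (Seq (If (RLe (RE (IVar ''M'')) (LE (IVar ''N''))) Skip
               (RAssign ''theta'' (RAdd (RVar ''level'') (RSub (RE (IVar ''M'')) (LE (IVar ''N''))))))
          (IAssign ''w'' (IVar ''M''))))
     (Seq (last_below ''w'' (IVar ''M'') (IVar ''N'') (\<lambda>e. RE e) (RVar ''theta''))
     (Seq (IAssign ''start'' (ILoad ''pos'' (IAdd (IVar ''J'') (IVar ''w''))))
     (Seq (IAssign ''phase'' (IConst 0))
     (Seq (IAssign ''switch1'' (ILoad ''pos'' (ISub (IAdd (IAdd (IVar ''J'') (IVar ''h'')) (IVar ''M'')) (IConst 1))))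
       (IAssign ''switch2'' (ILoad ''pos'' (ISub (IAdd (IAdd (IVar ''J'') (IVar ''h'')) (IVar ''N'')) (IConst 1)))))))))"

definition inner_start :: com where
  "inner_start = Seq (IAssign ''start'' (ILoad ''pos'' (ISub (IAdd (IAdd (IVar ''J'') (IVar ''h'')) (IVar ''v'')) (IConst 1))))
     (IAssign ''phase'' (IConst 1))"

text \<open>The variable \<open>v\<close> first becomes the last index whose left share is too
  small, or 0 if there is none, and is then increased by one to the first index from which all left
  shares suffice.\<close>

definition choose_plan :: com where
  "choose_plan = Seq load_segment
     (Seq (last_below ''v'' (IConst 1) (IVar ''k'') (\<lambda>e. LE e) (RVar ''level''))
     (Seq (IAssign ''v'' (IAdd (IVar ''v'') (IConst 1)))
     (Seq (argmin ''M'' (IConst 1) (IVar ''v'') (\<lambda>e. RE e))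
       (If (RLe (RVar ''level'') (RE (IVar ''M''))) inner_start outer_start))))"

context segment
begin

definition seg_ctx :: "mem \<Rightarrow> bool" where
  "seg_ctx s \<longleftrightarrow> ctx s \<and> ivar s ''J'' = J \<and> ivar s ''k'' = k \<and> rvar s ''level'' = t \<and>
     ivar s ''end1'' = (2 * J) mod n \<and> ivar s ''end2'' = (2 * (J + k)) mod n"

lemma seg_ctx_ivar [simp]: "a \<noteq> ''n'' \<Longrightarrow> a \<noteq> ''h'' \<Longrightarrow> a \<noteq> ''J'' \<Longrightarrow> a \<noteq> ''k'' \<Longrightarrow>
    a \<noteq> ''end1'' \<Longrightarrow> a \<noteq> ''end2'' \<Longrightarrow>
    seg_ctx (s\<lparr>ivar := f(a := y)\<rparr>) \<longleftrightarrow> seg_ctx (s\<lparr>ivar := f\<rparr>)"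
  by (simp add: seg_ctx_def)

lemma seg_ctx_id [simp]: "seg_ctx (s\<lparr>ivar := ivar s\<rparr>) \<longleftrightarrow> seg_ctx s"
  by (simp add: seg_ctx_def)

lemma seg_ctx_theta [simp]: "seg_ctx (s\<lparr>rvar := (rvar s)(''theta'' := y), ivar := f\<rparr>) \<longleftrightarrow> seg_ctx (s\<lparr>ivar := f\<rparr>)"
  "seg_ctx (s\<lparr>rvar := (rvar s)(''theta'' := y)\<rparr>) \<longleftrightarrow> seg_ctx s"
  by (simp_all add: seg_ctx_def ctx_def)

context
  assumes J: "0 \<le> J" "J + h + k \<le> 3 * n"
begin

lemma rval_LE:
  assumes "seg_ctx s" "1 \<le> ival e s" "ival e s \<le> k"
  shows "rval (LE e) s = L (ival e s)"
  using assms J k h_pos by (simp add: seg_ctx_def ctx_def L_def)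

lemma rval_RE:
  assumes "seg_ctx s" "1 \<le> ival e s" "ival e s \<le> k"
  shows "rval (RE e) s = R (ival e s)"
  using assms J k h_pos by (simp add: seg_ctx_def ctx_def R_def)

abbreviation good_plan :: "mem \<Rightarrow> bool" where
  "good_plan u \<equiv> ivar u ''n'' = n \<and> ivar u ''start'' \<in> {0..<n} \<and> wins (plan_of u) target"

context
  fixes v M :: int
  assumes t: "t \<le> inner" "k = 1 \<or> 4 * t \<le> 2 * inner + outer"
    and v: "v \<in> {1..k}" "\<And>j. j \<in> {v..k} \<Longrightarrow> t \<le> L j" "v = 1 \<or> L (v - 1) < t"
    and M: "M \<in> {1..v}" "\<And>i. i \<in> {1..v} \<Longrightarrow> R M \<le> R i"
begin

lemma run_inner_start:
  assumes s: "seg_ctx s" "ivar s ''v'' = v" and RM: "t \<le> R M"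
  shows "run inner_start s 2 good_plan"
proof (rule run_straightI)
  have "iarr s ''pos'' (J + h + v - 1) = (2 * (J + h - 1 + v)) mod n"
    using pos_at[of s "J + h + v - 1"] s(1) J k h_pos v(1) by (simp add: seg_ctx_def algebra_simps)
  then show "good_plan (result inner_start s)"
    using s n_pos wins_inner_start[OF t v M RM, of "plan_of (result inner_start s)"]
    by (simp add: inner_start_def plan_of_def seg_ctx_def ctx_vars)
qed (simp_all add: inner_start_def)

lemma run_outer_start:
  assumes s: "seg_ctx s" "ivar s ''M'' = M" and RM: "R M < t"
  shows "run outer_start s (nat n * 8 + 14) good_plan"
proof -
  have kn: "k < n" using k n_h by simp
  have M': "1 \<le> M" "M \<le> k" using M(1) v(1) by auto
  define A where "A N u \<longleftrightarrow> seg_ctx u \<and> ivar u ''M'' = M \<and> ivar u ''N'' = N \<and> N \<in> {M..k} \<and> (\<forall>j\<in>{M..k}. L N \<le> L j)"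
    for N :: int and u :: mem
  define \<theta> where "\<theta> N = max t (t + R M - L N)" for N
  have 1: "run (argmin ''N'' (IVar ''M'') (IVar ''k'') (\<lambda>e. LE e)) s (nat n * 4 + 3) (\<lambda>u. \<exists>N. A N u)"
  proof (rule run_mono)
    show "run (argmin ''N'' (IVar ''M'') (IVar ''k'') (\<lambda>e. LE e)) s
      (nat (ival (IVar ''k'') s + 1 - ival (IVar ''M'') s) * 4 + 3)
      (\<lambda>u. \<exists>N z. N \<in> {ival (IVar ''M'') s..ival (IVar ''k'') s} \<and>
        (\<forall>j\<in>{ival (IVar ''M'') s..ival (IVar ''k'') s}. L N \<le> L j) \<and> u = s\<lparr>ivar := (ivar s)(''N'' := N, ''i'' := z)\<rparr>)"
    proof (rule run_argmin)
      fix y z x assume *: "y \<in> {ival (IVar ''M'') s..ival (IVar ''k'') s}" "z \<in> {ival (IVar ''M'') s..ival (IVar ''k'') s}"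
        "x \<in> {''N'', ''i''}"
      show "rval (LE (IVar x)) (s\<lparr>ivar := (ivar s)(''N'' := y, ''i'' := z)\<rparr>) = L (if x = ''N'' then y else z)"
        using * s M' by (subst rval_LE) (auto simp: seg_ctx_def)
    qed (use s M' in \<open>auto simp: seg_ctx_def\<close>)
  qed (use s M' kn in \<open>auto simp: A_def seg_ctx_def\<close>)
  have 2: "run (Seq (RAssign ''theta'' (RVar ''level''))
       (Seq (If (RLe (RE (IVar ''M'')) (LE (IVar ''N''))) Skip
               (RAssign ''theta'' (RAdd (RVar ''level'') (RSub (RE (IVar ''M'')) (LE (IVar ''N''))))))
          (IAssign ''w'' (IVar ''M'')))) u 4 (\<lambda>u. A N u \<and> rvar u ''theta'' = \<theta> N \<and> ivar u ''w'' = M)"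
    if u: "A N u" for N u
  proof (rule run_straightI)
    let ?u = "u\<lparr>rvar := (rvar u)(''theta'' := t)\<rparr>"
    have lev: "rvar u ''level'' = t" and N: "M \<le> N" "N \<le> k" using u by (auto simp: A_def seg_ctx_def)
    have RM: "rval (RE (IVar ''M'')) ?u = R M" using u M' by (subst rval_RE) (auto simp: A_def)
    have LN: "rval (LE (IVar ''N'')) ?u = L N" using u M' N by (subst rval_LE) (auto simp: A_def)
    have "rval (RAdd e (RSub e1 e2)) ?u = rval e ?u + (rval e1 ?u - rval e2 ?u)" for e e1 e2 by simp
    from this[of "RVar ''level''" "RE (IVar ''M'')" "LE (IVar ''N'')"]
    have th: "rval (RAdd (RVar ''level'') (RSub (RE (IVar ''M'')) (LE (IVar ''N'')))) ?u = t + (R M - L N)"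
      unfolding RM LN using lev by simp
    show "A N (result (Seq (RAssign ''theta'' (RVar ''level''))
       (Seq (If (RLe (RE (IVar ''M'')) (LE (IVar ''N''))) Skip
               (RAssign ''theta'' (RAdd (RVar ''level'') (RSub (RE (IVar ''M'')) (LE (IVar ''N''))))))
          (IAssign ''w'' (IVar ''M'')))) u) \<and> rvar (result (Seq (RAssign ''theta'' (RVar ''level''))
       (Seq (If (RLe (RE (IVar ''M'')) (LE (IVar ''N''))) Skip
               (RAssign ''theta'' (RAdd (RVar ''level'') (RSub (RE (IVar ''M'')) (LE (IVar ''N''))))))
          (IAssign ''w'' (IVar ''M'')))) u) ''theta'' = \<theta> N \<and> ivar (result (Seq (RAssign ''theta'' (RVar ''level''))
       (Seq (If (RLe (RE (IVar ''M'')) (LE (IVar ''N''))) Skip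
               (RAssign ''theta'' (RAdd (RVar ''level'') (RSub (RE (IVar ''M'')) (LE (IVar ''N''))))))
          (IAssign ''w'' (IVar ''M'')))) u) ''w'' = M"
      using u lev RM LN th by (cases "R M \<le> L N") (simp_all add: A_def \<theta>_def max_def del: rval.simps(4,5))
  qed simp_all
  have 3: "run (last_below ''w'' (IVar ''M'') (IVar ''N'') (\<lambda>e. RE e) (RVar ''theta'')) u (nat n * 4 + 2)
      (\<lambda>u. A N u \<and> (\<exists>w. ivar u ''w'' = w \<and> w \<in> {M..N} \<and> R w < \<theta> N \<and> (\<forall>j\<in>{w + 1..N}. \<theta> N \<le> R j)))"
    if u: "A N u \<and> rvar u ''theta'' = \<theta> N \<and> ivar u ''w'' = M" for N u
  proof (rule run_mono)
    have N: "M \<le> N" "N \<le> k" using u by (auto simp: A_def)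
    show "run (last_below ''w'' (IVar ''M'') (IVar ''N'') (\<lambda>e. RE e) (RVar ''theta'')) u
      (nat (ival (IVar ''N'') u + 1 - ival (IVar ''M'') u) * 4 + 2)
      (\<lambda>v. \<exists>w z. (w = ivar u ''w'' \<or> w \<in> {ival (IVar ''M'') u..ival (IVar ''N'') u} \<and> R w < \<theta> N) \<and>
        (\<forall>j\<in>{ival (IVar ''M'') u..ival (IVar ''N'') u}. w < j \<longrightarrow> \<theta> N \<le> R j) \<and> v = u\<lparr>ivar := (ivar u)(''w'' := w, ''i'' := z)\<rparr>)"
    proof (rule run_last_below)
      show "rval (RE (IVar ''i'')) (u\<lparr>ivar := (ivar u)(''w'' := y, ''i'' := z)\<rparr>) = R z"
        if "z \<in> {ival (IVar ''M'') u..ival (IVar ''N'') u}" for y z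
        using that u M' N by (subst rval_RE) (auto simp: A_def)
    qed (use u N in \<open>auto simp: A_def\<close>)
    show "nat (ival (IVar ''N'') u + 1 - ival (IVar ''M'') u) * 4 + 2 \<le> nat n * 4 + 2"
      using u N M' kn by (auto simp: A_def)
    \<comment> \<open>This makes \<open>M\<close>, the initial value of \<open>w\<close>, a
      legitimate result of the search.\<close>
    have "R M < \<theta> N" using RM by (simp add: \<theta>_def)
    then show "A N q \<and> (\<exists>w. ivar q ''w'' = w \<and> w \<in> {M..N} \<and> R w < \<theta> N \<and> (\<forall>j\<in>{w + 1..N}. \<theta> N \<le> R j))"
      if "\<exists>w z. (w = ivar u ''w'' \<or> w \<in> {ival (IVar ''M'') u..ival (IVar ''N'') u} \<and> R w < \<theta> N) \<and>
        (\<forall>j\<in>{ival (IVar ''M'') u..ival (IVar ''N'') u}. w < j \<longrightarrow> \<theta> N \<le> R j) \<and> q = u\<lparr>ivar := (ivar u)(''w'' := w, ''i'' := z)\<rparr>" for q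
      using that u N by (auto simp: A_def)
  qed
  have 4: "run (Seq (IAssign ''start'' (ILoad ''pos'' (IAdd (IVar ''J'') (IVar ''w''))))
     (Seq (IAssign ''phase'' (IConst 0))
     (Seq (IAssign ''switch1'' (ILoad ''pos'' (ISub (IAdd (IAdd (IVar ''J'') (IVar ''h'')) (IVar ''M'')) (IConst 1))))
       (IAssign ''switch2'' (ILoad ''pos'' (ISub (IAdd (IAdd (IVar ''J'') (IVar ''h'')) (IVar ''N'')) (IConst 1))))))) u 4 good_plan"
    if u: "A N u \<and> (\<exists>w. ivar u ''w'' = w \<and> w \<in> {M..N} \<and> R w < \<theta> N \<and> (\<forall>j\<in>{w + 1..N}. \<theta> N \<le> R j))" for N u
  proof (rule run_straightI)
    obtain w where w: "ivar u ''w'' = w" "w \<in> {M..N}" "R w < \<theta> N" "\<forall>j\<in>{w + 1..N}. \<theta> N \<le> R j" using u by blast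
    have N: "N \<in> {M..k}" "\<And>j. j \<in> {M..k} \<Longrightarrow> L N \<le> L j" using u by (auto simp: A_def)
    have c: "ctx u" using u by (simp add: A_def seg_ctx_def)
    have p: "iarr u ''pos'' (J + w) = (2 * (J + w)) mod n"
      "iarr u ''pos'' (J + h + M - 1) = (2 * (J + h + M - 1)) mod n"
      "iarr u ''pos'' (J + h + N - 1) = (2 * (J + h + N - 1)) mod n"
      by (rule pos_at[OF c]; use w(2) N(1) M' J k h_pos in auto)+
    have p': "J + h + M - 1 = J + h - 1 + M" "J + h + N - 1 = J + h - 1 + N" by simp_all
    note win = wins_outer_start[OF t v M RM N w(2) w(3)[unfolded \<theta>_def] w(4)[unfolded \<theta>_def, rule_format]]
    show "good_plan (result (Seq (IAssign ''start'' (ILoad ''pos'' (IAdd (IVar ''J'') (IVar ''w''))))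
     (Seq (IAssign ''phase'' (IConst 0))
     (Seq (IAssign ''switch1'' (ILoad ''pos'' (ISub (IAdd (IAdd (IVar ''J'') (IVar ''h'')) (IVar ''M'')) (IConst 1))))
       (IAssign ''switch2'' (ILoad ''pos'' (ISub (IAdd (IAdd (IVar ''J'') (IVar ''h'')) (IVar ''N'')) (IConst 1))))))) u)"
      (is "good_plan ?u")
    proof (intro conjI)
      show "wins (plan_of ?u) target"
        by (rule win) (use u w(1) p in \<open>simp_all add: A_def seg_ctx_def ctx_vars plan_of_def p'\<close>)
    qed (use u w(1) p n_pos in \<open>simp_all add: A_def seg_ctx_def ctx_vars\<close>)
  qed simp_all
  have "run outer_start s (nat n * 4 + 3 + (4 + (nat n * 4 + 2 + 4))) good_plan"
    unfolding outer_start_def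
  proof (rule run_Seq, rule run_mono[OF 1 order_refl], elim exE)
    fix N u assume "A N u"
    show "run (Seq (Seq (RAssign ''theta'' (RVar ''level''))
       (Seq (If (RLe (RE (IVar ''M'')) (LE (IVar ''N''))) Skip
               (RAssign ''theta'' (RAdd (RVar ''level'') (RSub (RE (IVar ''M'')) (LE (IVar ''N''))))))
          (IAssign ''w'' (IVar ''M''))))
     (Seq (last_below ''w'' (IVar ''M'') (IVar ''N'') (\<lambda>e. RE e) (RVar ''theta''))
     (Seq (IAssign ''start'' (ILoad ''pos'' (IAdd (IVar ''J'') (IVar ''w''))))
     (Seq (IAssign ''phase'' (IConst 0))
     (Seq (IAssign ''switch1'' (ILoad ''pos'' (ISub (IAdd (IAdd (IVar ''J'') (IVar ''h'')) (IVar ''M'')) (IConst 1))))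
       (IAssign ''switch2'' (ILoad ''pos'' (ISub (IAdd (IAdd (IVar ''J'') (IVar ''h'')) (IVar ''N'')) (IConst 1)))))))))
      u (4 + (nat n * 4 + 2 + 4)) good_plan"
      by (rule run_Seq, rule run_mono[OF 2[OF \<open>A N u\<close>] order_refl], rule run_Seq, rule run_mono[OF 3[of N] order_refl], assumption)
        (rule 4)
  qed
  then show ?thesis by (rule run_mono) auto
qed

end

lemma run_choose_plan:
  assumes s: "ctx s" "ivar s ''bestJ'' = J" "ivar s ''bestk'' = k" "rvar s ''level'' = t"
    and t: "t \<le> inner" "k = 1 \<or> 4 * t \<le> 2 * inner + outer"
  shows "run choose_plan s (nat n * 16 + 26) good_plan"
proof -
  have kn: "k < n" using k n_h by simp
  have 1: "run load_segment s 5 (\<lambda>u. seg_ctx u \<and> ivar u ''v'' = 0)"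
    by (rule run_straightI)
      (use s J k h_pos pos_at[OF s(1), of J] pos_at[OF s(1), of "J + k"] in
        \<open>simp_all add: load_segment_def seg_ctx_def ctx_def\<close>)
  define A where "A v u \<longleftrightarrow> seg_ctx u \<and> ivar u ''v'' = v - 1 \<and> v \<in> {1..k} \<and> (\<forall>j\<in>{v..k}. t \<le> L j) \<and> (v = 1 \<or> L (v - 1) < t)"
    for v :: int and u :: mem
  \<comment> \<open>The last left share contains all inner slices, so the search stops before
    \<open>k\<close> and \<open>v <= k\<close>.\<close>
  have Lk: "t \<le> L k"
    using W_mono[of "J + k" "J + k + 1"] t(1) by (simp add: L_def)
  have 2: "run (last_below ''v'' (IConst 1) (IVar ''k'') (\<lambda>e. LE e) (RVar ''level'')) u (nat n * 4 + 2) (\<lambda>u. \<exists>v. A v u)"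
    if u: "seg_ctx u \<and> ivar u ''v'' = 0" for u
  proof (rule run_mono)
    show "run (last_below ''v'' (IConst 1) (IVar ''k'') (\<lambda>e. LE e) (RVar ''level'')) u
      (nat (ival (IVar ''k'') u + 1 - ival (IConst 1) u) * 4 + 2)
      (\<lambda>q. \<exists>w z. (w = ivar u ''v'' \<or> w \<in> {ival (IConst 1) u..ival (IVar ''k'') u} \<and> L w < t) \<and>
        (\<forall>j\<in>{ival (IConst 1) u..ival (IVar ''k'') u}. w < j \<longrightarrow> t \<le> L j) \<and> q = u\<lparr>ivar := (ivar u)(''v'' := w, ''i'' := z)\<rparr>)"
    proof (rule run_last_below)
      show "rval (LE (IVar ''i'')) (u\<lparr>ivar := (ivar u)(''v'' := y, ''i'' := z)\<rparr>) = L z"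
        if "z \<in> {ival (IConst 1) u..ival (IVar ''k'') u}" for y z
        using that u by (subst rval_LE) (auto simp: seg_ctx_def)
    qed (use u k in \<open>auto simp: seg_ctx_def\<close>)
    show "nat (ival (IVar ''k'') u + 1 - ival (IConst 1) u) * 4 + 2 \<le> nat n * 4 + 2"
      using u kn by (auto simp: seg_ctx_def)
    fix q assume "\<exists>w z. (w = ivar u ''v'' \<or> w \<in> {ival (IConst 1) u..ival (IVar ''k'') u} \<and> L w < t) \<and>
        (\<forall>j\<in>{ival (IConst 1) u..ival (IVar ''k'') u}. w < j \<longrightarrow> t \<le> L j) \<and> q = u\<lparr>ivar := (ivar u)(''v'' := w, ''i'' := z)\<rparr>"
    then obtain w z where w: "w = 0 \<or> w \<in> {1..k} \<and> L w < t" "\<forall>j\<in>{1..k}. w < j \<longrightarrow> t \<le> L j"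
      "q = u\<lparr>ivar := (ivar u)(''v'' := w, ''i'' := z)\<rparr>" using u by (auto simp: seg_ctx_def)
    have "w \<noteq> k" using w(1) Lk k by auto
    then show "\<exists>v. A v q" using w u k by (intro exI[of _ "w + 1"]) (auto simp: A_def)
  qed
  define B where "B v u \<longleftrightarrow> A v (u\<lparr>ivar := (ivar u)(''v'' := v - 1)\<rparr>) \<and> seg_ctx u \<and> ivar u ''v'' = v" for v :: int and u :: mem
  have 3: "run (IAssign ''v'' (IAdd (IVar ''v'') (IConst 1))) u 1 (B v)" if "A v u" for v u
    by (rule run_straightI) (use that in \<open>simp_all add: A_def B_def\<close>)
  have 4: "run (argmin ''M'' (IConst 1) (IVar ''v'') (\<lambda>e. RE e)) u (nat n * 4 + 3)
      (\<lambda>q. B v q \<and> (\<exists>M. ivar q ''M'' = M \<and> M \<in> {1..v} \<and> (\<forall>i\<in>{1..v}. R M \<le> R i)))" if u: "B v u" for v u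
  proof (rule run_mono)
    have v: "v \<in> {1..k}" "ivar u ''v'' = v" "seg_ctx u" using u by (auto simp: A_def B_def)
    show "run (argmin ''M'' (IConst 1) (IVar ''v'') (\<lambda>e. RE e)) u
      (nat (ival (IVar ''v'') u + 1 - ival (IConst 1) u) * 4 + 3)
      (\<lambda>q. \<exists>M z. M \<in> {ival (IConst 1) u..ival (IVar ''v'') u} \<and>
        (\<forall>j\<in>{ival (IConst 1) u..ival (IVar ''v'') u}. R M \<le> R j) \<and> q = u\<lparr>ivar := (ivar u)(''M'' := M, ''i'' := z)\<rparr>)"
    proof (rule run_argmin)
      fix y z x assume *: "y \<in> {ival (IConst 1) u..ival (IVar ''v'') u}" "z \<in> {ival (IConst 1) u..ival (IVar ''v'') u}"
        "x \<in> {''M'', ''i''}"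
      show "rval (RE (IVar x)) (u\<lparr>ivar := (ivar u)(''M'' := y, ''i'' := z)\<rparr>) = R (if x = ''M'' then y else z)"
        using * v by (subst rval_RE) auto
    qed (use v in auto)
    show "nat (ival (IVar ''v'') u + 1 - ival (IConst 1) u) * 4 + 3 \<le> nat n * 4 + 3" using v kn by auto
    show "B v q \<and> (\<exists>M. ivar q ''M'' = M \<and> M \<in> {1..v} \<and> (\<forall>i\<in>{1..v}. R M \<le> R i))"
      if "\<exists>M z. M \<in> {ival (IConst 1) u..ival (IVar ''v'') u} \<and>
        (\<forall>j\<in>{ival (IConst 1) u..ival (IVar ''v'') u}. R M \<le> R j) \<and> q = u\<lparr>ivar := (ivar u)(''M'' := M, ''i'' := z)\<rparr>" for q
      using that u v by (auto simp: A_def B_def)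
  qed
  have 5: "run (If (RLe (RVar ''level'') (RE (IVar ''M''))) inner_start outer_start) u (nat n * 8 + 14 + 1) good_plan"
    if u: "B v u \<and> (\<exists>M. ivar u ''M'' = M \<and> M \<in> {1..v} \<and> (\<forall>i\<in>{1..v}. R M \<le> R i))" for v u
  proof -
    obtain M where M: "ivar u ''M'' = M" "M \<in> {1..v}" "\<forall>i\<in>{1..v}. R M \<le> R i" using u by blast
    have v: "v \<in> {1..k}" "\<And>j. j \<in> {v..k} \<Longrightarrow> t \<le> L j" "v = 1 \<or> L (v - 1) < t" "seg_ctx u" "ivar u ''v'' = v"
      using u by (auto simp: A_def B_def)
    have RM: "rval (RE (IVar ''M'')) u = R M" using v M by (subst rval_RE) auto
    have lev: "rvar u ''level'' = t" using v(4) by (simp add: seg_ctx_def)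
    show ?thesis
    proof (rule run_If)
      assume "bval (RLe (RVar ''level'') (RE (IVar ''M''))) u"
      then have "t \<le> R M" using RM lev by (simp only: bval.simps rval.simps(2))
      then have "run inner_start u 2 good_plan"
        using run_inner_start[OF t v(1-3) M(2) M(3)[rule_format] v(4,5)] by simp
      then show "run inner_start u (nat n * 8 + 14) good_plan" by (rule run_mono) auto
    next
      assume "\<not> bval (RLe (RVar ''level'') (RE (IVar ''M''))) u"
      then have "R M < t" using RM lev by (simp only: bval.simps rval.simps(2) not_le)
      then show "run outer_start u (nat n * 8 + 14) good_plan"
        using run_outer_start[OF t v(1-3) M(2) M(3)[rule_format] v(4) M(1)] by simp
    qed
  qed
  have "run choose_plan s (5 + (nat n * 4 + 2 + (1 + (nat n * 4 + 3 + (nat n * 8 + 14 + 1))))) good_plan"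
    unfolding choose_plan_def
  proof (rule run_Seq, rule run_mono[OF 1 order_refl], rule run_Seq, rule run_mono[OF 2 order_refl], assumption, elim exE)
    fix v u assume "A v u"
    show "run (Seq (IAssign ''v'' (IAdd (IVar ''v'') (IConst 1)))
      (Seq (argmin ''M'' (IConst 1) (IVar ''v'') (\<lambda>e. RE e))
       (If (RLe (RVar ''level'') (RE (IVar ''M''))) inner_start outer_start))) u
       (1 + (nat n * 4 + 3 + (nat n * 8 + 14 + 1))) good_plan"
      by (rule run_Seq, rule run_mono[OF 3[OF \<open>A v u\<close>] order_refl], rule run_Seq, rule run_mono[OF 4[of v] order_refl], assumption)
        (rule 5)
  qed
  then show ?thesis by (rule run_mono) auto
qed

end

end

section \<open>Assembling the precomputation\<close>

definition precompute :: com where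
  "precompute = Seq halve (If (ILe (IAdd (IVar ''h'') (IVar ''h'')) (IVar ''n'')) even_plan
     (Seq table (Seq find_base (Seq find_pair (Seq no_jump (Seq choose_segment
       (If (IEq (IVar ''mode'') (IConst 1)) choose_plan Skip)))))))"

context odd_pizza
begin

text \<open>A half-circle meeting the overlap of the second and the third one can replace one of
  them in the covering triple: the second if it starts inside the first half-circle, otherwise the
  third. Lexicographic minimality of the pair then bounds it from below. For the other two segments
  the global minimality of \<open>S j1\<close> is enough.\<close>

lemma segments:
  assumes base: "\<And>j. S j1 \<le> S j" and cov: "covers j1 j2 j3"
    and best: "\<And>a b. covers j1 a b \<Longrightarrow> lex_le (max (S j2) (S j3)) (S j2 + S j3) a b"
    and k: "1 \<le> j2 + h - 1 - j3" "1 \<le> j3 - h - j1" "1 \<le> j1 + h - 1 - j2"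
  shows "segment P h j3 (j2 + h - 1 - j3) (min (S j2) (S j3))"
    and "segment P h j1 (j3 - h - j1) (S j1)"
    and "segment P h j2 (j1 + h - 1 - j2) (S j1)"
proof -
  note c = cov[unfolded covers_def]
  have "min (S j2) (S j3) \<le> S j" if "j \<in> {j3 + 1 - h..j2 + h - 1}" for j
  proof (cases "j < j1 + h")
    case True
    then have "covers j1 j j3" using that c by (auto simp: covers_def)
    from best[OF this] show ?thesis unfolding lex_le_def by linarith
  next
    case False
    then have "covers j1 j2 j" using that c by (auto simp: covers_def)
    from best[OF this] show ?thesis unfolding lex_le_def by linarith
  qed
  then show "segment P h j3 (j2 + h - 1 - j3) (min (S j2) (S j3))"
    using c k by unfold_locales auto
  show "segment P h j1 (j3 - h - j1) (S j1)" "segment P h j2 (j1 + h - 1 - j2) (S j1)"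
    using c k base by unfold_locales auto
qed

lemma chosen_cong:
  assumes "plan_of t = plan_of s" "ivar t ''mode'' = ivar s ''mode''" "ivar t ''bestJ'' = ivar s ''bestJ''"
    "ivar t ''bestk'' = ivar s ''bestk''" "rvar t ''best'' = rvar s ''best''" "rvar t ''level'' = rvar s ''level''"
  shows "chosen t = chosen s"
  unfolding chosen_def assms ..

lemma straight_parts: "straight evaluate" "straight segment1" "straight segment2" "straight segment3"
  "cost evaluate = 12" "cost segment1 \<le> 6" "cost segment2 \<le> 6" "cost segment3 \<le> 6"
  by (simp_all add: evaluate_def segment1_def segment2_def segment3_def)

lemma run_choose_segment:
  assumes s: "ctx s" and base: "ivar s ''base'' = j1" "j1 \<in> {0..<n}" "\<And>j. S j1 \<le> S j"
    and pair: "best_pair j1 s" and no_jump: "ivar s ''mode'' = 0" "ivar s ''start'' \<in> {0..<n}"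
      "rvar s ''best'' = min (rvar s ''gmax'') (sum_list P / 2)" "wins (plan_of s) (rvar s ''best'')"
    and n: "n \<noteq> 1"
  shows "run choose_segment s 60 (\<lambda>t. ctx t \<and> ivar t ''start'' \<in> {0..<n} \<and> chosen t \<and>
    gain_bound (length P) * sum_list P \<le> rvar t ''best'')"
proof -
  have tot: "0 \<le> sum_list P" "rvar s ''total'' = sum_list P"
    using W_mono[of 0 n] n_pos W_n pair by (auto simp: best_pair_def)
  have ch: "chosen s" using no_jump by (simp add: chosen_def)
  show ?thesis
  proof (cases "sum_list P / 2 \<le> rvar s ''gmax''")
    case True
    have "length P \<noteq> 1" using n by (simp add: n_def)
    then have "gain_bound (length P) * sum_list P \<le> 1 / 2 * sum_list P"
      by (intro mult_right_mono) (use tot in \<open>auto simp: gain_bound_def\<close>)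
    then show ?thesis unfolding choose_segment_def
      by (intro run_straightI) (use True s no_jump ch tot straight_parts in \<open>auto simp: min_def\<close>)
  next
    case False
    define j2 j3 where "j2 = ivar s ''j2''" and "j3 = ivar s ''j3''"
    let ?g = "max (S j2) (S j3)"
    have cov: "covers j1 j2 j3" and g: "rvar s ''gmax'' = ?g" "rvar s ''gsum'' = S j2 + S j3"
      and best: "\<And>a b. covers j1 a b \<Longrightarrow> lex_le ?g (S j2 + S j3) a b"
      using pair False tot unfolding best_pair_def j2_def j3_def by auto
    have g2: "2 * ?g < sum_list P" using False g by simp
    note worth = covering_triple_value[OF cov base(3) base(3) refl g2]
    note seg = segments[OF base(3) cov best worth(1-3)]
    note c = cov[unfolded covers_def]
    define s1 where "s1 = result segment1 s"
    define t1 where "t1 = result evaluate s1"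
    define s2 where "s2 = result segment2 t1"
    define t2 where "t2 = result evaluate s2"
    define s3 where "s3 = result segment3 t2"
    define t3 where "t3 = result evaluate s3"
    have SS: "rarr s ''W'' (j2 + h) - rarr s ''W'' j2 = S j2" "rarr s ''W'' (j3 + h) - rarr s ''W'' j3 = S j3"
      "rarr s ''W'' (j1 + h) - rarr s ''W'' j1 = S j1"
      by (rule S_at[OF s]; use c base n_h h_pos in auto)+
    have s1: "same_tables s s1" "ivar s1 ''J'' = j3" "ivar s1 ''k'' = j2 + h - 1 - j3" "rvar s1 ''x'' = min (S j2) (S j3)"
      "rvar s1 ''best'' = rvar s ''best''" "chosen s1 = chosen s"
    proof -
      have eq: "s1 = s\<lparr>ivar := (ivar s)(''J'' := j3, ''k'' := j2 + h - 1 - j3), rvar := (rvar s)(''x'' := min (S j2) (S j3))\<rparr>"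
        using s SS unfolding s1_def segment1_def by (simp add: add_diff_eq ctx_vars j2_def j3_def min_def)
      show "same_tables s s1" "ivar s1 ''J'' = j3" "ivar s1 ''k'' = j2 + h - 1 - j3" "rvar s1 ''x'' = min (S j2) (S j3)"
        "rvar s1 ''best'' = rvar s ''best''" unfolding eq by (simp_all add: same_tables_def)
      show "chosen s1 = chosen s" by (rule chosen_cong) (simp_all add: eq plan_of_def)
    qed
    have c1: "ctx s1" by (rule same_tables_ctx[OF s1(1) s])
    have e1: "same_tables s1 t1" "rvar t1 ''best'' = max (rvar s1 ''best'') (seg_value j3 (j2 + h - 1 - j3) (min (S j2) (S j3)))"
      using result_evaluate(1,2)[OF c1 s1(2,3)] c worth base n_h s1(4) unfolding t1_def by auto
    have ch1: "chosen t1" unfolding t1_def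
      by (rule chosen_evaluate[OF _ c1 s1(2,3)]) (use s1 ch seg c base n_h in auto)
    have st1: "same_tables s t1" by (rule same_tables_trans[OF s1(1) e1(1)])
    have ct1: "ctx t1" by (rule same_tables_ctx[OF st1 s])
    have SS1: "rarr t1 ''W'' (j1 + h) - rarr t1 ''W'' j1 = S j1" "ivar t1 ''base'' = j1" "ivar t1 ''j2'' = j2" "ivar t1 ''j3'' = j3"
      using SS st1 base by (simp_all add: same_tables_def j2_def j3_def)
    have s2: "same_tables t1 s2" "ivar s2 ''J'' = j1" "ivar s2 ''k'' = j3 - h - j1" "rvar s2 ''x'' = S j1"
      "rvar s2 ''best'' = rvar t1 ''best''" "chosen s2 = chosen t1"
    proof -
      have eq: "s2 = t1\<lparr>ivar := (ivar t1)(''J'' := j1, ''k'' := j3 - h - j1), rvar := (rvar t1)(''x'' := S j1)\<rparr>"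
        using ct1 SS1 unfolding s2_def segment2_def by (simp add: ctx_vars)
      show "same_tables t1 s2" "ivar s2 ''J'' = j1" "ivar s2 ''k'' = j3 - h - j1" "rvar s2 ''x'' = S j1"
        "rvar s2 ''best'' = rvar t1 ''best''" unfolding eq by (simp_all add: same_tables_def)
      show "chosen s2 = chosen t1" by (rule chosen_cong) (simp_all add: eq plan_of_def)
    qed
    have c2: "ctx s2" by (rule same_tables_ctx[OF s2(1) ct1])
    have e2: "same_tables s2 t2" "rvar t2 ''best'' = max (rvar s2 ''best'') (seg_value j1 (j3 - h - j1) (S j1))"
      using result_evaluate(1,2)[OF c2 s2(2,3)] c worth base n_h s2(4) unfolding t2_def by auto
    have ch2: "chosen t2" unfolding t2_def
      by (rule chosen_evaluate[OF _ c2 s2(2,3)]) (use s2 ch1 seg c base n_h in auto)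
    have st2: "same_tables s t2" by (rule same_tables_trans[OF st1 same_tables_trans[OF s2(1) e2(1)]])
    have ct2: "ctx t2" by (rule same_tables_ctx[OF st2 s])
    have SS2: "rarr t2 ''W'' (j1 + h) - rarr t2 ''W'' j1 = S j1" "ivar t2 ''base'' = j1" "ivar t2 ''j2'' = j2"
      using SS st2 base by (simp_all add: same_tables_def j2_def)
    have s3: "same_tables t2 s3" "ivar s3 ''J'' = j2" "ivar s3 ''k'' = j1 + h - 1 - j2" "rvar s3 ''x'' = S j1"
      "rvar s3 ''best'' = rvar t2 ''best''" "chosen s3 = chosen t2"
    proof -
      have eq: "s3 = t2\<lparr>ivar := (ivar t2)(''J'' := j2, ''k'' := j1 + h - 1 - j2), rvar := (rvar t2)(''x'' := S j1)\<rparr>"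
        using ct2 SS2 unfolding s3_def segment3_def by (simp add: add_diff_eq ctx_vars)
      show "same_tables t2 s3" "ivar s3 ''J'' = j2" "ivar s3 ''k'' = j1 + h - 1 - j2" "rvar s3 ''x'' = S j1"
        "rvar s3 ''best'' = rvar t2 ''best''" unfolding eq by (simp_all add: same_tables_def)
      show "chosen s3 = chosen t2" by (rule chosen_cong) (simp_all add: eq plan_of_def)
    qed
    have c3: "ctx s3" by (rule same_tables_ctx[OF s3(1) ct2])
    have e3: "same_tables s3 t3" "rvar t3 ''best'' = max (rvar s3 ''best'') (seg_value j2 (j1 + h - 1 - j2) (S j1))"
      using result_evaluate(1,2)[OF c3 s3(2,3)] c worth base n_h s3(4) unfolding t3_def by auto
    have ch3: "chosen t3" unfolding t3_def
      by (rule chosen_evaluate[OF _ c3 s3(2,3)]) (use s3 ch2 seg c base n_h in auto)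
    have st3: "same_tables s t3" by (rule same_tables_trans[OF st2 same_tables_trans[OF s3(1) e3(1)]])
    have "rvar s ''best'' = ?g" using no_jump(3) g g2 by simp
    then have "gain_bound (length P) * sum_list P \<le> rvar t3 ''best''"
      using worth(4) unfolding e3(2) s3(5) e2(2) s2(5) e1(2) s1(5) by linarith
    moreover have "result choose_segment s = t3"
      using False tot by (simp add: choose_segment_def t3_def s3_def t2_def s2_def t1_def s1_def)
    moreover have "ctx t3" by (rule same_tables_ctx[OF st3 s])
    moreover have "ivar t3 ''start'' \<in> {0..<n}" using st3 no_jump(2) by (simp add: same_tables_def)
    ultimately show ?thesis using ch3
      by (intro run_straightI) (use straight_parts in \<open>auto simp: choose_segment_def\<close>)
  qed
qed

lemma level_bounds: "level J k \<le> inner_sum J k" "k = 1 \<or> 4 * level J k \<le> 2 * inner_sum J k + outer_sum J k" if "1 \<le> k"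
  using that by (auto simp: level_def min_def)

lemma run_odd:
  assumes s: "loaded s" "ivar s ''h'' = h"
  shows "run (Seq table (Seq find_base (Seq find_pair (Seq no_jump (Seq choose_segment
       (If (IEq (IVar ''mode'') (IConst 1)) choose_plan Skip)))))) s (nat n * 65 + 117)
    (\<lambda>t. ivar t ''n'' = n \<and> ivar t ''start'' \<in> {0..<n} \<and> wins (plan_of t) (gain_bound (length P) * sum_list P))"
    (is "run ?prog s _ ?Q")
proof -
  let ?A = "\<lambda>j1 t. ctx t \<and> ivar t ''base'' = j1 \<and> j1 \<in> {0..<n} \<and> (\<forall>j. S j1 \<le> S j)"
  let ?B = "\<lambda>j1 t. ?A j1 t \<and> best_pair j1 t"
  let ?D = "\<lambda>j1 t. ?B j1 t \<and> ivar t ''mode'' = 0 \<and> ivar t ''start'' \<in> {0..<n} \<and>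
    rvar t ''best'' = min (rvar t ''gmax'') (sum_list P / 2) \<and> wins (plan_of t) (rvar t ''best'') \<and>
    (n = 1 \<longrightarrow> wins (plan_of t) (sum_list P))"
  have gb1: "n = 1 \<Longrightarrow> gain_bound (length P) = 1" by (simp add: n_def gain_bound_def)
  \<comment> \<open>The variable \<open>best\<close> is capped at half of the pizza, but for
    \<open>n = 1\<close> the claim is the whole pizza; this case is carried along as an alternative
    of its own.\<close>
  let ?E = "\<lambda>t. ctx t \<and> ivar t ''start'' \<in> {0..<n} \<and> (n = 1 \<and> ivar t ''mode'' = 0 \<and> wins (plan_of t) (sum_list P) \<or>
    chosen t \<and> gain_bound (length P) * sum_list P \<le> rvar t ''best'')"
  have 1: "run find_base t (nat n * 4 + 3) (\<lambda>t. \<exists>j1. ?A j1 t)" if "ctx t" for t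
    by (rule run_mono[OF run_find_base[OF that]]) auto
  have 2: "run find_pair t (nat n * 14 + 5) (?B j1)" if "?A j1 t" for j1 t
    using that by (intro run_mono[OF run_find_pair[of t j1]]) auto
  have 3: "run no_jump t (nat n * 4 + 9) (?D j1)" if "?B j1 t" for j1 t
    using that by (intro run_mono[OF run_no_jump[of t j1]]) auto
  have 4: "run choose_segment t 60 ?E" if t: "?D j1 t" for j1 t
  proof (cases "n = 1")
    case True
    have nc: "\<not> covers j1 a b" for a b using True n_h unfolding covers_def by linarith
    have tot: "0 \<le> sum_list P" using W_mono[of 0 n] n_pos W_n by simp
    have "sum_list P / 2 \<le> rvar t ''gmax''" "rvar t ''total'' = sum_list P"
      using t nc tot unfolding best_pair_def by auto
    then show ?thesis unfolding choose_segment_def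
      by (intro run_straightI) (use True t straight_parts in auto)
  next
    case False
    show ?thesis by (rule run_mono[OF run_choose_segment[of t j1]]) (use t False in auto)
  qed
  have 5: "run (If (IEq (IVar ''mode'') (IConst 1)) choose_plan Skip) t (nat n * 16 + 26 + 1) ?Q" if t: "?E t" for t
  proof (rule run_If)
    assume "bval (IEq (IVar ''mode'') (IConst 1)) t"
    then have mode: "ivar t ''mode'' = 1" by simp
    then obtain J k x where J: "ivar t ''bestJ'' = J" "ivar t ''bestk'' = k" "segment P h J k x"
      "rvar t ''level'' = level J k" "rvar t ''best'' = seg_value J k x" "0 \<le> J" "J + h + k \<le> 3 * n"
      and le: "gain_bound (length P) * sum_list P \<le> rvar t ''best''"
      using t unfolding chosen_def by auto
    interpret seg: segment P h J k x "level J k" by (rule J(3))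
    have "seg.target = seg_value J k x" by (simp add: seg.target_def seg_value_def outer_sum_def)
    then show "run choose_plan t (nat n * 16 + 26) ?Q"
      using t le J(5) level_bounds[OF seg.k(1), of J] unfolding inner_sum_def outer_sum_def
      by (intro run_mono[OF seg.run_choose_plan[OF J(6,7) _ J(1,2,4)]]) (auto intro: wins_mono)
  next
    assume "\<not> bval (IEq (IVar ''mode'') (IConst 1)) t"
    then have "ivar t ''mode'' \<noteq> 1" by auto
    then have "?Q t" using t gb1 unfolding chosen_def by (auto intro: wins_mono simp: ctx_vars)
    then show "run Skip t (nat n * 16 + 26) ?Q" by (intro run_straightI) auto
  qed
  have 6: "run (Seq no_jump (Seq choose_segment (If (IEq (IVar ''mode'') (IConst 1)) choose_plan Skip))) t
      (nat n * 4 + 9 + (60 + (nat n * 16 + 26 + 1))) ?Q" if "?B j1 t" for j1 t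
    by (rule run_Seq, rule run_mono[OF 3[OF that] order_refl], rule run_Seq, rule run_mono[OF 4[where ?j1.0 = j1] order_refl], assumption, rule 5)
  have "run ?prog s (nat n * 27 + 13 + (nat n * 4 + 3 + (nat n * 14 + 5 + (nat n * 4 + 9 + (60 + (nat n * 16 + 26 + 1)))))) ?Q"
  proof (rule run_Seq, rule run_mono[OF run_table[OF s] order_refl], rule run_Seq, rule run_mono[OF 1 order_refl], assumption, elim exE)
    fix t j1 assume A: "?A j1 t"
    show "run (Seq find_pair (Seq no_jump (Seq choose_segment (If (IEq (IVar ''mode'') (IConst 1)) choose_plan Skip)))) t
      (nat n * 14 + 5 + (nat n * 4 + 9 + (60 + (nat n * 16 + 26 + 1)))) ?Q"
      by (rule run_Seq, rule run_mono[OF 2[OF A] order_refl], rule 6)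
  qed
  then show ?thesis by (rule run_mono) auto
qed

end

lemma (in pizza) run_precompute:
  "run precompute (input P) (nat n * 69 + 120)
    (\<lambda>t. ivar t ''n'' = n \<and> ivar t ''start'' \<in> {0..<n} \<and> wins (plan_of t) (gain_bound (length P) * sum_list P))"
    (is "run _ _ _ ?Q")
proof -
  define h where "h = (n + 1) div 2"
  have load: "loaded (input P)" by (auto simp: loaded_def input_def n_def slice_def)
  have 1: "run halve (input P) (nat n * 4 + 2) (\<lambda>t. loaded t \<and> ivar t ''h'' = h)"
    by (rule run_mono[OF run_halve[of _ n]]) (use load n_pos in \<open>auto simp: loaded_def h_def input_def\<close>)
  have 2: "run (If (ILe (IAdd (IVar ''h'') (IVar ''h'')) (IVar ''n'')) even_plan
     (Seq table (Seq find_base (Seq find_pair (Seq no_jump (Seq choose_segment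
       (If (IEq (IVar ''mode'') (IConst 1)) choose_plan Skip))))))) t (nat n * 65 + 117 + 1) ?Q"
    if t: "loaded t \<and> ivar t ''h'' = h" for t
  proof (rule run_If)
    assume "bval (ILe (IAdd (IVar ''h'') (IVar ''h'')) (IVar ''n'')) t"
    then have "n = 2 * h" using t by (simp add: loaded_def h_def)
    then have len: "even (length P)" by (simp add: n_def) presburger
    have gb: "gain_bound (length P) = 1 / 2" using len by (auto simp: gain_bound_def)
    have e: "run even_plan t (nat h * 4 + 7) (\<lambda>t. ivar t ''n'' = n \<and> ivar t ''start'' \<in> {0..<n} \<and>
        wins (plan_of t) (1 / 2 * sum_list P))"
      by (rule run_even_plan) (use t \<open>n = 2 * h\<close> in auto)
    show "run even_plan t (nat n * 65 + 117) ?Q"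
      unfolding gb by (rule run_mono[OF e]) (use \<open>n = 2 * h\<close> in auto)
  next
    assume "\<not> bval (ILe (IAdd (IVar ''h'') (IVar ''h'')) (IVar ''n'')) t"
    then have "n = 2 * h - 1" using t by (simp add: loaded_def h_def)
    then interpret odd_pizza P h by unfold_locales
    show "run (Seq table (Seq find_base (Seq find_pair (Seq no_jump (Seq choose_segment
       (If (IEq (IVar ''mode'') (IConst 1)) choose_plan Skip)))))) t (nat n * 65 + 117) ?Q"
      using run_odd t by blast
  qed
  have "run precompute (input P) (nat n * 4 + 2 + (nat n * 65 + 117 + 1)) ?Q"
    unfolding precompute_def by (rule run_Seq, rule run_mono[OF 1 order_refl], rule 2)
  then show ?thesis by (rule run_mono) auto
qed

theorem theorem6:
  "\<exists>(pre :: com) (turn :: com) (T :: nat \<Rightarrow> nat) (C :: nat).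
     (\<lambda>n. real (T n)) \<in> O(\<lambda>n. real n) \<and>
     (\<forall>P. cutting P \<longrightarrow>
        (\<exists>k s. exec pre (input P) k s \<and> k \<le> T (length P)) \<and>
        (\<forall>xs s. reachable pre turn P xs s \<and> even (length xs) \<and> length xs < length P \<longrightarrow>
           (\<exists>k t i. exec turn (observe xs s) k t \<and> k \<le> C \<and>
              answer t = int i \<and> legal_move (length P) xs i)) \<and>
        (\<forall>xs s. reachable pre turn P xs s \<and> length xs = length P \<longrightarrow>
           alice_jumps (length P) xs \<le> 2 \<and>
           alice_gain P xs \<ge> gain_bound (length P) * sum_list P))"
proof (rule exI[of _ precompute], rule exI[of _ turn], rule exI[of _ "\<lambda>n. n * 69 + 120"], rule exI[of _ 20],
    intro conjI allI impI)
  show "(\<lambda>n. real (n * 69 + 120)) \<in> O(\<lambda>n. real n)"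
    by (rule bigoI[of _ 189]) (auto simp: eventually_at_top_linorder intro!: exI[of _ 1])
next
  fix P assume "cutting P"
  then interpret pizza P by unfold_locales
  have pre: "run precompute (input P) (length P * 69 + 120) (\<lambda>s. \<exists>q. knows n q s \<and> ivar s ''phase'' = first_phase q \<and>
      first_slice q \<in> {0..<n} \<and> wins q (gain_bound (length P) * sum_list P))"
  proof (rule run_mono[OF run_precompute])
    fix t assume t: "ivar t ''n'' = n \<and> ivar t ''start'' \<in> {0..<n} \<and> wins (plan_of t) (gain_bound (length P) * sum_list P)"
    then have "knows n (plan_of t) t" by (simp add: knows_plan_of)
    moreover have "first_phase (plan_of t) = ivar t ''phase''" "first_slice (plan_of t) = ivar t ''start''"
      by (simp_all add: plan_of_def)
    ultimately show "\<exists>q. knows n q t \<and> ivar t ''phase'' = first_phase q \<and>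
      first_slice q \<in> {0..<n} \<and> wins q (gain_bound (length P) * sum_list P)" using t by metis
  qed (simp add: n_def)
  note play = play_by_plan[OF pre]
  show "\<exists>k s. exec precompute (input P) k s \<and> k \<le> length P * 69 + 120" by (rule play(1))
  show "\<exists>k t i. exec turn (observe xs s) k t \<and> k \<le> 20 \<and> answer t = int i \<and> legal_move (length P) xs i"
    if "reachable precompute turn P xs s \<and> even (length xs) \<and> length xs < length P" for xs s
    using play(2) that by blast
  show "alice_jumps (length P) xs \<le> 2" "alice_gain P xs \<ge> gain_bound (length P) * sum_list P"
    if "reachable precompute turn P xs s \<and> length xs = length P" for xs s
    using play(3) that by blast+
qed

end
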